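(* Let $m>n>1$ be integers and $0<r<1$ be such that $\frac{\log r}{\log m}\notin\mathbb{Q}$ and $\frac{\log r}{\log n}\notin\mathbb{Q}$. Let $\mu\in\mathcal{P}([0,1]^2)$ be a self-similar measure $\mu=\sum_{k=1}^l p_k\,\phi_k\mu$ (with all $p_k>0$, $\sum p_k=1$) with respect to an IFS $\Phi=\{\phi_k(x)=r\,O_k x+t_k\}_{k=1}^l$ on $\mathbb{R}^2$, where each $O_k$ is a $2\times2$ rotation matrix and $t_k\in\mathbb{R}^2$, such that: (1) $\Phi$ satisfies the strong separation condition, has uniform contraction ratio $r$, $\operatorname{supp}(\mu)$ does not lie on a vertical or horizontal line, and $G_\Phi\leq SO(\mathbb{R}^2)$; (2) either $|G_\Phi|<\infty$ or $\dim\mu>1$; (3) if $k_\Phi<\infty$, then for every integer $q\neq 0$, neither $\frac{q}{\log m}$ nor $\frac{q}{\log n}$ belongs to $\mathbb{Z}\cdot\frac{\gamma_\Phi}{\log r\cdot k_\Phi}$. Then $\mu$ is pointwise generic for $\lambda\times\lambda$ under the map $T_m\times T_n$.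
   Context: $T_q(x)=qx\bmod 1$; $T_m\times T_n$ acts coordinatewise on $[0,1]^2\cong\mathbb{T}^2$; $\lambda$ is Lebesgue measure on $[0,1]$. The attractor $X$ of $\Phi$ is the unique nonempty compact set with $X=\bigcup_k\phi_k(X)$; $\Phi$ satisfies the strong separation condition if this union is disjoint. $D\Phi=\{O_k\}_{k=1}^l$, $G_\Phi$ is the subgroup of $SO(\mathbb{R}^2)$ generated by $D\Phi$. $k_\Phi=\min\{k\in\mathbb{N}: O^k=O'^k \text{ for all } O,O'\in D\Phi\}$ (with $\min\emptyset=\infty$); if $k_\Phi<\infty$, $\gamma_\Phi\in[0,2\pi)$ is the unique angle such that $O^{k_\Phi}$ is rotation by $\gamma_\Phi$ for every $O\in D\Phi$. $\dim\mu=\inf\{\dim_H A:\mu(A)>0\}$. A measure $\mu$ is pointwise generic under $T$ for $\rho$ if for $\mu$-a.e. $z$, $\frac1N\sum_{k=0}^{N-1}f(T^kz)\to\int f\,d\rho$ for all $f\in C(\mathbb{T}^2)$. *)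

theory Defs
  imports "HOL-Probability.Probability"
begin

definition rot_by :: "real \<Rightarrow> real^2^2" where
  "rot_by g = vector [vector [cos g, - sin g], vector [sin g, cos g]]"

fun matpow :: "real^2^2 \<Rightarrow> nat \<Rightarrow> real^2^2" where
  "matpow A 0 = mat 1"
| "matpow A (Suc k) = A ** matpow A k"

definition sim_map :: "real \<Rightarrow> (nat \<Rightarrow> real^2^2) \<Rightarrow> (nat \<Rightarrow> real^2) \<Rightarrow> nat \<Rightarrow> real^2 \<Rightarrow> real^2" where
  "sim_map r Q t k x = r *\<^sub>R (Q k *v x) + t k"

definition attractor :: "nat \<Rightarrow> (nat \<Rightarrow> real^2 \<Rightarrow> real^2) \<Rightarrow> (real^2) set" where
  "attractor l \<phi> = (THE X. X \<noteq> {} \<and> compact X \<and> X = (\<Union>k<l. \<phi> k ` X))"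

definition strong_separation :: "nat \<Rightarrow> (nat \<Rightarrow> real^2 \<Rightarrow> real^2) \<Rightarrow> bool" where
  "strong_separation l \<phi> \<longleftrightarrow>
     (\<forall>i<l. \<forall>j<l. i \<noteq> j \<longrightarrow> \<phi> i ` attractor l \<phi> \<inter> \<phi> j ` attractor l \<phi> = {})"

definition DPhi :: "nat \<Rightarrow> (nat \<Rightarrow> real^2^2) \<Rightarrow> (real^2^2) set" where
  "DPhi l Q = Q ` {..<l}"

inductive_set gen_group :: "(real^2^2) set \<Rightarrow> (real^2^2) set" for D where
  gen_one: "mat 1 \<in> gen_group D"
| gen_mult: "A \<in> gen_group D \<Longrightarrow> B \<in> D \<Longrightarrow> A ** B \<in> gen_group D"
| gen_inv: "A \<in> gen_group D \<Longrightarrow> B \<in> D \<Longrightarrow> A ** matrix_inv B \<in> gen_group D"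

definition kPhi_pred :: "nat \<Rightarrow> (nat \<Rightarrow> real^2^2) \<Rightarrow> nat \<Rightarrow> bool" where
  "kPhi_pred l Q k \<longleftrightarrow> (\<forall>A\<in>DPhi l Q. \<forall>B\<in>DPhi l Q. matpow A k = matpow B k)"

definition kPhi :: "nat \<Rightarrow> (nat \<Rightarrow> real^2^2) \<Rightarrow> enat" where
  "kPhi l Q = (if \<exists>k>0. kPhi_pred l Q k then enat (LEAST k. k > 0 \<and> kPhi_pred l Q k) else \<infinity>)"

definition gammaPhi :: "nat \<Rightarrow> (nat \<Rightarrow> real^2^2) \<Rightarrow> real" where
  "gammaPhi l Q = (THE g. 0 \<le> g \<and> g < 2 * pi \<and>
      (\<forall>A\<in>DPhi l Q. matpow A (the_enat (kPhi l Q)) = rot_by g))"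

definition msupp :: "(real^2) measure \<Rightarrow> (real^2) set" where
  "msupp \<mu> = {x. \<forall>e>0. emeasure \<mu> (ball x e) > 0}"

definition hausdorff_pre :: "real \<Rightarrow> real \<Rightarrow> (real^2) set \<Rightarrow> ennreal" where
  "hausdorff_pre s \<delta> A = (INF U \<in> {U :: nat \<Rightarrow> (real^2) set.
       A \<subseteq> (\<Union>i. U i) \<and> (\<forall>i. bounded (U i) \<and> diameter (U i) \<le> \<delta>)}.
       (\<Sum>i. ennreal (diameter (U i) powr s)))"

definition hausdorff_measure :: "real \<Rightarrow> (real^2) set \<Rightarrow> ennreal" where
  "hausdorff_measure s A = (SUP \<delta> \<in> {0<..}. hausdorff_pre s \<delta> A)"

definition hausdorff_dim :: "(real^2) set \<Rightarrow> real" where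
  "hausdorff_dim A = Inf {s. s > 0 \<and> hausdorff_measure s A = 0}"

definition measure_dim :: "(real^2) measure \<Rightarrow> real" where
  "measure_dim \<mu> = Inf {hausdorff_dim A | A. A \<in> sets \<mu> \<and> emeasure \<mu> A > 0}"

definition Tmn :: "nat \<Rightarrow> nat \<Rightarrow> real^2 \<Rightarrow> real^2" where
  "Tmn m n z = (\<chi> i. frac (real (if i = 1 then m else n) * z $ i))"

definition torus_continuous :: "(real^2 \<Rightarrow> real) \<Rightarrow> bool" where
  "torus_continuous f \<longleftrightarrow> continuous_on UNIV f \<and> (\<forall>x i. f (x + axis i 1) = f x)"

definition leb_square :: "(real^2) measure" where
  "leb_square = restrict_space lborel (cbox 0 One)"

definition pointwise_generic :: "(real^2) measure \<Rightarrow> (real^2 \<Rightarrow> real^2) \<Rightarrow> (real^2) measure \<Rightarrow> bool" where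
  "pointwise_generic \<mu> T \<rho> \<longleftrightarrow>
     (AE z in \<mu>. \<forall>f. torus_continuous f \<longrightarrow>
        (\<lambda>N. (\<Sum>k<N. f ((T ^^ k) z)) / real N) \<longlonglongrightarrow> integral\<^sup>L \<rho> f)"

end

theory Submission
  imports Defs
begin

text \<open>
  Identify the plane with the complex numbers, so that the maps become \<open>z \<mapsto> r c\<^sub>k z + \<tau>\<^sub>k\<close> with
  \<open>\<bar>c\<^sub>k\<bar> = 1\<close>. By Weyl's criterion it suffices that, almost surely, the averages of the characters
  \<open>exp (i Re (\<eta>\<^sub>k z))\<close> tend to \<open>0\<close>, where \<open>\<eta>\<^sub>k\<close> grows like \<open>\<eta>\<^sub>0 \<kappa>\<^sup>k\<close> with \<open>\<kappa>\<close> one of \<open>m\<close>, \<open>n\<close> and \<open>\<eta>\<^sub>0\<close>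
  is real or purely imaginary.

  Replace the \<open>k\<close>-th character by its mean over the cylinder of generation \<open>L k\<close> containing the
  point, where \<open>\<kappa>\<^sup>k r\<^sup>L\<^sup>k\<close> stays bounded: the errors are quasi-orthogonal, so their averages vanish
  almost surely (Borel--Cantelli along squares). The means are values of the characteristic
  function at \<open>\<eta>\<^sub>k r\<^sup>L\<^sup>k c\<^sub>w\<close>, with \<open>c\<^sub>w\<close> a product of \<open>L k\<close> of the \<open>c\<^sub>j\<close>, and only their size matters.

  If some \<open>c\<^sub>a / c\<^sub>b\<close> is not a root of unity, then the random walk on the circle makes the characteristic
  function vanish at infinity. Otherwise \<open>c\<^sub>w\<close> is a power of \<open>c\<^sub>0\<close> up to finitely many factors. The group
  generated by \<open>\<kappa>\<close> and \<open>r c\<^sub>0\<close> is not discrete, since \<open>ln r / ln \<kappa>\<close> is irrational, so its closure contains a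
  one-parameter group \<open>exp (t u)\<close>; a suitable choice of \<open>L\<close> lets the frequencies run along arcs of it.
  If the arcs are curved, averages over them decay because points are null sets, by van der Corput's
  method. If they are straight, there are only finitely many directions, and one uses that the lines
  orthogonal to them are null sets.
\<close>

section \<open>Weyl's criterion on the two-dimensional torus\<close>

text \<open>The generations \<open>L k\<close> are free as long as
  \<open>\<kappa> ^ k * r ^ L k\<close> stays between two positive constants; \<open>L\<close> need
  not even be monotone. This freedom drives the commensurable case, where the characteristic
  function may fail to vanish at infinity, so that single means can stay large and only averages
  over k can be small. In a block of length M q, passing from k to k + q adds j generations. This
  multiplies the frequency by \<open>\<kappa> ^ q * (r * c 0) ^ j\<close> = exp \<gamma> with
  \<gamma> close to u / M or - u / M, so M such steps trace an arc exp (t u) or exp (- t u), 0 \<le>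
  t \<le> 1. The size bounds then depend on \<epsilon>, which is harmless because \<epsilon> is
  fixed until the last limit. The rotation of the cylinder depends on the point, so smallness is
  demanded for all choices of rotations at once: after division by a power of \<open>c 0\<close>
  finitely many quotients remain, and one sums over all of them. Averages along arcs are treated
  through the squared modulus of the characteristic function, the expected character of the
  difference of two independent points: few differences are nearly invisible to the arc, all others
  oscillate.\<close>

definition tchar :: "int \<Rightarrow> int \<Rightarrow> real^2 \<Rightarrow> complex" where
  "tchar a b z = cis (2 * pi * (of_int a * z $ 1 + of_int b * z $ 2))"

inductive trig_poly :: "(real^2 \<Rightarrow> complex) \<Rightarrow> bool" where
  monom: "trig_poly (\<lambda>z. c * tchar a b z)"
| add: "trig_poly f \<Longrightarrow> trig_poly g \<Longrightarrow> trig_poly (\<lambda>z. f z + g z)"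

lemma tchar_mult: "tchar a b z * tchar a' b' z = tchar (a + a') (b + b') z"
  by (simp add: tchar_def cis_mult algebra_simps)

lemma trig_poly_mult:
  assumes "trig_poly f" "trig_poly g"
  shows "trig_poly (\<lambda>z. f z * g z)"
  using assms
proof (induction arbitrary: g)
  case (monom c a b)
  from monom show ?case
  proof induction
    case (monom d a' b')
    have "trig_poly (\<lambda>z. (c * d) * tchar (a + a') (b + b') z)" by (rule trig_poly.monom)
    then show ?case by (simp flip: tchar_mult add: ac_simps)
  next
    case (add f g)
    from trig_poly.add[OF add.IH] show ?case by (simp add: algebra_simps)
  qed
next
  case (add f1 f2)
  from trig_poly.add[OF add.IH(1)[OF add.prems] add.IH(2)[OF add.prems]]
  show ?case by (simp add: algebra_simps)
qed

text \<open>Puts the torus as a compact set into a Euclidean space, the setting of the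
  Stone-Weierstrass theorem for real polynomials.\<close>

definition torus_embed :: "real^2 \<Rightarrow> complex \<times> complex" where
  "torus_embed z = (cis (2 * pi * z $ 1), cis (2 * pi * z $ 2))"

text \<open>A linear functional of the embedded point is a combination of cosines and sines, hence
  of characters with frequencies 1 and -1; products are covered by
  \<open>trig_poly_mult\<close>.\<close>

lemma trig_poly_torus_embed:
  assumes "real_polynomial_function g"
  shows "trig_poly (\<lambda>z. complex_of_real (g (torus_embed z)))"
  using assms
proof induction
  case (linear f)
  have decomp: "f (u, v) = Re u * f (1, 0) + Im u * f (\<i>, 0) + Re v * f (0, 1) + Im v * f (0, \<i>)" for u v
  proof -
    have "(u, v) = Re u *\<^sub>R (1, 0) + Im u *\<^sub>R (\<i>, 0) + Re v *\<^sub>R (0, 1) + Im v *\<^sub>R (0, \<i>)"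
      by (simp add: complex_eq_iff)
    then have "f (u, v) = f (Re u *\<^sub>R (1, 0) + Im u *\<^sub>R (\<i>, 0) + Re v *\<^sub>R (0, 1) + Im v *\<^sub>R (0, \<i>))"
      by (rule arg_cong)
    also have "\<dots> = Re u * f (1, 0) + Im u * f (\<i>, 0) + Re v * f (0, 1) + Im v * f (0, \<i>)"
      using linear by (simp only: bounded_linear.linear linear_add linear_cmul real_scaleR_def)
    finally show ?thesis .
  qed
  have lin: "trig_poly (\<lambda>z. complex_of_real (\<alpha> * cos (2 * pi * z $ 1) + \<beta> * sin (2 * pi * z $ 1)))"
            "trig_poly (\<lambda>z. complex_of_real (\<alpha> * cos (2 * pi * z $ 2) + \<beta> * sin (2 * pi * z $ 2)))" for \<alpha> \<beta> :: real
  proof -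
    have *: "complex_of_real (\<alpha> * cos t + \<beta> * sin t)
        = Complex (\<alpha>/2) (- \<beta>/2) * cis t + Complex (\<alpha>/2) (\<beta>/2) * cis (- t)" for t
      by (simp add: complex_eq_iff)
    have "trig_poly (\<lambda>z. Complex (\<alpha>/2) (- \<beta>/2) * tchar 1 0 z + Complex (\<alpha>/2) (\<beta>/2) * tchar (-1) 0 z)"
      "trig_poly (\<lambda>z. Complex (\<alpha>/2) (- \<beta>/2) * tchar 0 1 z + Complex (\<alpha>/2) (\<beta>/2) * tchar 0 (-1) z)"
      by (intro trig_poly.intros)+
    then show "trig_poly (\<lambda>z. complex_of_real (\<alpha> * cos (2 * pi * z $ 1) + \<beta> * sin (2 * pi * z $ 1)))"
            "trig_poly (\<lambda>z. complex_of_real (\<alpha> * cos (2 * pi * z $ 2) + \<beta> * sin (2 * pi * z $ 2)))"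
      unfolding * by (simp_all add: tchar_def)
  qed
  have eq: "complex_of_real (f (torus_embed z))
     = complex_of_real (f (1, 0) * cos (2 * pi * z $ 1) + f (\<i>, 0) * sin (2 * pi * z $ 1))
     + complex_of_real (f (0, 1) * cos (2 * pi * z $ 2) + f (0, \<i>) * sin (2 * pi * z $ 2))" for z
    unfolding torus_embed_def decomp[of "cis _"] by simp
  show ?case unfolding eq by (intro trig_poly.add lin)
next
  case (const c)
  have "trig_poly (\<lambda>z. of_real c * tchar 0 0 z)" by (rule trig_poly.monom)
  then show ?case by (simp add: tchar_def)
next
  case (add f g)
  then show ?case by (auto intro: trig_poly.add)
next
  case (mult f g)
  then show ?case by (auto intro: trig_poly_mult)
qed

lemma periodic_of_int:
  fixes f :: "'a::real_vector \<Rightarrow> 'b"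
  assumes "\<And>x. f (x + v) = f x"
  shows "f (x + of_int k *\<^sub>R v) = f x"
proof (induction k arbitrary: x rule: int_induct[where k = 0])
  case base
  then show ?case by simp
next
  case (step1 i)
  have "f (x + of_int (i + 1) *\<^sub>R v) = f ((x + of_int i *\<^sub>R v) + v)" by (simp add: algebra_simps)
  with step1 assms show ?case by simp
next
  case (step2 i)
  have "f (x + of_int (i - 1) *\<^sub>R v) = f ((x + of_int (i - 1) *\<^sub>R v) + v)" by (rule assms[symmetric])
  also have "\<dots> = f (x + of_int i *\<^sub>R v)" by (simp add: algebra_simps)
  finally show ?case using step2 by simp
qed

lemma torus_continuous_of_int:
  assumes "torus_continuous f" "z $ 1 - z' $ 1 \<in> \<int>" "z $ 2 - z' $ 2 \<in> \<int>"
  shows "f z = f z'"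
proof -
  obtain a b where ab: "z $ 1 - z' $ 1 = of_int a" "z $ 2 - z' $ 2 = of_int b"
    using assms by (auto elim!: Ints_cases)
  have "z = z' + of_int a *\<^sub>R axis 1 1 + of_int b *\<^sub>R axis 2 1"
    using ab by (simp add: vec_eq_iff forall_2 axis_def algebra_simps)
  moreover have "f (x + of_int k *\<^sub>R axis i 1) = f x" for x i k
    using assms(1) by (intro periodic_of_int) (auto simp: torus_continuous_def)
  ultimately show ?thesis by simp
qed

lemma cis_2pi_eq_iff: "cis (2 * pi * x) = cis (2 * pi * y) \<longleftrightarrow> x - y \<in> \<int>"
proof -
  have "cis (2 * pi * x) = cis (2 * pi * y) \<longleftrightarrow> cis (2 * pi * (x - y)) = 1"
    by (simp add: right_diff_distrib flip: cis_divide)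
  also have "\<dots> \<longleftrightarrow> x - y \<in> \<int>"
    unfolding cis_conv_exp exp_eq_1 by (auto simp: Ints_def)
  finally show ?thesis .
qed

lemma continuous_vector_2: "continuous_on A (\<lambda>p::real \<times> real. vector [fst p, snd p] :: real^2)"
proof -
  have "(\<lambda>p::real \<times> real. vector [fst p, snd p] :: real^2) = (\<lambda>p. fst p *\<^sub>R axis 1 1 + snd p *\<^sub>R axis 2 1)"
    by (auto simp: fun_eq_iff vec_eq_iff forall_2 axis_def)
  then show ?thesis by (simp only:) (intro continuous_intros)
qed

lemma One_nth_2: "(\<Sum>b\<in>(Basis :: (real^2) set). b $ i) = 1"
proof -
  have "axis 1 1 \<noteq> (axis 2 1 :: real^2)" by (simp add: axis_eq_axis)
  then show ?thesis using exhaust_2[of i] by (auto simp: Basis_vec_def UNIV_2) (auto simp: axis_def)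
qed

text \<open>A periodic function descends to the image of the embedding. It is continuous there
  because a continuous map on a compact set is closed, so Stone-Weierstrass applies on the
  image.\<close>

lemma torus_continuous_approx:
  assumes f: "torus_continuous f" and "\<epsilon> > 0"
  obtains g where "trig_poly g" "\<And>z. cmod (of_real (f z) - g z) < \<epsilon>"
proof -
  define K where "K = cbox (0::real^2) One"
  \<comment> \<open>Any preimage serves: two of them differ by an integer vector, under which
    \<open>f\<close> is invariant.\<close>
  define F where "F = (\<lambda>p. f (SOME z. torus_embed z = p))"
  have F: "F (torus_embed z) = f z" for z
  proof -
    have "torus_embed (SOME z'. torus_embed z' = torus_embed z) = torus_embed z"
      by (rule someI[of _ z]) simp
    then show ?thesis unfolding F_def
      by (intro torus_continuous_of_int[OF f]) (auto simp: torus_embed_def cis_2pi_eq_iff)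
  qed
  have ce: "continuous_on A torus_embed" for A
    unfolding torus_embed_def by (intro continuous_intros)
  have compact: "compact K" by (simp add: K_def)
  define T where "T = torus_embed ` K"
  have "closed (F -` B \<inter> T)" if "closed B" for B
  proof -
    have "continuous_on K f" using f unfolding torus_continuous_def by (auto intro: continuous_on_subset)
    then have "compact (f -` B \<inter> K)"
      using that compact by (metis closed_vimage_Int compact_Int_closed compact_imp_closed inf_commute inf_left_idem)
    then have "compact (torus_embed ` (f -` B \<inter> K))"
      by (rule compact_continuous_image[OF ce])
    moreover have "torus_embed ` (f -` B \<inter> K) = F -` B \<inter> T"
      unfolding T_def by (auto simp: F)
    ultimately show ?thesis by (simp add: compact_imp_closed)
  qed
  moreover have cT: "compact T" unfolding T_def by (rule compact_continuous_image[OF ce compact])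
  ultimately have "continuous_on T F"
    by (subst continuous_on_closed_vimage) (auto simp: compact_imp_closed)
  then obtain g where g: "real_polynomial_function g" "\<And>x. x \<in> T \<Longrightarrow> \<bar>F x - g x\<bar> < \<epsilon>"
    using Stone_Weierstrass_real_polynomial_function[OF cT _ \<open>\<epsilon> > 0\<close>] by metis
  have "cmod (of_real (f z) - of_real (g (torus_embed z))) < \<epsilon>" for z
  proof -
    \<comment> \<open>The approximation holds only on the image of \<open>K\<close>; fractional
      parts bring any point into \<open>K\<close> without changing its image.\<close>
    define z' :: "real^2" where "z' = (\<chi> i. frac (z $ i))"
    have "torus_embed z = torus_embed z'"
      by (auto simp: torus_embed_def cis_2pi_eq_iff z'_def frac_def)
    moreover have "z' \<in> K"
      unfolding K_def z'_def by (auto simp: mem_box_cart frac_ge_0 frac_lt_1 less_imp_le One_nth_2)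
    ultimately have "torus_embed z \<in> T" unfolding T_def by auto
    from g(2)[OF this] show ?thesis unfolding F by (metis norm_of_real of_real_diff)
  qed
  then show ?thesis by (intro that[OF trig_poly_torus_embed[OF g(1)]])
qed

section \<open>Fourier coefficients of Lebesgue measure on the unit square\<close>

lemma lborel_vector_2:
  "(lborel :: (real^2) measure) = distr (lborel \<Otimes>\<^sub>M lborel) borel (\<lambda>p. vector [fst p, snd p])"
proof (rule lborel_eqI)
  define V :: "real \<times> real \<Rightarrow> real^2" where "V p = vector [fst p, snd p]" for p
  have "continuous_on UNIV V"
    unfolding V_def by (rule continuous_vector_2)
  then have V[measurable]: "V \<in> borel_measurable (lborel \<Otimes>\<^sub>M lborel)"
    by (simp add: lborel_prod borel_measurable_continuous_onI)
  fix l u :: "real^2"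
  assume lu: "\<And>b. b \<in> Basis \<Longrightarrow> l \<bullet> b \<le> u \<bullet> b"
  have lu': "l $ i \<le> u $ i" for i
    using lu[of "axis i 1"] by (simp add: inner_axis)
  have "V -` box l u = {l $ 1<..<u $ 1} \<times> {l $ 2<..<u $ 2}"
    by (auto simp: V_def mem_box_cart forall_2)
  then have "emeasure (distr (lborel \<Otimes>\<^sub>M lborel) borel V) (box l u)
      = emeasure (lborel \<Otimes>\<^sub>M lborel) ({l $ 1<..<u $ 1} \<times> {l $ 2<..<u $ 2})"
    by (subst emeasure_distr) (auto simp: space_pair_measure)
  also have "\<dots> = ennreal ((u $ 1 - l $ 1) * (u $ 2 - l $ 2))"
    using lu' by (subst lborel.emeasure_pair_measure_Times) (auto simp: ennreal_mult)
  also have "(u $ 1 - l $ 1) * (u $ 2 - l $ 2) = (\<Prod>b\<in>Basis. (u - l) \<bullet> b)"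
    by (simp add: Basis_vec_def inner_axis UNIV_2 axis_eq_axis prod.insert)
  finally show "emeasure (distr (lborel \<Otimes>\<^sub>M lborel) borel (\<lambda>p. vector [fst p, snd p])) (box l u)
    = (\<Prod>b\<in>Basis. (u - l) \<bullet> b)" unfolding V_def .
qed simp

lemma integral_cis_unit_interval:
  "(\<integral>x. indicator {0..1} x *\<^sub>R cis (2 * pi * (of_int a * x)) \<partial>lborel) = (if a = 0 then 1 else 0)"
proof (cases "a = 0")
  case False
  define \<beta> :: complex where "\<beta> = \<i> * (2 * of_real pi * of_int a)"
  have \<beta>: "\<beta> \<noteq> 0" "cis (2 * pi * (of_int a * x)) = exp (\<beta> * of_real x)" for x
    using False by (simp_all add: \<beta>_def cis_conv_exp mult.assoc)
  define F where "F x = exp (\<beta> * of_real x) / \<beta>" for x :: real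
  have "(F has_vector_derivative exp (\<beta> * of_real x)) (at x within {0..1})" for x
  proof -
    have "((\<lambda>z. exp (\<beta> * z) / \<beta>) has_field_derivative exp (\<beta> * of_real x)) (at (of_real x))"
      using \<beta> by (auto intro!: derivative_eq_intros)
    from has_vector_derivative_real_field[OF this, of "{0..1}"] show ?thesis
      by (simp add: F_def[abs_def] o_def)
  qed
  then have "(\<integral>x. indicator {0..1} x *\<^sub>R exp (\<beta> * of_real x) \<partial>lborel) = F 1 - F 0"
    by (intro integral_FTC_Icc) (auto intro!: continuous_intros)
  also have "F 1 - F 0 = 0"
    using \<beta>(2)[of 1] cis_2pi_eq_iff[of "of_int a" 0] by (simp add: F_def)
  finally show ?thesis using False \<beta>(2) by simp
qed auto

lemma has_bochner_integral_tchar: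
  "has_bochner_integral leb_square (tchar a b) (if a = 0 \<and> b = 0 then 1 else 0)"
proof -
  let ?V = "\<lambda>p::real \<times> real. vector [fst p, snd p] :: real^2"
  have cont: "continuous_on A (tchar a b)" for A
    unfolding tchar_def by (intro continuous_intros)
  have [measurable]: "tchar a b \<in> borel_measurable borel"
    using cont by (rule borel_measurable_continuous_onI)
  have [measurable]: "?V \<in> borel_measurable (lborel \<Otimes>\<^sub>M lborel)"
    using continuous_vector_2 by (simp add: lborel_prod borel_measurable_continuous_onI)
  have int: "integrable lborel (\<lambda>z. indicator (cbox 0 One) z *\<^sub>R tchar a b z)"
    by (rule borel_integrable_compact) (auto intro: cont)
  have ind: "indicator (cbox (0::real^2) One) (?V p) = (indicator {0..1} (fst p) * indicator {0..1} (snd p) :: real)" for p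
    by (auto simp: indicator_def mem_box_cart forall_2 One_nth_2)
  have fac: "tchar a b (?V p) = cis (2 * pi * (of_int a * fst p)) * cis (2 * pi * (of_int b * snd p))" for p
    by (simp add: tchar_def cis_mult algebra_simps)
  have int2: "integrable (lborel \<Otimes>\<^sub>M lborel) (\<lambda>p. indicator (cbox 0 One) (?V p) *\<^sub>R tchar a b (?V p))"
    using int by (subst (asm) lborel_vector_2, subst (asm) integrable_distr_eq) auto
  have "(\<integral>z. indicator (cbox 0 One) z *\<^sub>R tchar a b z \<partial>lborel)
     = (\<integral>p. indicator (cbox 0 One) (?V p) *\<^sub>R tchar a b (?V p) \<partial>(lborel \<Otimes>\<^sub>M lborel))"
    by (subst lborel_vector_2, subst integral_distr) auto
  also have "\<dots> = (\<integral>x. \<integral>y. indicator (cbox 0 One) (?V (x, y)) *\<^sub>R tchar a b (?V (x, y)) \<partial>lborel \<partial>lborel)"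
    using lborel_pair.integral_fst'[OF int2] by simp
  also have "\<dots> = (\<integral>x. indicator {0..1} x *\<^sub>R cis (2 * pi * (of_int a * x)) *
      (\<integral>y. indicator {0..1} y *\<^sub>R cis (2 * pi * (of_int b * y)) \<partial>lborel) \<partial>lborel)"
    unfolding ind fac by (simp flip: integral_mult_right_zero add: scaleR_conv_of_real ac_simps)
  also have "\<dots> = (if a = 0 \<and> b = 0 then 1 else 0)"
    by (simp only: integral_cis_unit_interval integral_mult_left_zero) auto
  finally have "has_bochner_integral lborel (\<lambda>z. indicator (cbox 0 One) z *\<^sub>R tchar a b z) (if a = 0 \<and> b = 0 then 1 else 0)"
    using int by (simp add: has_bochner_integral_iff)
  then show ?thesis
    unfolding leb_square_def by (subst has_bochner_integral_restrict_space) auto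
qed

lemma prob_space_leb_square: "prob_space leb_square"
proof
  have "emeasure leb_square (space leb_square) = emeasure lborel (cbox (0::real^2) One)"
    by (simp add: leb_square_def emeasure_restrict_space space_restrict_space)
  also have "\<dots> = 1" by (simp add: emeasure_lborel_cbox_eq)
  finally show "emeasure leb_square (space leb_square) = 1" .
qed

definition equidistributed :: "(nat \<Rightarrow> real^2) \<Rightarrow> bool" where
  "equidistributed z \<longleftrightarrow>
     (\<forall>a b. (a, b) \<noteq> (0, 0) \<longrightarrow> (\<lambda>N. (\<Sum>k<N. tchar a b (z k)) / of_nat N) \<longlonglongrightarrow> 0)"

lemma Weyl_trig_poly:
  assumes z: "equidistributed z" and "trig_poly g"
  shows "integrable leb_square g \<and> (\<lambda>N. (\<Sum>k<N. g (z k)) / of_nat N) \<longlonglongrightarrow> integral\<^sup>L leb_square g"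
  using assms(2)
proof induction
  case (monom c a b)
  have "(\<lambda>N. (\<Sum>k<N. tchar a b (z k)) / of_nat N) \<longlonglongrightarrow> (if a = 0 \<and> b = 0 then 1 else 0)"
  proof (cases "a = 0 \<and> b = 0")
    case True
    have "(\<lambda>N. (\<Sum>k<N. tchar a b (z k)) / of_nat N) \<longlonglongrightarrow> 1"
      by (rule tendsto_eventually, rule eventually_mono[OF eventually_gt_at_top[of 0]])
         (simp add: tchar_def True)
    then show ?thesis using True by simp
  next
    case False
    then show ?thesis using z by (auto simp: equidistributed_def)
  qed
  from tendsto_mult_left[OF this, of c] has_bochner_integral_tchar[of a b]
  show ?case by (auto simp: has_bochner_integral_iff sum_distrib_left)
next
  case (add f g)
  then have "(\<lambda>N. (\<Sum>k<N. f (z k)) / of_nat N + (\<Sum>k<N. g (z k)) / of_nat N)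
     \<longlonglongrightarrow> integral\<^sup>L leb_square f + integral\<^sup>L leb_square g"
    by (intro tendsto_add) auto
  with add show ?case by (auto simp: sum.distrib add_divide_distrib)
qed

text \<open>Three errors of size \<epsilon> / 4: replacing \<open>f\<close> by a trigonometric
  polynomial along the orbit, Weyl convergence for the polynomial, and the replacement in the
  integral.\<close>

lemma Weyl_torus_continuous:
  assumes z: "equidistributed z" and f: "torus_continuous f"
  shows "(\<lambda>N. (\<Sum>k<N. f (z k)) / real N) \<longlonglongrightarrow> integral\<^sup>L leb_square f"
proof (rule metric_LIMSEQ_I)
  interpret L: prob_space leb_square by (rule prob_space_leb_square)
  fix \<epsilon> :: real assume "\<epsilon> > 0"
  then obtain g where g: "trig_poly g" "\<And>z. cmod (of_real (f z) - g z) < \<epsilon> / 4"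
    using torus_continuous_approx[OF f, of "\<epsilon> / 4"] by auto
  define I where "I = integral\<^sup>L leb_square g"
  note W = Weyl_trig_poly[OF z g(1), folded I_def]
  then obtain N0 where N0: "\<And>N. N \<ge> N0 \<Longrightarrow> dist ((\<Sum>k<N. g (z k)) / of_nat N) I < \<epsilon> / 4"
    using \<open>\<epsilon> > 0\<close> metric_LIMSEQ_D[of _ I "\<epsilon> / 4"] by fastforce
  have mf: "f \<in> borel_measurable leb_square"
    using f unfolding torus_continuous_def leb_square_def
    by (intro measurable_restrict_space1) (auto intro: borel_measurable_continuous_onI)
  have intf: "integrable leb_square (\<lambda>z. complex_of_real (f z))"
  proof (rule Bochner_Integration.integrable_bound)
    show "integrable leb_square (\<lambda>x. norm (g x) + \<epsilon> / 4)" using W by auto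
    have "norm (complex_of_real (f x)) \<le> norm (g x) + \<epsilon> / 4" for x
      using g(2)[of x] norm_triangle_sub[of "complex_of_real (f x)" "g x"] by linarith
    then show "AE x in leb_square. norm (complex_of_real (f x)) \<le> norm (norm (g x) + \<epsilon> / 4)"
      using \<open>\<epsilon> > 0\<close> by (intro AE_I2) (smt (verit) real_norm_def)
  qed (use mf in measurable)
  have "cmod (integral\<^sup>L leb_square (\<lambda>z. complex_of_real (f z)) - I) \<le> \<epsilon> / 4"
  proof -
    have "integral\<^sup>L leb_square (\<lambda>z. complex_of_real (f z)) - I = (\<integral>z. complex_of_real (f z) - g z \<partial>leb_square)"
      unfolding I_def using intf W by simp
    also have "cmod \<dots> \<le> (\<integral>z. cmod (complex_of_real (f z) - g z) \<partial>leb_square)"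
      by (rule integral_norm_bound)
    also have "\<dots> \<le> (\<integral>z. \<epsilon> / 4 \<partial>leb_square)"
      using g(2) intf W by (intro integral_mono) (auto intro: less_imp_le)
    also have "\<dots> = \<epsilon> / 4" by (simp add: L.prob_space)
    finally show ?thesis .
  qed
  then have I: "dist I (complex_of_real (integral\<^sup>L leb_square f)) \<le> \<epsilon> / 4"
    by (simp add: dist_norm norm_minus_commute)
  have "dist ((\<Sum>k<N. f (z k)) / real N) (integral\<^sup>L leb_square f) < \<epsilon>" if N: "N \<ge> N0" for N
  proof -
    have "dist (complex_of_real ((\<Sum>k<N. f (z k)) / real N)) ((\<Sum>k<N. g (z k)) / of_nat N)
        = cmod ((\<Sum>k<N. of_real (f (z k)) - g (z k)) / of_nat N)"
      by (simp add: dist_norm sum_subtractf diff_divide_distrib)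
    also have "\<dots> = cmod (\<Sum>k<N. of_real (f (z k)) - g (z k)) / real N"
      by (simp add: norm_divide)
    also have "\<dots> \<le> (\<Sum>k<N. \<epsilon> / 4) / real N"
      by (intro divide_right_mono sum_norm_le less_imp_le[OF g(2)]) auto
    also have "\<dots> \<le> \<epsilon> / 4" using \<open>\<epsilon> > 0\<close> by simp
    finally have "dist (complex_of_real ((\<Sum>k<N. f (z k)) / real N)) ((\<Sum>k<N. g (z k)) / of_nat N) \<le> \<epsilon> / 4" .
    moreover note N0[OF N] I
    ultimately have "dist (complex_of_real ((\<Sum>k<N. f (z k)) / real N)) (complex_of_real (integral\<^sup>L leb_square f)) < \<epsilon>"
      using dist_triangle[of "complex_of_real ((\<Sum>k<N. f (z k)) / real N)" "complex_of_real (integral\<^sup>L leb_square f)" "(\<Sum>k<N. g (z k)) / of_nat N"]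
        dist_triangle[of "(\<Sum>k<N. g (z k)) / of_nat N" "complex_of_real (integral\<^sup>L leb_square f)" I] \<open>\<epsilon> > 0\<close>
      by linarith
    then show ?thesis by (simp only: dist_of_real)
  qed
  then show "\<exists>N0. \<forall>N\<ge>N0. dist ((\<Sum>k<N. f (z k)) / real N) (integral\<^sup>L leb_square f) < \<epsilon>" by blast
qed

text \<open>A character does not see integer parts, so \<open>frac\<close> drops out and each step
  multiplies the two frequencies by \<open>m\<close> and \<open>n\<close>.\<close>

lemma tchar_Tmn_funpow:
  "tchar a b ((Tmn m n ^^ k) z) = tchar (a * int m ^ k) (b * int n ^ k) z"
proof (induction k arbitrary: a b)
  case (Suc k)
  have "tchar a b (Tmn m n w) = tchar (a * int m) (b * int n) w" for w
    unfolding tchar_def cis_2pi_eq_iff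
  proof -
    have "of_int a * Tmn m n w $ 1 + of_int b * Tmn m n w $ 2 -
      (of_int (a * int m) * w $ 1 + of_int (b * int n) * w $ 2)
      = - of_int a * of_int \<lfloor>real m * w $ 1\<rfloor> - of_int b * of_int \<lfloor>real n * w $ 2\<rfloor>"
      by (simp add: Tmn_def frac_def algebra_simps)
    also have "\<dots> \<in> \<int>" by (intro Ints_diff Ints_mult Ints_minus) auto
    finally show "of_int a * Tmn m n w $ 1 + of_int b * Tmn m n w $ 2 -
      (of_int (a * int m) * w $ 1 + of_int (b * int n) * w $ 2) \<in> \<int>" .
  qed
  then show ?case by (simp add: Suc.IH mult.assoc)
qed simp

section \<open>Oscillatory sums along spirals, circles and rays\<close>

text \<open>The integrand is split by \<open>1 = q\<^sup>2 / (q\<^sup>2 + \<kappa>\<^sup>2) + \<kappa>\<^sup>2 / (q\<^sup>2 + \<kappa>\<^sup>2)\<close>. The first part is \<open>1 / \<rho>\<close> times a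
  derivative up to lower order; the second is small since, by integrating the derivative of
  \<open>\<kappa> q' arctan (q / \<kappa>)\<close>, \<open>q\<close> is small on a short set only. This avoids locating the zeros of \<open>q\<close>.\<close>

lemma oscillatory_integral_bound:
  fixes g q q1 q2 :: "real \<Rightarrow> real"
  assumes g: "\<And>t. (g has_real_derivative \<rho> * q t) (at t)"
    and q: "\<And>t. (q has_real_derivative q1 t) (at t)"
    and q1: "\<And>t. (q1 has_real_derivative q2 t) (at t)"
    and cont: "continuous_on UNIV q2"
    and bound: "\<And>t. t \<in> {0..1} \<Longrightarrow> \<bar>q1 t\<bar> \<le> B" "\<And>t. t \<in> {0..1} \<Longrightarrow> \<bar>q2 t\<bar> \<le> B"
    and c: "\<And>t. t \<in> {0..1} \<Longrightarrow> c \<le> (q t)\<^sup>2 + (q1 t)\<^sup>2" "c > 0"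
    and pos: "\<rho> > 0" "\<kappa> > 0"
  shows "cmod (integral {0..1} (\<lambda>t. cis (g t))) \<le> (2 / \<kappa> + B / \<kappa>\<^sup>2) / \<rho> + (\<kappa>\<^sup>2 + 6 * \<kappa> * B) / c"
proof -
  have cont': "continuous_on A g" "continuous_on A q" "continuous_on A q1" "continuous_on A q2" for A
    using DERIV_continuous[OF g] DERIV_continuous[OF q] DERIV_continuous[OF q1] cont
    by (auto intro: continuous_at_imp_continuous_on continuous_on_subset)
  have nz: "(q t)\<^sup>2 + \<kappa>\<^sup>2 > 0" "(q t)\<^sup>2 + \<kappa>\<^sup>2 \<noteq> 0" for t
    using pos by (auto intro: add_nonneg_pos simp: sum_power2_eq_zero_iff)
  have B0: "B \<ge> 0" using bound(1)[of 0] by auto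
  \<comment> \<open>\<open>q * w\<close> is the first of the two weights. Since \<open>cis g\<close>
    has derivative i \<rho> q \<open>cis g\<close>, the first part is the derivative of
    \<open>G\<close>, divided by i \<rho>, up to the term with \<open>w1\<close>.\<close>
  define w where "w t = q t / ((q t)\<^sup>2 + \<kappa>\<^sup>2)" for t
  define w1 where "w1 t = q1 t * (\<kappa>\<^sup>2 - (q t)\<^sup>2) / ((q t)\<^sup>2 + \<kappa>\<^sup>2)\<^sup>2" for t
  have w: "(w has_real_derivative w1 t) (at t)" for t
    unfolding w_def w1_def using nz(2)[of t]
    by (auto intro!: derivative_eq_intros q simp: field_simps power2_eq_square)
  have cw: "continuous_on A w" "continuous_on A w1" for A
    unfolding w_def w1_def using nz(2) by (auto intro!: continuous_intros cont')
  have w_le: "\<bar>w t\<bar> \<le> 1 / \<kappa>" for t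
  proof -
    have "2 * (\<bar>q t\<bar> * \<kappa>) \<le> (q t)\<^sup>2 + \<kappa>\<^sup>2"
      using zero_le_power2[of "\<bar>q t\<bar> - \<kappa>"] by (simp add: power2_diff)
    moreover have "0 \<le> \<bar>q t\<bar> * \<kappa>" using pos by simp
    ultimately have "\<bar>q t\<bar> * \<kappa> \<le> (q t)\<^sup>2 + \<kappa>\<^sup>2" by linarith
    then show ?thesis unfolding w_def using pos nz(1)[of t] by (simp add: field_simps abs_mult)
  qed
  have w1_le: "\<bar>w1 t\<bar> \<le> B / \<kappa>\<^sup>2" if "t \<in> {0..1}" for t
  proof -
    have "\<bar>w1 t\<bar> = \<bar>q1 t\<bar> * (\<bar>\<kappa>\<^sup>2 - (q t)\<^sup>2\<bar> / ((q t)\<^sup>2 + \<kappa>\<^sup>2)) / ((q t)\<^sup>2 + \<kappa>\<^sup>2)"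
      by (simp add: w1_def abs_mult power2_eq_square)
    also have "\<dots> \<le> B * 1 / \<kappa>\<^sup>2"
      using nz(1)[of t] pos bound(1)[OF that] B0
      by (intro frac_le mult_mono) (auto simp: divide_le_eq abs_le_iff)
    finally show ?thesis by simp
  qed
  define G where "G t = cis (g t) * of_real (w t)" for t
  have cis': "((\<lambda>t. cis (g t)) has_vector_derivative (\<i> * of_real (\<rho> * q t)) * cis (g t)) (at t within A)" for t A
  proof -
    have "((\<lambda>t. cis (g t)) has_vector_derivative of_real (\<rho> * q t) * (\<i> * cis (g t))) (at t)"
    proof -
      have "(cis has_vector_derivative (\<i> * cis s)) (at s)" for s
      proof -
        have "((\<lambda>z. exp (\<i> * z)) has_field_derivative \<i> * exp (\<i> * of_real s)) (at (of_real s))"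
          by (auto intro!: derivative_eq_intros)
        from has_vector_derivative_real_field[OF this, of UNIV] show ?thesis
          by (simp add: cis_conv_exp[abs_def] o_def)
      qed
      from vector_diff_chain_at[OF g[of t, unfolded has_real_derivative_iff_has_vector_derivative] this]
      show ?thesis by (simp add: o_def scaleR_conv_of_real)
    qed
    then show ?thesis by (auto intro: has_vector_derivative_at_within simp: algebra_simps)
  qed
  have "(G has_vector_derivative (cis (g t) * of_real (w1 t) + (\<i> * of_real (\<rho> * q t)) * cis (g t) * of_real (w t))) (at t within {0..1})" for t
    unfolding G_def
    by (intro has_vector_derivative_mult cis' has_vector_derivative_of_real)
       (use w in \<open>auto simp: has_real_derivative_iff_has_vector_derivative intro: has_vector_derivative_at_within\<close>)
  then have "((\<lambda>t. cis (g t) * of_real (w1 t) + (\<i> * of_real (\<rho> * q t)) * cis (g t) * of_real (w t)) has_integral (G 1 - G 0)) {0..1}"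
    by (intro fundamental_theorem_of_calculus) auto
  moreover have i1: "(\<lambda>t. cis (g t) * of_real (w1 t)) integrable_on {0..1}"
    by (intro integrable_continuous_real continuous_intros cw cont')
  ultimately have "((\<lambda>t. (\<i> * of_real (\<rho> * q t)) * cis (g t) * of_real (w t)) has_integral
     (G 1 - G 0 - integral {0..1} (\<lambda>t. cis (g t) * of_real (w1 t)))) {0..1}"
    using has_integral_diff[OF _ integrable_integral[OF i1]] by fastforce
  from has_integral_mult_right[OF this, of "1 / (\<i> * of_real \<rho>)"]
  have main: "((\<lambda>t. cis (g t) * of_real (q t * w t)) has_integral
     1 / (\<i> * of_real \<rho>) * (G 1 - G 0 - integral {0..1} (\<lambda>t. cis (g t) * of_real (w1 t)))) {0..1}"
    using pos by (simp add: field_simps)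
  have "cmod (integral {0..1} (\<lambda>t. cis (g t) * of_real (w1 t))) \<le> integral {0..1} (\<lambda>t::real. B / \<kappa>\<^sup>2)"
    by (rule integral_norm_bound_integral[OF i1]) (use w1_le in \<open>auto simp: norm_mult\<close>)
  then have "cmod (G 1 - G 0 - integral {0..1} (\<lambda>t. cis (g t) * of_real (w1 t))) \<le> 1 / \<kappa> + 1 / \<kappa> + B / \<kappa>\<^sup>2"
    using w_le by (intro norm_triangle_le_diff add_mono) (auto simp: G_def norm_mult)
  then have first: "cmod (integral {0..1} (\<lambda>t. cis (g t) * of_real (q t * w t))) \<le> (2 / \<kappa> + B / \<kappa>\<^sup>2) / \<rho>"
    unfolding integral_unique[OF main] using pos by (simp add: norm_mult norm_divide divide_right_mono)
  define v where "v t = \<kappa>\<^sup>2 / ((q t)\<^sup>2 + \<kappa>\<^sup>2)" for t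
  have v: "v t \<ge> 0" "q t * w t + v t = 1" for t
    using nz[of t] by (auto simp: v_def w_def power2_eq_square simp flip: add_divide_distrib)
  have cv: "continuous_on A v" for A
    unfolding v_def using nz(2) by (auto intro!: continuous_intros cont')
  \<comment> \<open>\<kappa> arctan (q / \<kappa>) is a primitive of \<open>v * q1\<close>, so the
    derivative of \<open>A\<close> is \<open>v * q1\<^sup>2\<close> plus a term of order \<kappa>;
    hence the integral of \<open>v * q1\<^sup>2\<close> is of order \<kappa>.\<close>
  define A where "A t = \<kappa> * q1 t * arctan (q t / \<kappa>)" for t
  have "(A has_real_derivative (\<kappa> * q2 t * arctan (q t / \<kappa>) + v t * (q1 t)\<^sup>2)) (at t)" for t
  proof -
    have "\<kappa>\<^sup>2 + (q t)\<^sup>2 \<noteq> 0" "1 + (q t / \<kappa>)\<^sup>2 \<noteq> 0" using nz(2)[of t] by (auto simp: add.commute add_nonneg_eq_0_iff)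
    then show ?thesis unfolding A_def v_def using pos
      by (auto intro!: derivative_eq_intros q q1 simp: field_simps power2_eq_square)
  qed
  then have "((\<lambda>t. \<kappa> * q2 t * arctan (q t / \<kappa>) + v t * (q1 t)\<^sup>2) has_integral (A 1 - A 0)) {0..1}"
    by (intro fundamental_theorem_of_calculus)
       (auto simp: has_real_derivative_iff_has_vector_derivative intro: has_vector_derivative_at_within)
  moreover have i2: "(\<lambda>t. \<kappa> * q2 t * arctan (q t / \<kappa>)) integrable_on {0..1}"
    using pos by (intro integrable_continuous_real continuous_intros cont') auto
  ultimately have vq1: "((\<lambda>t. v t * (q1 t)\<^sup>2) has_integral (A 1 - A 0 - integral {0..1} (\<lambda>t. \<kappa> * q2 t * arctan (q t / \<kappa>)))) {0..1}"
    using has_integral_diff[OF _ integrable_integral[OF i2]] by fastforce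
  \<comment> \<open>The value 2 rounds up \<pi> / 2. Two endpoint terms and one integral, each at
    most 2 \<kappa> B, make up the constant 6 \<kappa> B.\<close>
  have at: "\<bar>arctan x\<bar> \<le> 2" for x
    using arctan_bounded[of x] pi_less_4 by (auto simp: abs_le_iff)
  have "norm (integral {0..1} (\<lambda>t. \<kappa> * q2 t * arctan (q t / \<kappa>))) \<le> integral {0..1} (\<lambda>t::real. \<kappa> * B * 2)"
    by (rule integral_norm_bound_integral[OF i2])
       (use pos bound B0 at in \<open>auto simp: abs_mult intro!: mult_mono\<close>)
  moreover have "\<bar>A t\<bar> \<le> \<kappa> * B * 2" if "t \<in> {0..1}" for t
    unfolding A_def abs_mult using pos bound(1)[OF that] B0 at by (intro mult_mono) auto
  from this[of 0] this[of 1] have "\<bar>A 0\<bar> \<le> \<kappa> * B * 2" "\<bar>A 1\<bar> \<le> \<kappa> * B * 2" by auto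
  ultimately have vq1_le: "A 1 - A 0 - integral {0..1} (\<lambda>t. \<kappa> * q2 t * arctan (q t / \<kappa>)) \<le> 6 * \<kappa> * B"
    by auto
  have vc: "(\<lambda>t. (\<kappa>\<^sup>2 + v t * (q1 t)\<^sup>2) / c) integrable_on {0..1}"
    by (intro integrable_continuous_real continuous_intros cv cont') (use c in auto)
  have "cmod (integral {0..1} (\<lambda>t. cis (g t) * of_real (v t))) \<le> integral {0..1} (\<lambda>t. (\<kappa>\<^sup>2 + v t * (q1 t)\<^sup>2) / c)"
  proof (rule integral_norm_bound_integral[OF _ vc])
    show "(\<lambda>t. cis (g t) * of_real (v t)) integrable_on {0..1}"
      by (intro integrable_continuous_real continuous_intros cv cont')
    fix t :: real assume t: "t \<in> {0..1}"
    \<comment> \<open>The weight \<open>v\<close> is large only near zeros of \<open>q\<close>,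
      where the lower bound \<open>c\<close> falls to \<open>q1\<close>; away from them v q^2 \<le>
      \<kappa>^2 suffices.\<close>
    have "v t * c \<le> v t * ((q t)\<^sup>2 + (q1 t)\<^sup>2)" using c(1)[OF t] v(1) by (intro mult_left_mono)
    also have "v t * (q t)\<^sup>2 \<le> \<kappa>\<^sup>2"
      unfolding v_def using nz(1)[of t] by (simp add: divide_le_eq mult_left_mono)
    then have "v t * ((q t)\<^sup>2 + (q1 t)\<^sup>2) \<le> \<kappa>\<^sup>2 + v t * (q1 t)\<^sup>2" by (simp add: distrib_left)
    finally show "cmod (cis (g t) * of_real (v t)) \<le> (\<kappa>\<^sup>2 + v t * (q1 t)\<^sup>2) / c"
      using v(1)[of t] c(2) by (simp add: norm_mult field_simps)
  qed
  also have "\<dots> \<le> (\<kappa>\<^sup>2 + 6 * \<kappa> * B) / c"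
  proof -
    have "((\<lambda>t. (\<kappa>\<^sup>2 + v t * (q1 t)\<^sup>2) / c) has_integral
      ((\<kappa>\<^sup>2 + (A 1 - A 0 - integral {0..1} (\<lambda>t. \<kappa> * q2 t * arctan (q t / \<kappa>)))) / c)) {0..1}"
      using has_integral_divide[OF has_integral_add[OF has_integral_const_real[of "\<kappa>\<^sup>2" 0 1] vq1], of c] by simp
    from integral_unique[OF this] show ?thesis using vq1_le c(2) by (simp add: divide_right_mono)
  qed
  finally have second: "cmod (integral {0..1} (\<lambda>t. cis (g t) * of_real (v t))) \<le> (\<kappa>\<^sup>2 + 6 * \<kappa> * B) / c" .
  have "integral {0..1} (\<lambda>t. cis (g t)) = integral {0..1} (\<lambda>t. cis (g t) * of_real (q t * w t) + cis (g t) * of_real (v t))"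
    unfolding distrib_left[symmetric] of_real_add[symmetric] v(2) by simp
  also have "\<dots> = integral {0..1} (\<lambda>t. cis (g t) * of_real (q t * w t)) + integral {0..1} (\<lambda>t. cis (g t) * of_real (v t))"
    by (intro integral_add integrable_continuous_real continuous_intros cv cw cont')
  finally show ?thesis using norm_triangle_mono[OF first second] by simp
qed

text \<open>The size of \<open>z\<close> as seen by the phase \<open>Re (z exp (u t))\<close>: a logarithmic spiral or a circle sees
  \<open>\<bar>z\<bar>\<close>, whereas a ray only sees the component of \<open>z\<close> along it.\<close>

definition arc_size :: "complex \<Rightarrow> complex \<Rightarrow> real" where
  "arc_size u z = (if Im u = 0 then \<bar>Re z\<bar> else cmod z)"

lemma arc_size_nonneg: "arc_size u z \<ge> 0"
  by (simp add: arc_size_def)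

lemma arc_size_scale: "s \<ge> 0 \<Longrightarrow> arc_size u (of_real s * z) = s * arc_size u z"
  by (simp add: arc_size_def norm_mult abs_mult)

text \<open>The right-hand side consists of the first two derivatives of the phase at t = 0. For
  nonreal \<open>u\<close>, the identity u^2 = 2 (Re u) u - |u|^2 shows that they vanish together
  only for z = 0, and an injective linear map is bounded below. For real \<open>u\<close> both are
  multiples of Re z.\<close>

lemma phase_nondegenerate:
  assumes "u \<noteq> 0"
  obtains c where "c > 0" "\<And>z. c * (arc_size u z)\<^sup>2 \<le> (Re (u * z))\<^sup>2 + (Re (u\<^sup>2 * z))\<^sup>2"
proof (cases "Im u = 0")
  case True
  have "(Re u)\<^sup>2 * (arc_size u z)\<^sup>2 \<le> (Re (u * z))\<^sup>2 + (Re (u\<^sup>2 * z))\<^sup>2" for z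
    using True by (simp add: arc_size_def power_mult_distrib)
  moreover have "Re u \<noteq> 0" using True assms by (auto simp: complex_eq_iff)
  ultimately show ?thesis by (intro that[of "(Re u)\<^sup>2"]) auto
next
  case False
  define L where "L z = (Re (u * z), Re (u\<^sup>2 * z))" for z
  have lin: "linear L"
    by (rule linearI) (auto simp: L_def algebra_simps)
  have "z = 0" if "L z = 0" for z
  proof -
    have z: "Re (u * z) = 0" "Re (u\<^sup>2 * z) = 0" using that by (auto simp: L_def zero_prod_def)
    have "Re (u\<^sup>2 * z) - 2 * Re u * Re (u * z) = - (cmod u)\<^sup>2 * Re z"
      unfolding cmod_power2 by (simp add: power2_eq_square algebra_simps)
    with z assms have "Re z = 0" by simp
    with z(1) False show ?thesis by (simp add: complex_eq_iff)
  qed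
  then have "inj L" using lin by (simp add: linear_injective_0)
  then obtain B where B: "B > 0" "\<And>z. B * norm z \<le> norm (L z)"
    using linear_inj_bounded_below_pos[OF lin] by metis
  have "B\<^sup>2 * (arc_size u z)\<^sup>2 \<le> (Re (u * z))\<^sup>2 + (Re (u\<^sup>2 * z))\<^sup>2" for z
  proof -
    have "(B * norm z)\<^sup>2 \<le> (norm (L z))\<^sup>2"
      using B by (intro power_mono) auto
    also have "\<dots> = (Re (u * z))\<^sup>2 + (Re (u\<^sup>2 * z))\<^sup>2" by (simp add: L_def norm_Pair)
    finally show ?thesis using False by (simp add: arc_size_def power_mult_distrib)
  qed
  then show ?thesis using B by (intro that[of "B\<^sup>2"]) auto
qed

text \<open>Divided by \<open>arc_size u z\<close>, the phase has derivatives bounded above and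
  below independently of \<open>z\<close>, so \<open>oscillatory_integral_bound\<close> applies with
  uniform constants.\<close>

lemma oscillatory_integral_decay:
  assumes "u \<noteq> 0" "\<epsilon> > 0"
  obtains \<rho> where "\<rho> > 0"
    "\<And>z. arc_size u z \<ge> \<rho> \<Longrightarrow> cmod (integral {0..1} (\<lambda>t. cis (Re (z * exp (u * of_real t))))) \<le> \<epsilon>"
proof -
  obtain c0 where c0: "c0 > 0" "\<And>z. c0 * (arc_size u z)\<^sup>2 \<le> (Re (u * z))\<^sup>2 + (Re (u\<^sup>2 * z))\<^sup>2"
    using phase_nondegenerate[OF \<open>u \<noteq> 0\<close>] by blast
  \<comment> \<open>\<open>1 / E\<close> and \<open>E\<close> bound the modulus of exp (u t) on
    [0, 1]. Accordingly \<open>c\<close> is a lower bound for the squares of the first two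
    normalised derivatives, and \<open>B\<close> bounds the second and third ones.\<close>
  define E where "E = exp (cmod u)"
  define c where "c = c0 / E\<^sup>2"
  define B where "B = (1 + cmod u ^ 3) * E * (1 + cmod u ^ 2)"
  have "c > 0" "B \<ge> 0" using c0 by (auto simp: c_def B_def E_def)
  \<comment> \<open>The order of choice matters: \<kappa> settles the term without \<rho>, and only
    then is \<rho> taken large against \<open>D\<close>, which blows up as \<kappa> tends to
    0.\<close>
  obtain \<kappa> where \<kappa>: "\<kappa> > 0" "(\<kappa>\<^sup>2 + 6 * \<kappa> * B) / c \<le> \<epsilon> / 2"
  proof -
    have "((\<lambda>\<kappa>. (\<kappa>\<^sup>2 + 6 * \<kappa> * B) / c) \<longlongrightarrow> (0\<^sup>2 + 6 * 0 * B) / c) (at_right 0)"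
      using \<open>c > 0\<close> by (intro tendsto_intros) auto
    then have "\<forall>\<^sub>F \<kappa> in at_right 0. (\<kappa>\<^sup>2 + 6 * \<kappa> * B) / c < \<epsilon> / 2"
      using \<open>\<epsilon> > 0\<close> by (intro order_tendstoD(2)) auto
    moreover have "\<forall>\<^sub>F \<kappa> in at_right 0. (\<kappa>::real) > 0" by (simp add: eventually_at_right_less)
    ultimately have "\<forall>\<^sub>F \<kappa> in at_right 0. (\<kappa>\<^sup>2 + 6 * \<kappa> * B) / c < \<epsilon> / 2 \<and> \<kappa> > 0" by (rule eventually_conj)
    from eventually_happens'[OF _ this] show ?thesis using that by (auto intro: less_imp_le)
  qed
  define D where "D = 2 / \<kappa> + B / \<kappa>\<^sup>2"
  have "D > 0" using \<kappa>(1) \<open>B \<ge> 0\<close> by (simp add: D_def add_pos_nonneg)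
  define \<rho>0 where "\<rho>0 = D / (\<epsilon> / 2)"
  have "\<rho>0 > 0" using \<open>D > 0\<close> \<open>\<epsilon> > 0\<close> by (simp add: \<rho>0_def)
  show ?thesis
  proof (rule that[OF \<open>\<rho>0 > 0\<close>])
    fix z assume z: "arc_size u z \<ge> \<rho>0"
    define \<rho> where "\<rho> = arc_size u z"
    have "\<rho> > 0" using z \<open>\<rho>0 > 0\<close> by (simp add: \<rho>_def)
    define q where "q k t = Re (u ^ k * (z * exp (u * of_real t))) / \<rho>" for k t
    have deriv: "((\<lambda>t. Re (u ^ k * (z * exp (u * of_real t)))) has_real_derivative Re (u ^ Suc k * (z * exp (u * of_real t)))) (at t)" for k t
    proof -
      have "((\<lambda>w. u ^ k * (z * exp (u * w))) has_field_derivative u ^ Suc k * (z * exp (u * of_real t))) (at (of_real t))"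
        by (auto intro!: derivative_eq_intros)
      from has_vector_derivative_real_field[OF this, of UNIV]
      have "((\<lambda>t. u ^ k * (z * exp (u * of_real t))) has_vector_derivative u ^ Suc k * (z * exp (u * of_real t))) (at t)"
        by (simp add: o_def)
      from bounded_linear.has_vector_derivative[OF bounded_linear_Re this] show ?thesis
        by (simp add: has_real_derivative_iff_has_vector_derivative)
    qed
    have deriv_q: "(q k has_real_derivative q (Suc k) t) (at t)" for k t
      unfolding q_def by (rule DERIV_cdivide[OF deriv])
    have e: "1 / E \<le> cmod (exp (u * of_real t))" "cmod (exp (u * of_real t)) \<le> E" if "t \<in> {0..1}" for t
    proof -
      have "\<bar>Re u * t\<bar> \<le> cmod u * 1"
        unfolding abs_mult using that by (intro mult_mono abs_Re_le_cmod) auto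
      then have "- cmod u \<le> Re u * t" "Re u * t \<le> cmod u" by (auto simp: abs_le_iff)
      then show "1 / E \<le> cmod (exp (u * of_real t))" "cmod (exp (u * of_real t)) \<le> E"
        by (auto simp: E_def exp_minus[symmetric] inverse_eq_divide[symmetric])
    qed
    have ge: "arc_size u z * (1 / E) \<le> arc_size u (z * exp (u * of_real t))" if "t \<in> {0..1}" for t
    proof (cases "Im u = 0")
      case True
      then have "Im (exp (u * of_real t)) = 0" "cmod (exp (u * of_real t)) = \<bar>Re (exp (u * of_real t))\<bar>"
        by (auto simp: exp_eq_polar Im_exp Re_exp)
      then show ?thesis using True mult_left_mono[OF e(1)[OF that], of "\<bar>Re z\<bar>"]
        by (simp add: arc_size_def abs_mult del: norm_exp_eq_Re)
    next
      case False
      show ?thesis using e(1)[OF that] False by (simp only: arc_size_def if_False norm_mult mult_left_mono norm_ge_zero)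
    qed
    have gabs: "\<bar>Re (u ^ k * (z * exp (u * of_real t)))\<bar> \<le> cmod u ^ k * (arc_size u z * E)" if "t \<in> {0..1}" for k t
    proof (cases "Im u = 0")
      case True
      define a where "a = Re u"
      have "u = of_real a" using True by (simp add: a_def complex_eq_iff)
      then have *: "u ^ k * (z * exp (u * of_real t)) = of_real (a ^ k * exp (a * t)) * z"
        by (simp flip: exp_of_real add: ac_simps)
      have "\<bar>Re (u ^ k * (z * exp (u * of_real t)))\<bar> = \<bar>a\<bar> ^ k * (\<bar>Re z\<bar> * exp (a * t))"
        unfolding * by (simp add: abs_mult power_abs del: of_real_mult of_real_power)
      also have "exp (a * t) = cmod (exp (u * of_real t))" using \<open>u = of_real a\<close> by simp
      finally show ?thesis using True e(2)[OF that] \<open>u = of_real a\<close>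
        by (simp add: arc_size_def mult_left_mono)
    next
      case False
      have "\<bar>Re (u ^ k * (z * exp (u * of_real t)))\<bar> \<le> cmod (u ^ k * (z * exp (u * of_real t)))"
        by (rule abs_Re_le_cmod)
      also have "\<dots> \<le> cmod u ^ k * (arc_size u z * E)"
        using False e(2)[OF that] by (simp only: arc_size_def if_False norm_mult norm_power mult_left_mono norm_ge_zero zero_le_power)
      finally show ?thesis .
    qed
    have q_le: "\<bar>q k t\<bar> \<le> cmod u ^ k * E" if "t \<in> {0..1}" for k t
      unfolding q_def using gabs[OF that, of k] \<open>\<rho> > 0\<close> by (simp add: \<rho>_def field_simps)
    have "E > 0" by (simp add: E_def)
    have "cmod (integral {0..1} (\<lambda>t. cis (Re (u ^ 0 * (z * exp (u * of_real t)))))) \<le> D / \<rho> + (\<kappa>\<^sup>2 + 6 * \<kappa> * B) / c"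
      unfolding D_def
    proof (rule oscillatory_integral_bound[where q = "q 1" and ?q1.0 = "q 2" and ?q2.0 = "q 3"])
      show "((\<lambda>t. Re (u ^ 0 * (z * exp (u * of_real t)))) has_real_derivative \<rho> * q 1 t) (at t)" for t
        using deriv[of 0 t] \<open>\<rho> > 0\<close> by (simp add: q_def)
      show "(q 1 has_real_derivative q 2 t) (at t)" "(q 2 has_real_derivative q 3 t) (at t)" for t
        using deriv_q[of 1 t] deriv_q[of 2 t] by (simp_all add: numeral_2_eq_2 numeral_3_eq_3)
      show "continuous_on UNIV (q 3)"
        unfolding q_def using \<open>\<rho> > 0\<close> by (intro continuous_intros) auto
      have "1 \<le> 1 + cmod u ^ 3" "1 \<le> 1 + cmod u ^ 2" by auto
      have "cmod u ^ 2 * E \<le> B"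
      proof -
        have "1 * (E * cmod u ^ 2) \<le> (1 + cmod u ^ 3) * (E * (1 + cmod u ^ 2))"
          using \<open>E > 0\<close> by (intro mult_mono) auto
        then show ?thesis by (simp add: B_def ac_simps)
      qed
      moreover have "cmod u ^ 3 * E \<le> B"
      proof -
        have "cmod u ^ 3 * (E * 1) \<le> (1 + cmod u ^ 3) * (E * (1 + cmod u ^ 2))"
          using \<open>E > 0\<close> by (intro mult_mono) auto
        then show ?thesis by (simp add: B_def ac_simps)
      qed
      ultimately show "\<bar>q 2 t\<bar> \<le> B" "\<bar>q 3 t\<bar> \<le> B" if "t \<in> {0..1}" for t
        using q_le[OF that, of 2] q_le[OF that, of 3] by auto
      show "c \<le> (q 1 t)\<^sup>2 + (q 2 t)\<^sup>2" if "t \<in> {0..1}" for t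
      proof -
        have "c0 * (\<rho> * (1 / E))\<^sup>2 \<le> c0 * (arc_size u (z * exp (u * of_real t)))\<^sup>2"
          using c0(1) ge[OF that] \<open>\<rho> > 0\<close> \<open>E > 0\<close> unfolding \<rho>_def
          by (intro mult_left_mono power_mono) auto
        also have "\<dots> \<le> (\<rho> * q 1 t)\<^sup>2 + (\<rho> * q 2 t)\<^sup>2"
          using c0(2)[of "z * exp (u * of_real t)"] \<open>\<rho> > 0\<close> by (simp add: q_def)
        also have "\<dots> = \<rho>\<^sup>2 * ((q 1 t)\<^sup>2 + (q 2 t)\<^sup>2)" by (simp add: power_mult_distrib algebra_simps)
        finally have "\<rho>\<^sup>2 * c \<le> \<rho>\<^sup>2 * ((q 1 t)\<^sup>2 + (q 2 t)\<^sup>2)"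
          by (simp add: c_def power_mult_distrib power_divide ac_simps)
        then show ?thesis using \<open>\<rho> > 0\<close> by (simp add: mult_le_cancel_left_pos)
      qed
    qed (fact | use \<kappa> in simp)+
    also have "D / \<rho> \<le> D / \<rho>0"
      using z \<open>\<rho>0 > 0\<close> \<open>D > 0\<close> by (intro divide_left_mono) (auto simp: \<rho>_def)
    also have "D / \<rho>0 = \<epsilon> / 2" using \<open>D > 0\<close> by (simp add: \<rho>0_def)
    finally show "cmod (integral {0..1} (\<lambda>t. cis (Re (z * exp (u * of_real t))))) \<le> \<epsilon>"
      using \<kappa>(2) unfolding power_0 mult_1_left by linarith
  qed
qed

lemma norm_cis_diff_le: "cmod (cis x - cis y) \<le> \<bar>x - y\<bar>"
proof -
  have "cmod (cis x - cis y) = cmod (cis y * (cis (x - y) - 1))"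
    by (simp add: algebra_simps cis_mult)
  also have "\<dots> = cmod (cis (x - y) - 1)" by (simp add: norm_mult)
  also have "\<dots> \<le> \<bar>x - y\<bar>"
    using iexp_approx1[of "x - y" 0] by (simp add: cis_conv_exp)
  finally show ?thesis .
qed

lemma norm_exp_diff_le:
  assumes "cmod a \<le> r" "cmod b \<le> r"
  shows "cmod (exp a - exp b) \<le> exp r * cmod (a - b)"
proof -
  have "convex (cball (0::complex) r)" by simp
  moreover have "(exp has_field_derivative exp z) (at z within cball 0 r)" for z :: complex
    by (auto intro: DERIV_exp has_field_derivative_at_within)
  moreover have "cmod (exp z) \<le> exp r" if "z \<in> cball 0 r" for z
    using that complex_Re_le_cmod[of z] by simp
  ultimately show ?thesis
    using assms field_differentiable_bound[of "cball 0 r" exp exp "exp r" b a] by (simp add: norm_minus_commute)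
qed

text \<open>A Riemann sum of the preceding integral, with the M samples perturbed from i u / M to i
  \<gamma>. The lower threshold \<open>\<rho>\<close> comes from the integral alone, whereas
  \<open>M0\<close> and \<open>\<epsilon>'\<close> depend on the upper bound \<open>\<rho>'\<close>,
  because the phase varies proportionally to |z|.\<close>

lemma oscillatory_sum_decay:
  assumes "u \<noteq> 0" "\<epsilon> > 0"
  obtains \<rho> where "\<rho> > 0"
    "\<And>\<rho>'. \<exists>M0 \<epsilon>'. M0 > 0 \<and> \<epsilon>' > 0 \<and> (\<forall>M \<gamma> z. M \<ge> M0 \<and> cmod (\<gamma> - u / of_nat M) \<le> \<epsilon>' / real M \<and> \<rho> \<le> arc_size u z \<and> cmod z \<le> \<rho>' \<longrightarrow>
       cmod (\<Sum>i<M. cis (Re (z * exp (of_nat i * \<gamma>)))) \<le> \<epsilon> * real M)"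
proof -
  obtain \<rho> where \<rho>: "\<rho> > 0"
    "\<And>z. arc_size u z \<ge> \<rho> \<Longrightarrow> cmod (integral {0..1} (\<lambda>t. cis (Re (z * exp (u * of_real t))))) \<le> \<epsilon> / 2"
    using oscillatory_integral_decay[OF \<open>u \<noteq> 0\<close>, of "\<epsilon> / 2"] \<open>\<epsilon> > 0\<close> by auto
  show ?thesis
  proof (rule that[OF \<rho>(1)])
    fix \<rho>' :: real
    \<comment> \<open>A Lipschitz constant of the character as a function of the exponent: the
      exponents to be compared have modulus at most |u| + 1. The summand 1 keeps it
      positive.\<close>
    define L where "L = \<bar>\<rho>'\<bar> * exp (cmod u + 1) + 1"
    have "L > 0" by (simp add: L_def add_nonneg_pos)
    define \<epsilon>' where "\<epsilon>' = min 1 (\<epsilon> / (4 * L))"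
    define M0 where "M0 = nat \<lceil>4 * L * cmod u / \<epsilon>\<rceil> + 1"
    have e': "\<epsilon>' > 0" "\<epsilon>' \<le> 1" "L * \<epsilon>' \<le> \<epsilon> / 4" using \<open>\<epsilon> > 0\<close> \<open>L > 0\<close> by (auto simp: \<epsilon>'_def min_def field_simps)
    have "cmod (\<Sum>i<M. cis (Re (z * exp (of_nat i * \<gamma>)))) \<le> \<epsilon> * real M"
      if M: "M \<ge> M0" and \<gamma>: "cmod (\<gamma> - u / of_nat M) \<le> \<epsilon>' / real M" and z: "\<rho> \<le> arc_size u z" "cmod z \<le> \<rho>'" for M \<gamma> z
    proof -
      have "M > 0" using M by (simp add: M0_def)
      define f where "f t = cis (Re (z * exp (u * of_real t)))" for t
      have cf: "continuous_on A f" for A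
        unfolding f_def by (intro continuous_intros)
      have "4 * L * cmod u / \<epsilon> \<le> real M" using M unfolding M0_def by linarith
      then have LM: "L * cmod u / real M \<le> \<epsilon> / 4"
        using \<open>M > 0\<close> \<open>\<epsilon> > 0\<close> by (simp add: field_simps)
      define I where "I i = {real i / real M..real (Suc i) / real M}" for i
      have step: "cmod (cis (Re (z * exp (of_nat i * \<gamma>))) - f t) \<le> \<epsilon> / 2" if i: "i < M" and t: "t \<in> I i" for i t
      proof -
        have t': "\<bar>real i / real M - t\<bar> \<le> 1 / real M" "0 \<le> t" "t \<le> 1"
        proof -
          show "\<bar>real i / real M - t\<bar> \<le> 1 / real M" using t by (simp add: I_def add_divide_distrib)
          have "0 \<le> real i / real M" by simp
          also have "\<dots> \<le> t" using t unfolding I_def by simp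
          finally show "0 \<le> t" .
          have "real (Suc i) / real M \<le> 1" using i by (simp add: divide_le_eq_1)
          then show "t \<le> 1" using t unfolding I_def by simp
        qed
        have d1: "cmod (of_nat i * \<gamma> - u * of_real (real i / real M)) \<le> \<epsilon>'"
        proof -
          have "of_nat i * \<gamma> - u * of_real (real i / real M) = of_nat i * (\<gamma> - u / of_nat M)"
            by (simp add: algebra_simps)
          then have "cmod (of_nat i * \<gamma> - u * of_real (real i / real M)) = real i * cmod (\<gamma> - u / of_nat M)"
            by (simp add: norm_mult)
          also have "\<dots> \<le> real M * (\<epsilon>' / real M)" using i \<gamma> by (intro mult_mono) auto
          finally show ?thesis using \<open>M > 0\<close> by simp
        qed
        have d2: "cmod (u * of_real (real i / real M) - u * of_real t) \<le> cmod u / real M"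
        proof -
          have "u * of_real (real i / real M) - u * of_real t = u * of_real (real i / real M - t)" by (simp add: algebra_simps)
          then have "cmod (u * of_real (real i / real M) - u * of_real t) = cmod u * \<bar>real i / real M - t\<bar>"
            by (simp only: norm_mult norm_of_real)
          also have "\<dots> \<le> cmod u * (1 / real M)" using t' by (intro mult_left_mono) auto
          finally show ?thesis by simp
        qed
        have "cmod (u * of_real t) \<le> cmod u * 1" unfolding norm_mult norm_of_real using t' by (intro mult_left_mono) auto
        then have n1: "cmod (u * of_real t) \<le> cmod u + 1" by simp
        have "cmod (u * of_real (real i / real M)) \<le> cmod u * 1"
          unfolding norm_mult norm_of_real using i by (intro mult_left_mono) auto
        then have n2: "cmod (of_nat i * \<gamma>) \<le> cmod u + 1"
          using d1 e'(2) norm_triangle_sub[of "of_nat i * \<gamma>" "u * of_real (real i / real M)"] by linarith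
        have d3: "cmod (of_nat i * \<gamma> - u * of_real t) \<le> \<epsilon>' + cmod u / real M"
          using norm_triangle_le[OF add_mono[OF d1 d2]] by simp
        have "cmod (cis (Re (z * exp (of_nat i * \<gamma>))) - f t) \<le> \<bar>Re (z * exp (of_nat i * \<gamma>)) - Re (z * exp (u * of_real t))\<bar>"
          unfolding f_def by (rule norm_cis_diff_le)
        also have "\<dots> = \<bar>Re (z * (exp (of_nat i * \<gamma>) - exp (u * of_real t)))\<bar>" by (simp add: algebra_simps)
        also have "\<dots> \<le> cmod z * cmod (exp (of_nat i * \<gamma>) - exp (u * of_real t))"
          using abs_Re_le_cmod norm_mult by metis
        also have "\<dots> \<le> \<bar>\<rho>'\<bar> * (exp (cmod u + 1) * (\<epsilon>' + cmod u / real M))"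
          using z(2) norm_exp_diff_le[OF n2 n1] d3
          by (intro mult_mono order_trans[OF norm_exp_diff_le[OF n2 n1]]) auto
        also have "\<dots> \<le> L * (\<epsilon>' + cmod u / real M)"
          unfolding L_def using e' by (simp add: algebra_simps)
        also have "\<dots> = L * \<epsilon>' + L * cmod u / real M" by (simp add: distrib_left)
        also have "\<dots> \<le> \<epsilon> / 2" using add_mono[OF e'(3) LM] by simp
        finally show ?thesis .
      qed
      have int_I: "f integrable_on I i" for i
        unfolding I_def by (rule integrable_continuous_real[OF cf])
      have lenI: "real (Suc i) / real M - real i / real M = 1 / real M" for i
        by (simp add: add_divide_distrib)
      have piece: "cmod (cis (Re (z * exp (of_nat i * \<gamma>))) / real M - integral (I i) f) \<le> (\<epsilon> / 2) / real M" if "i < M" for i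
      proof -
        define X where "X = cis (Re (z * exp (of_nat i * \<gamma>)))"
        have le: "real i / real M \<le> real (Suc i) / real M" by (intro divide_right_mono) auto
        have "((\<lambda>t. X) has_integral X / real M) (I i)"
          using has_integral_const_real[of X "real i / real M" "real (Suc i) / real M"] le lenI[of i]
          unfolding I_def by (simp add: scaleR_conv_of_real)
        from has_integral_diff[OF this integrable_integral[OF int_I]]
        have *: "((\<lambda>t. X - f t) has_integral (X / real M - integral (I i) f)) {real i / real M..real (Suc i) / real M}"
          unfolding I_def .
        have "cmod (X / real M - integral (I i) f) \<le> \<epsilon> / 2 * measure lborel {real i / real M..real (Suc i) / real M}"
          by (rule has_integral_bound_real[OF _ _ *, of _ "{}"]) (use step[OF that] \<open>\<epsilon> > 0\<close> in \<open>auto simp: X_def I_def\<close>)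
        also have "measure lborel {real i / real M..real (Suc i) / real M} = 1 / real M"
          using le lenI[of i] by simp
        finally show ?thesis by (simp add: X_def)
      qed
      have total: "(\<Sum>i<k. integral (I i) f) = integral {0..real k / real M} f" if "k \<le> M" for k
        using that
      proof (induction k)
        case (Suc k)
        have "integral {0..real k / real M} f + integral (I k) f = integral {0..real (Suc k) / real M} f"
          unfolding I_def
          by (rule Henstock_Kurzweil_Integration.integral_combine) (auto intro!: integrable_continuous_real cf divide_right_mono)
        then show ?case using Suc by simp
      qed simp
      have "cmod ((\<Sum>i<M. cis (Re (z * exp (of_nat i * \<gamma>))) / real M) - integral {0..1} f) \<le> (\<Sum>i<M. (\<epsilon> / 2) / real M)"
      proof -
        have "integral {0..1} f = (\<Sum>i<M. integral (I i) f)" using total[of M] \<open>M > 0\<close> by simp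
        then have "(\<Sum>i<M. cis (Re (z * exp (of_nat i * \<gamma>))) / real M) - integral {0..1} f
          = (\<Sum>i<M. cis (Re (z * exp (of_nat i * \<gamma>))) / real M - integral (I i) f)" by (simp add: sum_subtractf)
        then show ?thesis by (simp only:) (intro sum_norm_le piece, simp)
      qed
      also have "\<dots> = \<epsilon> / 2" using \<open>M > 0\<close> by simp
      finally have "cmod (\<Sum>i<M. cis (Re (z * exp (of_nat i * \<gamma>))) / real M) \<le> \<epsilon>"
        using \<rho>(2)[OF z(1)] norm_triangle_sub[of "(\<Sum>i<M. cis (Re (z * exp (of_nat i * \<gamma>))) / real M)" "integral {0..1} f"]
        unfolding f_def by linarith
      then show ?thesis using \<open>M > 0\<close> by (simp add: norm_divide pos_divide_le_eq flip: sum_divide_distrib)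
    qed
    moreover have "M0 > 0" by (simp add: M0_def)
    ultimately show "\<exists>M0 \<epsilon>'. M0 > 0 \<and> \<epsilon>' > 0 \<and> (\<forall>M \<gamma> z. M \<ge> M0 \<and> cmod (\<gamma> - u / of_nat M) \<le> \<epsilon>' / real M \<and> \<rho> \<le> arc_size u z \<and> cmod z \<le> \<rho>' \<longrightarrow>
       cmod (\<Sum>i<M. cis (Re (z * exp (of_nat i * \<gamma>)))) \<le> \<epsilon> * real M)"
      using e'(1) by blast
  qed
qed

section \<open>Closed subgroups of the plane\<close>

text \<open>Normalised short elements accumulate at a unit vector \<open>u\<close> by compactness.
  Rounding t / |\<gamma>| down gives integer multiples whose length misses t by at most |\<gamma>|,
  so they converge to t u.\<close>

lemma closure_subgroup_contains_line:
  fixes \<Gamma> :: "'a::euclidean_space set"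
  assumes zero: "0 \<in> \<Gamma>" and diff: "\<And>x y. x \<in> \<Gamma> \<Longrightarrow> y \<in> \<Gamma> \<Longrightarrow> x - y \<in> \<Gamma>"
    and acc: "\<And>\<epsilon>. \<epsilon> > 0 \<Longrightarrow> \<exists>\<gamma>\<in>\<Gamma>. \<gamma> \<noteq> 0 \<and> norm \<gamma> < \<epsilon>"
  obtains u where "norm u = 1" "\<And>t. t *\<^sub>R u \<in> closure \<Gamma>"
proof -
  have minus: "- x \<in> \<Gamma>" if "x \<in> \<Gamma>" for x using diff[OF zero that] by simp
  have add: "x + y \<in> \<Gamma>" if "x \<in> \<Gamma>" "y \<in> \<Gamma>" for x y using diff[OF that(1) minus[OF that(2)]] by simp
  have natmult: "real n *\<^sub>R x \<in> \<Gamma>" if "x \<in> \<Gamma>" for n x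
    by (induction n) (auto simp: zero scaleR_add_left intro: add that)
  have intmult: "of_int k *\<^sub>R x \<in> \<Gamma>" if "x \<in> \<Gamma>" for k x
    using natmult[OF that, of "nat k"] minus[OF natmult[OF that, of "nat (- k)"]] by (cases "k \<ge> 0") auto
  obtain \<gamma> where \<gamma>: "\<And>n. \<gamma> n \<in> \<Gamma>" "\<And>n. \<gamma> n \<noteq> 0" "\<And>n. norm (\<gamma> n) < 1 / real (Suc n)"
    using acc[of "1 / real (Suc _)"] by (metis of_nat_0_less_iff zero_less_Suc zero_less_divide_1_iff)
  have "compact (sphere (0::'a) 1)" by simp
  moreover have "\<forall>n. (1 / norm (\<gamma> n)) *\<^sub>R \<gamma> n \<in> sphere 0 1" using \<gamma>(2) by simp
  ultimately obtain u s where u: "u \<in> sphere 0 1" and s: "strict_mono s"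
    and lim: "((\<lambda>n. (1 / norm (\<gamma> n)) *\<^sub>R \<gamma> n) \<circ> s) \<longlonglongrightarrow> u"
    unfolding compact_def by meson
  have "(\<lambda>n. norm (\<gamma> n)) \<longlonglongrightarrow> 0"
    by (rule tendsto_sandwich[OF _ _ tendsto_const LIMSEQ_inverse_real_of_nat])
       (use \<gamma>(3) in \<open>auto intro!: always_eventually less_imp_le simp: inverse_eq_divide\<close>)
  then have n0: "(\<lambda>n. norm (\<gamma> (s n))) \<longlonglongrightarrow> 0"
    using LIMSEQ_subseq_LIMSEQ[OF _ s] by (auto simp: o_def)
  show ?thesis
  proof (rule that)
    show "norm u = 1" using u by simp
    fix t :: real
    define k where "k n = \<lfloor>t / norm (\<gamma> (s n))\<rfloor>" for n
    have "\<bar>of_int (k n) * norm (\<gamma> (s n)) - t\<bar> \<le> norm (\<gamma> (s n))" for n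
    proof -
      have p: "norm (\<gamma> (s n)) > 0" using \<gamma>(2) by simp
      have "of_int (k n) \<le> t / norm (\<gamma> (s n))" "t / norm (\<gamma> (s n)) < of_int (k n) + 1"
        unfolding k_def by linarith+
      then show ?thesis using p by (simp add: field_simps abs_le_iff)
    qed
    then have "(\<lambda>n. of_int (k n) * norm (\<gamma> (s n)) - t) \<longlonglongrightarrow> 0"
      by (intro Lim_null_comparison[OF _ n0]) (auto intro!: always_eventually)
    then have "(\<lambda>n. of_int (k n) * norm (\<gamma> (s n))) \<longlonglongrightarrow> t"
      by (simp add: LIM_zero_iff)
    from tendsto_scaleR[OF this lim[unfolded o_def]]
    have "(\<lambda>n. of_int (k n) *\<^sub>R \<gamma> (s n)) \<longlonglongrightarrow> t *\<^sub>R u"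
      using \<gamma>(2) by simp
    then show "t *\<^sub>R u \<in> closure \<Gamma>"
      unfolding closure_sequential
      using intmult[OF \<gamma>(1)] by (intro exI[of _ "\<lambda>n. of_int (k n) *\<^sub>R \<gamma> (s n)"]) auto
  qed
qed

text \<open>All logarithms of the elements of the multiplicative group generated by \<open>\<kappa>\<close> and \<open>r e\<^sup>i\<^sup>\<theta>\<close>.\<close>

definition log_group :: "real \<Rightarrow> real \<Rightarrow> real \<Rightarrow> complex set" where
  "log_group \<kappa> r \<theta> = {Complex (of_int q * ln \<kappa> + of_int j * ln r) (of_int j * \<theta> + 2 * pi * of_int p) | q j p. True}"

lemma log_group_diff:
  assumes "x \<in> log_group \<kappa> r \<theta>" "y \<in> log_group \<kappa> r \<theta>"
  shows "x - y \<in> log_group \<kappa> r \<theta>"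
proof -
  obtain q j p q' j' p' where
    "x = Complex (of_int q * ln \<kappa> + of_int j * ln r) (of_int j * \<theta> + 2 * pi * of_int p)"
    "y = Complex (of_int q' * ln \<kappa> + of_int j' * ln r) (of_int j' * \<theta> + 2 * pi * of_int p')"
    using assms by (auto simp: log_group_def)
  then have "x - y = Complex (of_int (q - q') * ln \<kappa> + of_int (j - j') * ln r) (of_int (j - j') * \<theta> + 2 * pi * of_int (p - p'))"
    by (simp add: complex_eq_iff algebra_simps)
  then show ?thesis unfolding log_group_def by blast
qed

text \<open>A real direction gives straight arcs, which are manageable only if they occur in
  finitely many directions. So the direction has to be nonreal unless \<open>cis \<theta>\<close>
  has finite order.\<close>

lemma log_group_drift:
  assumes \<kappa>: "\<kappa> > 1" and irr: "ln r / ln \<kappa> \<notin> \<rat>"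
  obtains u where "u \<noteq> 0" "Im u \<noteq> 0 \<or> (\<exists>J>0. cis \<theta> ^ J = 1)"
    "\<And>t. of_real t * u \<in> closure (log_group \<kappa> r \<theta>)"
proof -
  let ?G = "log_group \<kappa> r \<theta>"
  have zero: "0 \<in> ?G"
    unfolding log_group_def by (auto intro!: exI[of _ 0] simp: complex_eq_iff)
  have acc: "\<exists>\<gamma>\<in>?G. \<gamma> \<noteq> 0 \<and> norm \<gamma> < \<epsilon>" if "\<epsilon> > 0" for \<epsilon>
  proof -
    have L: "ln \<kappa> > 0" using \<kappa> by simp
    obtain N :: nat where N: "(ln \<kappa> + 2 * pi) / \<epsilon> < real N" using reals_Archimedean2 by blast
    have "N > 0" using N L that by (cases N) (auto simp: field_simps dest: order_less_trans intro: add_pos_pos)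
    \<comment> \<open>Simultaneous Dirichlet approximation of both numbers gives one exponent of
      \<open>r\<close> making the real and the imaginary part small together; irrationality of the
      first number makes the resulting element nonzero.\<close>
    define x where "x i = (if i = 0 then ln r / ln \<kappa> else \<theta> / (2 * pi))" for i :: nat
    obtain q p where q: "0 < q" "\<And>i. i < (2::nat) \<Longrightarrow> \<bar>of_int q * x i - of_int (p i)\<bar> < 1 / N"
      using Dirichlet_approx_simult[OF \<open>N > 0\<close>, of 2 x] by blast
    define \<gamma> where "\<gamma> = Complex (of_int (- p 0) * ln \<kappa> + of_int q * ln r) (of_int q * \<theta> + 2 * pi * of_int (- p 1))"
    have re: "Re \<gamma> = ln \<kappa> * (of_int q * x 0 - of_int (p 0))" using L by (simp add: \<gamma>_def x_def field_simps)
    have im: "Im \<gamma> = 2 * pi * (of_int q * x 1 - of_int (p 1))" by (simp add: \<gamma>_def x_def field_simps)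
    have "\<gamma> \<in> ?G" unfolding \<gamma>_def log_group_def by blast
    moreover have "\<gamma> \<noteq> 0"
    proof
      assume "\<gamma> = 0"
      then have "of_int q * x 0 = of_int (p 0)" using re L by simp
      then have "ln r / ln \<kappa> = of_int (p 0) / of_int q" using q(1) by (simp add: x_def field_simps)
      then show False using irr by (metis Rats_divide Rats_of_int)
    qed
    moreover have "norm \<gamma> < \<epsilon>"
    proof -
      have "norm \<gamma> \<le> \<bar>Re \<gamma>\<bar> + \<bar>Im \<gamma>\<bar>" by (rule cmod_le)
      also have "\<dots> \<le> ln \<kappa> * (1 / N) + 2 * pi * (1 / N)"
        unfolding re im abs_mult using L q(2)[of 0] q(2)[of 1]
        by (intro add_mono mult_mono) (auto simp: less_imp_le)
      also have "\<dots> = (ln \<kappa> + 2 * pi) / N" by (simp add: add_divide_distrib)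
      also have "\<dots> < \<epsilon>" using N \<open>N > 0\<close> that by (simp add: field_simps)
      finally show ?thesis .
    qed
    ultimately show ?thesis by blast
  qed
  obtain u where u: "norm u = 1" "\<And>t. t *\<^sub>R u \<in> closure ?G"
    using closure_subgroup_contains_line[OF zero log_group_diff acc] by metis
  show ?thesis
  proof (cases "Im u \<noteq> 0 \<or> (\<exists>J>0. cis \<theta> ^ J = 1)")
    case True
    then show ?thesis using u by (intro that[of u]) (auto simp: scaleR_conv_of_real)
  next
    case False
    then have "Im u = 0" and ru: "\<And>J. J > 0 \<Longrightarrow> cis \<theta> ^ J \<noteq> 1" by blast+
    then have "u = of_real (Re u)" by (simp add: complex_eq_iff)
    moreover from this have "Re u \<noteq> 0" using u(1) by auto
    ultimately have "u = of_real (Re u)" "Re u \<noteq> 0" by blast+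
    have reals: "of_real t \<in> closure ?G" for t
      using u(2)[of "t / Re u"] \<open>u = of_real (Re u)\<close> \<open>Re u \<noteq> 0\<close>
      by (metis divide_cancel_right nonzero_eq_divide_eq of_real_mult scaleR_conv_of_real)
    have irr': "\<theta> / (2 * pi) \<notin> \<rat>"
    proof
      assume "\<theta> / (2 * pi) \<in> \<rat>"
      then obtain a b :: int where ab: "b > 0" "\<theta> / (2 * pi) = of_int a / of_int b"
        by (metis Rats_cases')
      then have "real (nat b) * \<theta> = 2 * pi * of_int a" by (simp add: field_simps)
      then have "cis \<theta> ^ nat b = 1" by (simp only: Complex.DeMoivre) (auto intro: cis_multiple_2pi)
      then show False using ru[of "nat b"] ab by simp
    qed
    \<comment> \<open>Multiples of \<theta> are dense modulo 2 \<pi>, so every imaginary part is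
      approximated. The real part picked up on the way is cancelled by a group element near it,
      since the real axis already lies in the closure; then \<open>\<i>\<close> can serve as
      direction.\<close>
    have "of_real t * \<i> \<in> closure ?G" for t
      unfolding closure_approachable
    proof (intro allI impI)
      fix \<epsilon> :: real assume "\<epsilon> > 0"
      then have "\<epsilon> / (4 * pi) > 0" by simp
      then obtain h k where hk: "k > 0" "\<bar>of_int k * (\<theta> / (2 * pi)) - of_int h - t / (2 * pi)\<bar> < \<epsilon> / (4 * pi)"
        using sequence_of_fractional_parts_is_dense[OF irr', of "\<epsilon> / (4 * pi)" "t / (2 * pi)"] by blast
      define \<gamma> where "\<gamma> = Complex (of_int 0 * ln \<kappa> + of_int k * ln r) (of_int k * \<theta> + 2 * pi * of_int (- h))"
      have "\<gamma> \<in> ?G" unfolding \<gamma>_def log_group_def by blast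
      moreover obtain \<delta> where \<delta>: "\<delta> \<in> ?G" "dist \<delta> (of_real (of_int k * ln r)) < \<epsilon> / 2"
        using reals[of "of_int k * ln r"] \<open>\<epsilon> > 0\<close> unfolding closure_approachable by (meson half_gt_zero)
      ultimately have "\<gamma> - \<delta> \<in> ?G" by (intro log_group_diff)
      moreover have "dist (\<gamma> - \<delta>) (of_real t * \<i>) < \<epsilon>"
      proof -
        have eq: "\<gamma> - \<delta> - of_real t * \<i> = (of_real (of_int k * ln r) - \<delta>) + of_real (of_int k * \<theta> - 2 * pi * of_int h - t) * \<i>"
          by (simp add: complex_eq_iff \<gamma>_def)
        have "norm (of_real (of_int k * \<theta> - 2 * pi * of_int h - t) * \<i>) = 2 * pi * \<bar>of_int k * (\<theta> / (2 * pi)) - of_int h - t / (2 * pi)\<bar>"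
        proof -
          have "of_int k * \<theta> - 2 * pi * of_int h - t = 2 * pi * (of_int k * (\<theta> / (2 * pi)) - of_int h - t / (2 * pi))"
            by (simp add: field_simps)
          then show ?thesis by (simp only: norm_mult norm_of_real abs_mult norm_ii) simp
        qed
        also have "\<dots> < \<epsilon> / 2" using mult_strict_left_mono[OF hk(2), of "2 * pi"] by simp
        finally show ?thesis using \<delta>(2) norm_triangle_ineq[of "of_real (of_int k * ln r) - \<delta>" "of_real (of_int k * \<theta> - 2 * pi * of_int h - t) * \<i>"]
          unfolding dist_norm eq by (simp add: norm_minus_commute)
      qed
      ultimately show "\<exists>y\<in>?G. dist y (of_real t * \<i>) < \<epsilon>" by blast
    qed
    then show ?thesis by (intro that[of \<i>]) auto
  qed
qed

lemma log_group_step: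
  assumes \<kappa>: "\<kappa> > 1" and r: "0 < r" "r < 1"
    and u: "\<And>t. of_real t * u \<in> closure (log_group \<kappa> r \<theta>)"
    and \<epsilon>: "0 < \<epsilon>" "\<epsilon> < cmod u"
  shows "\<exists>M0>0. \<forall>M\<ge>M0. \<exists>q>0. \<exists>j>0. \<exists>\<gamma>. exp \<gamma> = of_real \<kappa> ^ q * (of_real r * cis \<theta>) ^ j \<and>
     (cmod (\<gamma> - u / of_nat M) \<le> \<epsilon> / real M \<or> cmod (\<gamma> - (- u) / of_nat M) \<le> \<epsilon> / real M)"
proof -
  \<comment> \<open>For an element of modulus below \<open>\<beta>\<close>, q > 0 forces j > 0,
    because the real part is less than ln \<kappa>; and q = 0 forces j = 0 and p = 0 in turn,
    through the other two entries of the minimum. The element is nonzero because \<epsilon> <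
    |u|.\<close>
  define \<beta> where "\<beta> = min (ln \<kappa>) (min (- ln r) (2 * pi))"
  have "\<beta> > 0" using \<kappa> r by (simp add: \<beta>_def)
  define M0 where "M0 = nat \<lceil>(cmod u + \<epsilon>) / \<beta>\<rceil> + 1"
  have main: "\<exists>q>0. \<exists>j>0. \<exists>\<gamma>. exp \<gamma> = of_real \<kappa> ^ q * (of_real r * cis \<theta>) ^ j \<and>
     (cmod (\<gamma> - u / of_nat M) \<le> \<epsilon> / real M \<or> cmod (\<gamma> - (- u) / of_nat M) \<le> \<epsilon> / real M)" if "M \<ge> M0" for M
  proof -
    have "M > 0" using that by (simp add: M0_def)
    have "(cmod u + \<epsilon>) / \<beta> < real M" using that unfolding M0_def by linarith
    then have small: "cmod u / real M + \<epsilon> / real M < \<beta>"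
      using \<open>M > 0\<close> \<open>\<beta> > 0\<close> by (simp add: field_simps)
    have "of_real (1 / real M) * u \<in> closure (log_group \<kappa> r \<theta>)" by (rule u)
    then obtain \<gamma> where \<gamma>: "\<gamma> \<in> log_group \<kappa> r \<theta>" "dist \<gamma> (of_real (1 / real M) * u) < \<epsilon> / real M"
      unfolding closure_approachable using \<epsilon>(1) \<open>M > 0\<close> by (meson divide_pos_pos of_nat_0_less_iff)
    then have d: "cmod (\<gamma> - u / of_nat M) < \<epsilon> / real M" by (simp add: dist_norm)
    have nu: "cmod (u / of_nat M) = cmod u / real M" by (simp add: norm_divide)
    have n\<gamma>: "cmod \<gamma> < \<beta>"
      using small d nu norm_triangle_sub[of \<gamma> "u / of_nat M"] by linarith
    have "\<gamma> \<noteq> 0"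
    proof
      assume "\<gamma> = 0"
      then show False using d nu \<epsilon> \<open>M > 0\<close> by (simp add: divide_less_cancel)
    qed
    have conclude: "\<exists>q>0. \<exists>j>0. exp \<gamma>' = of_real \<kappa> ^ q * (of_real r * cis \<theta>) ^ j"
      if \<gamma>': "\<gamma>' = Complex (of_int q * ln \<kappa> + of_int j * ln r) (of_int j * \<theta> + 2 * pi * of_int p)"
        "q > 0" "cmod \<gamma>' < \<beta>" for q j p \<gamma>'
    proof -
      have "Re \<gamma>' < ln \<kappa>" using \<gamma>'(3) complex_Re_le_cmod[of \<gamma>'] by (auto simp: \<beta>_def)
      then have "of_int j * ln r < (1 - of_int q) * ln \<kappa>" by (simp add: \<gamma>'(1) algebra_simps)
      also have "\<dots> \<le> 0" using \<kappa> \<gamma>'(2) by (intro mult_nonpos_nonneg) auto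
      finally have "j > 0" using r by (simp add: mult_less_0_iff)
      have "exp \<gamma>' = exp (of_nat (nat q) * of_real (ln \<kappa>)) * exp (of_nat (nat j) * (of_real (ln r) + \<i> * of_real \<theta>)) * exp (2 * pi * of_int p * \<i>)"
      proof -
        have "\<gamma>' = of_nat (nat q) * of_real (ln \<kappa>) + of_nat (nat j) * (of_real (ln r) + \<i> * of_real \<theta>) + 2 * pi * of_int p * \<i>"
          using \<gamma>' \<open>j > 0\<close> by (simp add: complex_eq_iff)
        then show ?thesis by (simp only: exp_add)
      qed
      also have "exp (2 * pi * of_int p * \<i>) = (1::complex)" by (auto simp: exp_eq_1)
      also have "exp (of_nat (nat q) * complex_of_real (ln \<kappa>)) = of_real \<kappa> ^ nat q"
        using \<kappa> by (simp only: exp_of_nat_mult exp_of_real) simp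
      also have "exp (of_nat (nat j) * (of_real (ln r) + \<i> * of_real \<theta>)) = (of_real r * cis \<theta>) ^ nat j"
        using r by (simp only: exp_of_nat_mult exp_add exp_of_real cis_conv_exp) simp
      finally have "exp \<gamma>' = of_real \<kappa> ^ nat q * (of_real r * cis \<theta>) ^ nat j" by simp
      moreover have "nat q > 0" "nat j > 0" using \<gamma>'(2) \<open>j > 0\<close> by auto
      ultimately show ?thesis by blast
    qed
    obtain q j p where eq: "\<gamma> = Complex (of_int q * ln \<kappa> + of_int j * ln r) (of_int j * \<theta> + 2 * pi * of_int p)"
      using \<gamma>(1) by (auto simp: log_group_def)
    consider "q > 0" | "q < 0" | "q = 0" by linarith
    then show ?thesis
    proof cases
      case 1
      then show ?thesis using conclude[OF eq 1 n\<gamma>] d by (meson less_imp_le)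
    next
      case 2
      have "- \<gamma> = Complex (of_int (- q) * ln \<kappa> + of_int (- j) * ln r) (of_int (- j) * \<theta> + 2 * pi * of_int (- p))"
        by (simp add: eq complex_eq_iff)
      then obtain q' j' where "q' > 0" "j' > 0" "exp (- \<gamma>) = of_real \<kappa> ^ q' * (of_real r * cis \<theta>) ^ j'"
        using conclude[of "- \<gamma>" "- q" "- j" "- p"] 2 n\<gamma> unfolding norm_minus_cancel by fastforce
      moreover have "cmod (- \<gamma> - (- u) / of_nat M) \<le> \<epsilon> / real M"
        using d by (simp add: norm_minus_commute)
      ultimately show ?thesis by blast
    next
      case 3
      have "j = 0"
      proof (rule ccontr)
        assume "j \<noteq> 0"
        then have "1 \<le> \<bar>real_of_int j\<bar>" by simp
        then have "1 * (- ln r) \<le> \<bar>real_of_int j\<bar> * \<bar>ln r\<bar>" using r by (intro mult_mono) auto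
        also have "\<dots> = \<bar>Re \<gamma>\<bar>" using 3 by (simp add: eq abs_mult)
        also have "\<dots> < - ln r" using n\<gamma> abs_Re_le_cmod[of \<gamma>] by (auto simp: \<beta>_def)
        finally show False by simp
      qed
      then have "\<bar>Im \<gamma>\<bar> = 2 * pi * \<bar>real_of_int p\<bar>" by (simp add: eq abs_mult)
      moreover have "\<bar>Im \<gamma>\<bar> < 2 * pi" using n\<gamma> abs_Im_le_cmod[of \<gamma>] by (auto simp: \<beta>_def)
      ultimately have "\<bar>real_of_int p\<bar> < 1" by simp
      then have "p = 0" by linarith
      then have "\<gamma> = 0" using 3 \<open>j = 0\<close> by (simp add: eq complex_eq_iff)
      then show ?thesis using \<open>\<gamma> \<noteq> 0\<close> by simp
    qed
  qed
  have "M0 > 0" by (simp add: M0_def)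
  with main show ?thesis by blast
qed

section \<open>Self-similar measures and words\<close>

lemma measurable_Re[measurable (raw)]:
  "f \<in> borel_measurable M \<Longrightarrow> (\<lambda>x. Re (f x)) \<in> borel_measurable M"
  by (rule measurable_compose[of f M borel]) (auto intro: borel_measurable_continuous_onI continuous_intros)

lemma measurable_cnj[measurable (raw)]:
  "f \<in> borel_measurable M \<Longrightarrow> (\<lambda>x. cnj (f x)) \<in> borel_measurable M"
  by (rule measurable_compose[of f M borel]) (auto intro: borel_measurable_continuous_onI continuous_intros)

lemma measurable_cis[measurable (raw)]:
  "f \<in> borel_measurable M \<Longrightarrow> (\<lambda>x. cis (f x)) \<in> borel_measurable M"
  unfolding cis_conv_exp by measurable

text \<open>The bound 2 rounds up the diagonal of the unit square; it enters the Lipschitz constant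
  of the characteristic function and the variation of characters on cylinders.\<close>

locale self_similar = prob_space \<nu> for \<nu> :: "complex measure" +
  fixes l :: nat and r :: real and p :: "nat \<Rightarrow> real" and c \<tau> :: "nat \<Rightarrow> complex"
  assumes sets_nu [measurable_cong]: "sets \<nu> = sets borel"
    and r: "0 < r" "r < 1"
    and p_pos: "\<And>k. k < l \<Longrightarrow> p k > 0"
    and p_sum: "(\<Sum>k<l. p k) = 1"
    and norm_c: "\<And>k. k < l \<Longrightarrow> cmod (c k) = 1"
    and bounded: "AE z in \<nu>. cmod z \<le> 2"
    and self_sim: "\<And>A. A \<in> sets borel \<Longrightarrow>
      measure \<nu> A = (\<Sum>k<l. p k * measure \<nu> ((\<lambda>z. of_real r * c k * z + \<tau> k) -` A))"
begin

lemma p_nonneg: "k < l \<Longrightarrow> 0 \<le> p k"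
  using p_pos by (simp add: less_imp_le)

definition \<phi> :: "nat \<Rightarrow> complex \<Rightarrow> complex" where
  "\<phi> k z = of_real r * c k * z + \<tau> k"

lemma measurable_phi[measurable]: "\<phi> k \<in> borel_measurable borel"
  unfolding \<phi>_def by measurable

lemma space_nu [simp]: "space \<nu> = UNIV"
  using sets_eq_imp_space_eq[OF sets_nu] by simp

lemma integrable_bounded:
  fixes G :: "complex \<Rightarrow> 'b::{banach, second_countable_topology}"
  assumes "G \<in> borel_measurable borel" "\<And>z. norm (G z) \<le> B"
  shows "integrable \<nu> G"
  using assms by (intro integrable_const_bound[of _ B]) auto

text \<open>As a push-forward, self-similarity passes from sets to integrals by Fubini.\<close>

lemma nu_eq_distr:
  "\<nu> = distr (point_measure {..<l} (\<lambda>k. ennreal (p k)) \<Otimes>\<^sub>M \<nu>) borel (\<lambda>(k, z). \<phi> k z)"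
  (is "_ = distr (?P \<Otimes>\<^sub>M _) _ ?f")
proof (rule measure_eqI)
  have "?f \<in> measurable (count_space {..<l} \<Otimes>\<^sub>M \<nu>) borel"
    by (rule measurable_pair_measure_countable1) auto
  then have f[measurable]: "?f \<in> measurable (?P \<Otimes>\<^sub>M \<nu>) borel"
    by (subst measurable_cong_sets[OF sets_pair_measure_cong[of _ "count_space {..<l}" _ \<nu>] refl])
       (auto simp: sets_point_measure)
  fix A assume "A \<in> sets \<nu>"
  then have A[measurable]: "A \<in> sets borel" by (simp add: sets_nu)
  have m: "\<phi> k -` A \<in> sets \<nu>" for k
    using measurable_sets[OF measurable_phi A, of k] by (simp add: sets_nu)
  have "emeasure (distr (?P \<Otimes>\<^sub>M \<nu>) borel ?f) A = emeasure (?P \<Otimes>\<^sub>M \<nu>) (?f -` A \<inter> space (?P \<Otimes>\<^sub>M \<nu>))"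
    by (rule emeasure_distr) auto
  also have "\<dots> = (\<integral>\<^sup>+k. emeasure \<nu> (Pair k -` (?f -` A \<inter> space (?P \<Otimes>\<^sub>M \<nu>))) \<partial>?P)"
    by (rule emeasure_pair_measure_alt) measurable
  also have "\<dots> = (\<Sum>k<l. ennreal (p k) * emeasure \<nu> (Pair k -` (?f -` A \<inter> space (?P \<Otimes>\<^sub>M \<nu>))))"
    by (subst nn_integral_point_measure_finite) (auto simp: ac_simps)
  also have "\<dots> = (\<Sum>k<l. ennreal (p k * measure \<nu> (\<phi> k -` A)))"
  proof (rule sum.cong[OF refl])
    fix k assume "k \<in> {..<l}"
    then have "Pair k -` (?f -` A \<inter> space (?P \<Otimes>\<^sub>M \<nu>)) = \<phi> k -` A"
      by (auto simp: space_pair_measure space_point_measure)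
    then show "ennreal (p k) * emeasure \<nu> (Pair k -` (?f -` A \<inter> space (?P \<Otimes>\<^sub>M \<nu>))) = ennreal (p k * measure \<nu> (\<phi> k -` A))"
      using p_pos[of k] \<open>k \<in> {..<l}\<close> by (simp add: emeasure_eq_measure ennreal_mult)
  qed
  also have "\<dots> = ennreal (\<Sum>k<l. p k * measure \<nu> (\<phi> k -` A))"
    by (intro sum_ennreal mult_nonneg_nonneg p_nonneg) auto
  also have "\<dots> = emeasure \<nu> A"
    using self_sim[OF A] by (simp add: emeasure_eq_measure \<phi>_def[abs_def])
  finally show "emeasure \<nu> A = emeasure (distr (?P \<Otimes>\<^sub>M \<nu>) borel ?f) A" ..
qed (simp add: sets_nu)

lemma integral_self_similar:
  fixes G :: "complex \<Rightarrow> 'b::{banach, second_countable_topology}"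
  assumes G[measurable]: "G \<in> borel_measurable borel" and B: "\<And>z. norm (G z) \<le> B"
  shows "integral\<^sup>L \<nu> G = (\<Sum>k<l. p k *\<^sub>R (\<integral>z. G (\<phi> k z) \<partial>\<nu>))"
proof -
  let ?P = "point_measure {..<l} (\<lambda>k. ennreal (p k))" and ?f = "\<lambda>(k, z). \<phi> k z"
  have "?f \<in> measurable (count_space {..<l} \<Otimes>\<^sub>M \<nu>) borel"
    by (rule measurable_pair_measure_countable1) auto
  then have f[measurable]: "?f \<in> measurable (?P \<Otimes>\<^sub>M \<nu>) borel"
    by (subst measurable_cong_sets[OF sets_pair_measure_cong[of _ "count_space {..<l}" _ \<nu>] refl])
       (auto simp: sets_point_measure)
  interpret P: finite_measure ?P
    by (rule finite_measureI) (simp add: emeasure_point_measure_finite space_point_measure)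
  interpret pair_sigma_finite ?P \<nu> ..
  have int: "integrable (?P \<Otimes>\<^sub>M \<nu>) (\<lambda>x. G (?f x))"
  proof -
    have "integrable (distr (?P \<Otimes>\<^sub>M \<nu>) borel ?f) G"
      using integrable_bounded[OF G B] by (simp flip: nu_eq_distr)
    then show ?thesis by (subst (asm) integrable_distr_eq) auto
  qed
  have "integral\<^sup>L \<nu> G = (\<integral>x. G (?f x) \<partial>(?P \<Otimes>\<^sub>M \<nu>))"
    by (subst nu_eq_distr, subst integral_distr) auto
  also have "\<dots> = (\<integral>k. \<integral>z. G (\<phi> k z) \<partial>\<nu> \<partial>?P)"
    using integral_fst'[OF int] by simp
  also have "\<dots> = (\<Sum>k<l. p k *\<^sub>R (\<integral>z. G (\<phi> k z) \<partial>\<nu>))"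
    by (rule lebesgue_integral_point_measure_finite) (auto intro: p_nonneg)
  finally show ?thesis .
qed

section \<open>Words, cylinders and the characteristic function\<close>

definition words :: "nat \<Rightarrow> nat list set" where
  "words n = {w. length w = n \<and> set w \<subseteq> {..<l}}"

text \<open>Expectation over a word of independent letters with law \<open>p\<close>, written as a
  nested finite sum so that no probability space of words has to be built.\<close>

primrec wexp :: "nat \<Rightarrow> (nat list \<Rightarrow> 'b::real_normed_vector) \<Rightarrow> 'b" where
  "wexp 0 F = F []"
| "wexp (Suc n) F = (\<Sum>k<l. p k *\<^sub>R wexp n (\<lambda>w. F (k # w)))"

lemma Cons_in_words: "k < l \<Longrightarrow> w \<in> words n \<Longrightarrow> k # w \<in> words (Suc n)"
  by (auto simp: words_def)

lemma take_in_words: "w \<in> words n \<Longrightarrow> m \<le> n \<Longrightarrow> take m w \<in> words m"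
  by (auto simp: words_def dest: in_set_takeD)

lemma length_words: "w \<in> words n \<Longrightarrow> length w = n"
  by (simp add: words_def)

lemma wexp_cong: "(\<And>w. w \<in> words n \<Longrightarrow> F w = G w) \<Longrightarrow> wexp n F = wexp n G"
proof (induction n arbitrary: F G)
  case (Suc n)
  have "wexp n (\<lambda>w. F (k # w)) = wexp n (\<lambda>w. G (k # w))" if "k < l" for k
    using that by (intro Suc.IH Suc.prems Cons_in_words)
  then show ?case by simp
qed (simp add: words_def)

lemma wexp_mono:
  fixes F G :: "nat list \<Rightarrow> real"
  shows "(\<And>w. w \<in> words n \<Longrightarrow> F w \<le> G w) \<Longrightarrow> wexp n F \<le> wexp n G"
proof (induction n arbitrary: F G)
  case (Suc n)
  have "wexp n (\<lambda>w. F (k # w)) \<le> wexp n (\<lambda>w. G (k # w))" if "k < l" for k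
    using that by (intro Suc.IH Suc.prems Cons_in_words)
  then show ?case by (auto intro!: sum_mono mult_left_mono p_nonneg)
qed (simp add: words_def)

lemma wexp_const: "wexp n (\<lambda>_. a) = a"
  by (induction n) (auto simp: p_sum simp flip: scaleR_left.sum)

lemma wexp_sum: "wexp n (\<lambda>w. \<Sum>i\<in>I. F i w) = (\<Sum>i\<in>I. wexp n (F i))"
proof (induction n arbitrary: F)
  case (Suc n)
  show ?case by (simp add: Suc scaleR_sum_right sum.swap[of _ I])
qed simp

lemma wexp_bounded_linear: "bounded_linear f \<Longrightarrow> f (wexp n F) = wexp n (\<lambda>w. f (F w))"
  by (induction n arbitrary: F) (simp_all add: bounded_linear.linear linear_sum linear_cmul)

lemma norm_wexp_le: "norm (wexp n F) \<le> wexp n (\<lambda>w. norm (F w))"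
proof (induction n arbitrary: F)
  case (Suc n)
  have "norm (p k *\<^sub>R wexp n (\<lambda>w. F (k # w))) \<le> p k *\<^sub>R wexp n (\<lambda>w. norm (F (k # w)))" if "k < l" for k
    using p_pos[OF that] Suc[of "\<lambda>w. F (k # w)"] by (simp add: mult_left_mono)
  then show ?case by (auto intro!: sum_norm_le)
qed simp

lemma norm_wexp_le_const: "(\<And>w. w \<in> words n \<Longrightarrow> norm (F w) \<le> B) \<Longrightarrow> norm (wexp n F) \<le> B"
  using order_trans[OF norm_wexp_le wexp_mono[of n "\<lambda>w. norm (F w)" "\<lambda>_. B"]] by (simp add: wexp_const)

lemma wexp_append: "wexp (m + n) F = wexp m (\<lambda>u. wexp n (\<lambda>v. F (u @ v)))"
  by (induction m arbitrary: F) simp_all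

text \<open>The first letter acts outermost, so the generation \<open>L\<close> cylinder around
  \<open>wmap w z\<close> is given by the prefix \<open>take L w\<close>.\<close>

primrec wmap :: "nat list \<Rightarrow> complex \<Rightarrow> complex" where
  "wmap [] z = z"
| "wmap (k # w) z = \<phi> k (wmap w z)"

definition rot :: "nat list \<Rightarrow> complex" where
  "rot w = prod_list (map c w)"

lemma norm_rot: "w \<in> words n \<Longrightarrow> cmod (rot w) = 1"
proof (induction w arbitrary: n)
  case (Cons k w)
  then have "cmod (rot w) = 1" "k < l" by (auto simp: words_def)
  then show ?case by (simp add: rot_def norm_mult norm_c)
qed (simp add: rot_def)

lemma wmap_append: "wmap (u @ v) z = wmap u (wmap v z)"
  by (induction u) simp_all

lemma wmap_affine: "wmap w z = of_real (r ^ length w) * rot w * z + wmap w 0"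
  by (induction w) (simp_all add: rot_def \<phi>_def algebra_simps)

lemma measurable_wmap[measurable]: "wmap w \<in> borel_measurable borel"
  by (induction w) (auto intro: measurable_compose)

lemma integral_words:
  fixes G :: "complex \<Rightarrow> 'b::{banach, second_countable_topology}"
  assumes "G \<in> borel_measurable borel" "\<And>z. norm (G z) \<le> B"
  shows "integral\<^sup>L \<nu> G = wexp n (\<lambda>w. \<integral>z. G (wmap w z) \<partial>\<nu>)"
  using assms
proof (induction n arbitrary: G)
  case (Suc n)
  note [measurable] = Suc.prems(1)
  have "integral\<^sup>L \<nu> G = (\<Sum>k<l. p k *\<^sub>R (\<integral>z. G (\<phi> k z) \<partial>\<nu>))"
    by (rule integral_self_similar) fact+
  also have "\<dots> = (\<Sum>k<l. p k *\<^sub>R wexp n (\<lambda>w. \<integral>z. G (\<phi> k (wmap w z)) \<partial>\<nu>))"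
    by (subst Suc.IH) (use Suc.prems in auto)
  finally show ?case by simp
qed simp

text \<open>The pairing is Re (\<xi> z), without conjugation, so that passing to a cylinder
  multiplies the frequency by the rotation of its word and not by the conjugate.\<close>

definition char_fun :: "complex \<Rightarrow> complex" where
  "char_fun \<xi> = (\<integral>z. cis (Re (\<xi> * z)) \<partial>\<nu>)"

lemma measurable_character: "(\<lambda>z. cis (Re (\<xi> * z))) \<in> borel_measurable borel"
  by measurable

lemma norm_char_fun_le: "cmod (char_fun \<xi>) \<le> 1"
proof -
  have "cmod (char_fun \<xi>) \<le> (\<integral>z. cmod (cis (Re (\<xi> * z))) \<partial>\<nu>)"
    unfolding char_fun_def by (rule integral_norm_bound)
  then show ?thesis using prob_space by simp
qed

lemma char_fun_lipschitz: "cmod (char_fun \<xi> - char_fun \<xi>') \<le> 2 * cmod (\<xi> - \<xi>')"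
proof -
  have i: "integrable \<nu> (\<lambda>z. cis (Re (\<xi> * z)))" for \<xi>
    by (rule integrable_bounded[where B = 1, OF measurable_character]) simp
  have "cmod (char_fun \<xi> - char_fun \<xi>') = cmod (\<integral>z. cis (Re (\<xi> * z)) - cis (Re (\<xi>' * z)) \<partial>\<nu>)"
    unfolding char_fun_def using i by simp
  also have "\<dots> \<le> (\<integral>z. cmod (cis (Re (\<xi> * z)) - cis (Re (\<xi>' * z))) \<partial>\<nu>)"
    by (rule integral_norm_bound)
  also have "\<dots> \<le> (\<integral>z. 2 * cmod (\<xi> - \<xi>') \<partial>\<nu>)"
  proof (rule integral_mono_AE)
    show "AE z in \<nu>. cmod (cis (Re (\<xi> * z)) - cis (Re (\<xi>' * z))) \<le> 2 * cmod (\<xi> - \<xi>')"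
      using bounded
    proof eventually_elim
      case (elim z)
      have "cmod (cis (Re (\<xi> * z)) - cis (Re (\<xi>' * z))) \<le> \<bar>Re (\<xi> * z) - Re (\<xi>' * z)\<bar>"
        by (rule norm_cis_diff_le)
      also have "\<dots> = \<bar>Re ((\<xi> - \<xi>') * z)\<bar>" by (simp add: algebra_simps)
      also have "\<dots> \<le> cmod (\<xi> - \<xi>') * cmod z" using abs_Re_le_cmod norm_mult by metis
      also have "\<dots> \<le> cmod (\<xi> - \<xi>') * 2" using elim by (intro mult_left_mono) auto
      finally show ?case by simp
    qed
  qed (use i in auto)
  finally show ?thesis using prob_space by simp
qed

lemma char_fun_wmap:
  assumes "length w = n"
  shows "(\<integral>z. cis (Re (\<xi> * wmap w z)) \<partial>\<nu>) = cis (Re (\<xi> * wmap w 0)) * char_fun (\<xi> * of_real (r ^ n) * rot w)"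
proof -
  have "cis (Re (\<xi> * wmap w z)) = cis (Re (\<xi> * wmap w 0)) * cis (Re (\<xi> * of_real (r ^ n) * rot w * z))" for z
  proof -
    have "\<xi> * wmap w z = \<xi> * wmap w 0 + \<xi> * of_real (r ^ n) * rot w * z"
      using wmap_affine[of w z] assms by (simp add: distrib_left mult.assoc)
    then show ?thesis by (simp only: plus_complex.sel cis_mult)
  qed
  then have "(\<integral>z. cis (Re (\<xi> * wmap w z)) \<partial>\<nu>)
      = (\<integral>z. cis (Re (\<xi> * wmap w 0)) * cis (Re (\<xi> * of_real (r ^ n) * rot w * z)) \<partial>\<nu>)"
    by (intro Bochner_Integration.integral_cong refl)
  then show ?thesis unfolding char_fun_def by (simp only: integral_mult_right_zero)
qed

text \<open>The translation parts of the cylinder maps contribute only phases, which are dropped;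
  what remains is a random walk of rotations at the reduced scale r^n.\<close>

lemma norm_char_fun_le_words:
  "cmod (char_fun \<xi>) \<le> wexp n (\<lambda>w. cmod (char_fun (\<xi> * of_real (r ^ n) * rot w)))"
proof -
  have "char_fun \<xi> = wexp n (\<lambda>w. \<integral>z. cis (Re (\<xi> * wmap w z)) \<partial>\<nu>)"
    unfolding char_fun_def by (rule integral_words[where B = 1, OF measurable_character]) simp
  also have "\<dots> = wexp n (\<lambda>w. cis (Re (\<xi> * wmap w 0)) * char_fun (\<xi> * of_real (r ^ n) * rot w))"
    by (rule wexp_cong) (rule char_fun_wmap[OF length_words])
  also have "cmod \<dots> \<le> wexp n (\<lambda>w. cmod (cis (Re (\<xi> * wmap w 0)) * char_fun (\<xi> * of_real (r ^ n) * rot w)))"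
    by (rule norm_wexp_le)
  finally show ?thesis by (simp add: norm_mult)
qed

end

section \<open>Characters and their means over cylinders\<close>

text \<open>Subtraction is truncated, so one exponent is always 0 and the summand is x to the power
  |j - k|: two geometric series.\<close>

lemma sum_power_distance_le:
  fixes x :: real
  assumes x: "0 \<le> x" "x < 1"
  shows "(\<Sum>j<N. x ^ (j - k) * x ^ (k - j)) \<le> 2 / (1 - x)"
proof -
  have geo: "(\<Sum>i\<in>A. x ^ i) \<le> 1 / (1 - x)" if "finite A" for A
    using sum_le_suminf[OF summable_geometric, of x A] suminf_geometric[of x] that x by auto
  have "(\<Sum>j<N. x ^ (j - k) * x ^ (k - j)) \<le> (\<Sum>j\<in>{..<N} \<inter> {..k}. x ^ (k - j)) + (\<Sum>j\<in>{..<N} \<inter> {k..}. x ^ (j - k))"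
  proof -
    have "(\<Sum>j<N. x ^ (j - k) * x ^ (k - j)) \<le> (\<Sum>j<N. (if j \<in> {..k} then x ^ (k - j) else 0) + (if j \<in> {k..} then x ^ (j - k) else 0))"
      using x by (intro sum_mono) auto
    then show ?thesis by (simp add: sum.distrib sum.If_cases Int_def)
  qed
  also have "(\<Sum>j\<in>{..<N} \<inter> {..k}. x ^ (k - j)) = (\<Sum>i\<in>(\<lambda>j. k - j) ` ({..<N} \<inter> {..k}). x ^ i)"
    by (subst sum.reindex) (auto simp: inj_on_def)
  also have "\<dots> \<le> 1 / (1 - x)" by (rule geo) simp
  also have "(\<Sum>j\<in>{..<N} \<inter> {k..}. x ^ (j - k)) = (\<Sum>i\<in>(\<lambda>j. j - k) ` ({..<N} \<inter> {k..}). x ^ i)"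
    by (subst sum.reindex) (auto simp: inj_on_def)
  also have "\<dots> \<le> 1 / (1 - x)" by (rule geo) simp
  finally show ?thesis by simp
qed
text \<open>Borel-Cantelli works only along a sparse sequence. Squares are sparse enough for
  summability, yet the gap P (2 i + 1) is negligible against P i^2, so bounded summands cannot spoil
  the average in between.\<close>

lemma square_interpolation:
  fixes f :: "nat \<Rightarrow> complex"
  assumes f: "\<And>k. cmod (f k) \<le> 1" and "P > 0" "\<epsilon> > 0"
    and ev: "eventually (\<lambda>i. cmod (\<Sum>k<P * i\<^sup>2. f k) \<le> \<epsilon> * real (P * i\<^sup>2)) sequentially"
  shows "eventually (\<lambda>N. cmod (\<Sum>k<N. f k) \<le> 2 * \<epsilon> * real N) sequentially"
proof -
  obtain I where I: "\<And>i. i \<ge> I \<Longrightarrow> cmod (\<Sum>k<P * i\<^sup>2. f k) \<le> \<epsilon> * real (P * i\<^sup>2)"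
    using ev unfolding eventually_sequentially by blast
  \<comment> \<open>For i \<ge> 3 / \<epsilon> the gap is at most 3 P i \<le> \<epsilon> P
    i^2.\<close>
  define J where "J = I + nat \<lceil>3 / \<epsilon>\<rceil> + 1"
  have "cmod (\<Sum>k<N. f k) \<le> 2 * \<epsilon> * real N" if N: "N \<ge> P * J\<^sup>2" for N
  proof -
    have "\<exists>i. P * i\<^sup>2 \<le> N \<and> N < P * (Suc i)\<^sup>2"
    proof -
      have "finite {i. P * i\<^sup>2 \<le> N}"
      proof (rule finite_subset)
        show "{i. P * i\<^sup>2 \<le> N} \<subseteq> {..N}"
        proof safe
          fix i assume "P * i\<^sup>2 \<le> N"
          have "i \<le> i * i" by simp
          also have "\<dots> \<le> P * i\<^sup>2" using \<open>P > 0\<close> by (simp add: power2_eq_square)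
          finally show "i \<le> N" using \<open>P * i\<^sup>2 \<le> N\<close> by simp
        qed
      qed simp
      moreover have "0 \<in> {i. P * i\<^sup>2 \<le> N}" by simp
      ultimately have "Max {i. P * i\<^sup>2 \<le> N} \<in> {i. P * i\<^sup>2 \<le> N}" "Suc (Max {i. P * i\<^sup>2 \<le> N}) \<notin> {i. P * i\<^sup>2 \<le> N}"
        by (metis Max_in empty_iff, metis Max_ge Suc_n_not_le_n)
      then show ?thesis by (auto simp: not_le)
    qed
    then obtain i where i: "P * i\<^sup>2 \<le> N" "N < P * (Suc i)\<^sup>2" by blast
    have "J < Suc i"
    proof (rule ccontr)
      assume "\<not> J < Suc i"
      then have "(Suc i)\<^sup>2 \<le> J\<^sup>2" by (intro power_mono) auto
      then have "P * (Suc i)\<^sup>2 \<le> P * J\<^sup>2" by (rule mult_left_mono) simp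
      then show False using i N by linarith
    qed
    then have iJ: "i \<ge> J" by simp
    have "i \<ge> 1" using iJ by (simp add: J_def)
    have "3 / \<epsilon> \<le> real i" using iJ unfolding J_def by linarith
    then have "3 \<le> \<epsilon> * real i" using \<open>\<epsilon> > 0\<close> by (simp add: field_simps)
    then have "3 * real i \<le> \<epsilon> * real i * real i" by (rule mult_right_mono) simp
    then have small: "real P * (2 * real i + 1) \<le> \<epsilon> * real (P * i\<^sup>2)"
    proof -
      have "2 * real i + 1 \<le> 3 * real i" using \<open>i \<ge> 1\<close> by simp
      also have "\<dots> \<le> \<epsilon> * real i * real i" by fact
      finally have "real P * (2 * real i + 1) \<le> real P * (\<epsilon> * real i * real i)" by (intro mult_left_mono) auto
      then show ?thesis by (simp add: power2_eq_square ac_simps)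
    qed
    have split: "(\<Sum>k<N. f k) = (\<Sum>k<P * i\<^sup>2. f k) + (\<Sum>k\<in>{P * i\<^sup>2..<N}. f k)"
      using sum.atLeastLessThan_concat[of 0 "P * i\<^sup>2" N f] i(1) by (simp add: lessThan_atLeast0)
    have "cmod (\<Sum>k\<in>{P * i\<^sup>2..<N}. f k) \<le> (\<Sum>k\<in>{P * i\<^sup>2..<N}. 1)"
      by (intro sum_norm_le f)
    also have "\<dots> = real N - real (P * i\<^sup>2)" using i(1) by (simp add: of_nat_diff)
    also have "\<dots> \<le> real (P * (Suc i)\<^sup>2) - real (P * i\<^sup>2)" using i(2) by linarith
    also have "\<dots> = real P * (2 * real i + 1)" by (simp add: power2_eq_square algebra_simps)
    also note small
    finally have "cmod (\<Sum>k<N. f k) \<le> \<epsilon> * real (P * i\<^sup>2) + \<epsilon> * real (P * i\<^sup>2)"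
      unfolding split using I[of i] iJ by (intro norm_triangle_le add_mono) (auto simp: J_def)
    also have "\<dots> \<le> 2 * (\<epsilon> * real N)" using i(1) \<open>\<epsilon> > 0\<close> by (simp add: mult_left_mono del: of_nat_mult)
    finally show ?thesis by simp
  qed
  then show ?thesis unfolding eventually_sequentially by blast
qed

context self_similar
begin

text \<open>The point is presented as \<open>wmap w z\<close> with a random word \<open>w\<close>,
  so its cylinder of generation \<open>L\<close> is read off the word; by
  \<open>integral_words\<close> this presentation reproduces \<nu>.\<close>

definition fluct :: "complex \<Rightarrow> nat \<Rightarrow> nat list \<Rightarrow> complex \<Rightarrow> complex" where
  "fluct \<eta> L w z = cis (Re (\<eta> * wmap w z)) - (\<integral>y. cis (Re (\<eta> * wmap (take L w) y)) \<partial>\<nu>)"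

lemma measurable_character_wmap: "(\<lambda>z. cis (Re (\<eta> * wmap w z))) \<in> borel_measurable borel"
  by measurable

lemma measurable_fluct[measurable]: "fluct \<eta> L w \<in> borel_measurable borel"
  unfolding fluct_def by measurable

lemma norm_mean_character_le: "cmod (\<integral>y. cis (Re (\<eta> * wmap w y)) \<partial>\<nu>) \<le> 1"
  using integral_norm_bound[of \<nu> "\<lambda>y. cis (Re (\<eta> * wmap w y))"] prob_space by simp

lemma norm_fluct_le: "cmod (fluct \<eta> L w z) \<le> 2"
  unfolding fluct_def using norm_mean_character_le[of \<eta> "take L w"]
  by (intro order_trans[OF norm_triangle_ineq4]) simp

lemma norm_cnj_fluct_mult_le: "cmod (cnj (fluct \<eta> L w z) * fluct \<eta>' L' w z) \<le> 4"
  using mult_mono[OF norm_fluct_le norm_fluct_le] by (simp add: norm_mult)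

text \<open>Condition on the first \<open>L'\<close> letters. The finer fluctuation has mean 0 on
  that cylinder, while the coarser one is nearly constant there, because the cylinder has size of
  order \<open>r ^ L'\<close>.\<close>

lemma correlation_fluct:
  assumes L: "L \<le> L'" "L' \<le> n"
  shows "cmod (wexp n (\<lambda>w. \<integral>z. cnj (fluct \<eta> L w z) * fluct \<eta>' L' w z \<partial>\<nu>)) \<le> 4 * cmod \<eta> * r ^ L'"
proof -
  obtain m where n: "n = L' + m" using L by (metis le_add_diff_inverse)
  define a where "a \<eta> u = (\<integral>y. cis (Re (\<eta> * wmap u y)) \<partial>\<nu>)" for \<eta> u
  \<comment> \<open>The product of the two fluctuations seen from inside the cylinder of
    \<open>u\<close>: both means depend on \<open>u\<close> only.\<close>
  define \<Psi> where "\<Psi> u y = cnj (cis (Re (\<eta> * wmap u y)) - a \<eta> (take L u)) * (cis (Re (\<eta>' * wmap u y)) - a \<eta>' u)" for u y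
  have [measurable]: "\<Psi> u \<in> borel_measurable borel" for u
    unfolding \<Psi>_def by measurable
  have na: "cmod (a \<eta> u) \<le> 1" for \<eta> u
    unfolding a_def by (rule norm_mean_character_le)
  have two: "cmod (cis x - a \<eta> u) \<le> 2" for x \<eta> u
    using na[of \<eta> u] by (intro order_trans[OF norm_triangle_ineq4]) simp
  have \<Psi>_le: "cmod (\<Psi> u y) \<le> 4" for u y
    using mult_mono[OF two two] by (simp add: \<Psi>_def norm_mult del: complex_cnj_diff)
  have "wexp n (\<lambda>w. \<integral>z. cnj (fluct \<eta> L w z) * fluct \<eta>' L' w z \<partial>\<nu>)
      = wexp L' (\<lambda>u. wexp m (\<lambda>v. \<integral>z. \<Psi> u (wmap v z) \<partial>\<nu>))"
    unfolding n wexp_append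
  proof (intro wexp_cong Bochner_Integration.integral_cong refl)
    fix u v z assume "u \<in> words L'" "v \<in> words m"
    then have len: "length u = L'" by (simp add: words_def)
    show "cnj (fluct \<eta> L (u @ v) z) * fluct \<eta>' L' (u @ v) z = \<Psi> u (wmap v z)"
      unfolding fluct_def \<Psi>_def a_def wmap_append using L len by simp
  qed
  also have "\<dots> = wexp L' (\<lambda>u. \<integral>z. \<Psi> u z \<partial>\<nu>)"
    by (intro wexp_cong integral_words[symmetric, of _ 4] \<Psi>_le) measurable
  also have "cmod \<dots> \<le> 4 * cmod \<eta> * r ^ L'"
  proof (rule norm_wexp_le_const)
    fix u assume u: "u \<in> words L'"
    \<comment> \<open>The coarser factor is its value at one point of the cylinder, which drops out
      against the mean 0 of \<open>g\<close>, plus the variation \<open>\<Delta>\<close>. The final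
      constant 4 is the radius 2 of the support times the bound 2 for \<open>g\<close>.\<close>
    define b where "b = cnj (cis (Re (\<eta> * wmap u 0)) - a \<eta> (take L u))"
    define \<Delta> where "\<Delta> y = cis (Re (\<eta> * wmap u y)) - cis (Re (\<eta> * wmap u 0))" for y
    define g where "g y = cis (Re (\<eta>' * wmap u y)) - a \<eta>' u" for y
    have [measurable]: "\<Delta> \<in> borel_measurable borel" "g \<in> borel_measurable borel"
      unfolding \<Delta>_def g_def by measurable
    have ig: "integrable \<nu> g" unfolding g_def by (rule integrable_bounded[of _ 2]) (auto intro: two)
    have g0: "(\<integral>y. g y \<partial>\<nu>) = 0"
    proof -
      have "integrable \<nu> (\<lambda>y. cis (Re (\<eta>' * wmap u y)))" by (rule integrable_bounded[where B = 1, OF measurable_character_wmap]) simp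
      then show ?thesis unfolding g_def a_def using prob_space by simp
    qed
    have \<Delta>2: "cmod (\<Delta> y) \<le> 2" for y
      unfolding \<Delta>_def by (intro order_trans[OF norm_triangle_ineq4]) simp
    have i\<Delta>: "integrable \<nu> (\<lambda>y. cnj (\<Delta> y) * g y)"
    proof (rule integrable_bounded[where B = 4])
      show "cmod (cnj (\<Delta> y) * g y) \<le> 4" for y
        using mult_mono[OF \<Delta>2[of y], of "cmod (g y)" 2] two unfolding g_def by (simp add: norm_mult)
    qed measurable
    have split: "\<Psi> u y = b * g y + cnj (\<Delta> y) * g y" for y
      by (simp add: \<Psi>_def b_def \<Delta>_def g_def algebra_simps)
    have "(\<integral>y. \<Psi> u y \<partial>\<nu>) = b * (\<integral>y. g y \<partial>\<nu>) + (\<integral>y. cnj (\<Delta> y) * g y \<partial>\<nu>)"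
      unfolding split using ig i\<Delta> by simp
    then have "cmod (\<integral>y. \<Psi> u y \<partial>\<nu>) = cmod (\<integral>y. cnj (\<Delta> y) * g y \<partial>\<nu>)" by (simp add: g0)
    also have "\<dots> \<le> (\<integral>y. cmod (cnj (\<Delta> y) * g y) \<partial>\<nu>)" by (rule integral_norm_bound)
    also have "\<dots> \<le> (\<integral>y. 4 * cmod \<eta> * r ^ L' \<partial>\<nu>)"
    proof (rule integral_mono_AE)
      show "AE y in \<nu>. cmod (cnj (\<Delta> y) * g y) \<le> 4 * cmod \<eta> * r ^ L'"
        using bounded
      proof eventually_elim
        case (elim y)
        have "cmod (\<Delta> y) \<le> \<bar>Re (\<eta> * wmap u y) - Re (\<eta> * wmap u 0)\<bar>"
          unfolding \<Delta>_def by (rule norm_cis_diff_le)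
        also have "\<dots> = \<bar>Re (\<eta> * (of_real (r ^ L') * rot u * y))\<bar>"
        proof -
          have "wmap u y - wmap u 0 = of_real (r ^ L') * rot u * y"
            using wmap_affine[of u y] length_words[OF u] by simp
          then have "\<eta> * (of_real (r ^ L') * rot u * y) = \<eta> * wmap u y - \<eta> * wmap u 0"
            by (metis right_diff_distrib)
          then show ?thesis by simp
        qed
        also have "\<dots> \<le> cmod (\<eta> * (of_real (r ^ L') * rot u * y))" by (rule abs_Re_le_cmod)
        also have "\<dots> = cmod \<eta> * r ^ L' * cmod y"
          using norm_rot[OF u] r by (simp add: norm_mult norm_power)
        also have "\<dots> \<le> cmod \<eta> * r ^ L' * 2" using elim r by (intro mult_left_mono) auto
        finally have "cmod (\<Delta> y) * cmod (g y) \<le> (cmod \<eta> * r ^ L' * 2) * 2"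
          using two r unfolding g_def by (intro mult_mono) auto
        then show ?case by (simp add: norm_mult)
      qed
    qed (use i\<Delta> in auto)
    finally show "cmod (\<integral>y. \<Psi> u y \<partial>\<nu>) \<le> 4 * cmod \<eta> * r ^ L'" using prob_space by simp
  qed
  finally show ?thesis .
qed

lemma correlation_fluct_le_4:
  "cmod (wexp n (\<lambda>w. \<integral>z. cnj (fluct \<eta> L w z) * fluct \<eta>' L' w z \<partial>\<nu>)) \<le> 4"
proof (rule norm_wexp_le_const)
  fix w
  have "cmod (\<integral>z. cnj (fluct \<eta> L w z) * fluct \<eta>' L' w z \<partial>\<nu>) \<le> (\<integral>z. cmod (cnj (fluct \<eta> L w z) * fluct \<eta>' L' w z) \<partial>\<nu>)"
    by (rule integral_norm_bound)
  also have "\<dots> \<le> (\<integral>z. 4 \<partial>\<nu>)"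
  proof (rule integral_mono)
    show "integrable \<nu> (\<lambda>z. cmod (cnj (fluct \<eta> L w z) * fluct \<eta>' L' w z))"
      by (rule integrable_bounded[where B = 4]) (measurable, use norm_cnj_fluct_mult_le in simp)
  qed (use norm_cnj_fluct_mult_le in auto)
  finally show "cmod (\<integral>z. cnj (fluct \<eta> L w z) * fluct \<eta>' L' w z \<partial>\<nu>) \<le> 4" using prob_space by simp
qed

text \<open>Correlations decay like \<kappa> to the power -|j - k|, so the second moment grows
  linearly in N instead of quadratically. The two parts of \<open>K0\<close> belong to the two
  possible orders of \<open>L j\<close> and \<open>L k\<close>.\<close>

lemma second_moment_fluct:
  assumes \<kappa>: "\<kappa> > 1" and \<eta>: "\<And>k. cmod (\<eta> k) \<le> C * \<kappa> ^ k"
    and L: "\<And>k. c1 \<le> \<kappa> ^ k * r ^ L k" "\<And>k. \<kappa> ^ k * r ^ L k \<le> c2" "c1 > 0"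
  shows "\<exists>K\<ge>0. \<forall>N n. (\<forall>k<N. L k \<le> n) \<longrightarrow>
    wexp n (\<lambda>w. \<integral>z. (cmod (\<Sum>k<N. fluct (\<eta> k) (L k) w z))\<^sup>2 \<partial>\<nu>) \<le> K * real N"
proof -
  define x where "x = 1 / \<kappa>"
  have x: "0 < x" "x < 1" using \<kappa> by (auto simp: x_def)
  have C: "C \<ge> 0" using order_trans[OF norm_ge_zero \<eta>[of 0]] by simp
  have c2: "c2 > 0" using L(1,2)[of 0] L(3) by linarith
  define K0 where "K0 = 4 * (C * c2) + 4 * (c2 / c1)"
  have K0: "K0 \<ge> 0" using C c2 L(3) by (simp add: K0_def)
  define E where "E n j k = wexp n (\<lambda>w. \<integral>z. cnj (fluct (\<eta> j) (L j) w z) * fluct (\<eta> k) (L k) w z \<partial>\<nu>)" for n j k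
  have E_cnj: "cmod (E n j k) = cmod (E n k j)" for n j k
  proof -
    have "cnj (E n j k) = wexp n (\<lambda>w. cnj (\<integral>z. cnj (fluct (\<eta> j) (L j) w z) * fluct (\<eta> k) (L k) w z \<partial>\<nu>))"
      unfolding E_def by (rule wexp_bounded_linear) (rule bounded_linear_cnj)
    also have "\<dots> = E n k j"
      unfolding E_def Bochner_Integration.integral_cnj[symmetric]
      by (simp add: mult.commute del: Bochner_Integration.integral_cnj)
    finally show ?thesis by (metis complex_mod_cnj)
  qed
  have E_le: "cmod (E n j k) \<le> K0 * x ^ (k - j)" if jk: "j \<le> k" and n: "L j \<le> n" "L k \<le> n" for n j k
  proof (cases "L j \<le> L k")
    case True
    have "cmod (E n j k) \<le> 4 * cmod (\<eta> j) * r ^ L k"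
      unfolding E_def by (rule correlation_fluct[OF True n(2)])
    also have "\<dots> \<le> 4 * (C * \<kappa> ^ j) * (c2 * x ^ k)"
    proof (intro mult_mono mult_left_mono \<eta>)
      show "r ^ L k \<le> c2 * x ^ k" using L(2)[of k] \<kappa> by (simp add: x_def field_simps)
    qed (use C r \<kappa> c2 in auto)
    also have "\<dots> = 4 * (C * c2) * (\<kappa> ^ j * x ^ k)" by simp
    also have "\<kappa> ^ j * x ^ k = x ^ (k - j)"
    proof -
      have "x ^ k = x ^ (k - j) * x ^ j" using jk by (simp flip: power_add)
      then show ?thesis using \<kappa> by (simp add: x_def power_divide)
    qed
    also have "4 * (C * c2) * x ^ (k - j) \<le> K0 * x ^ (k - j)"
      using x c2 L(3) by (intro mult_right_mono) (auto simp: K0_def)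
    finally show ?thesis .
  next
    case False
    \<comment> \<open>The schedule may decrease. If \<open>L j > L k\<close> although j \<le> k, the
      two-sided size bounds force \<open>\<kappa> ^ (k - j)\<close> \<le> c2 / c1, and the trivial
      bound 4 is already of the required form.\<close>
    then have "r ^ L j \<le> r ^ L k" using r by (intro power_decreasing) auto
    have "c1 \<le> \<kappa> ^ j * r ^ L j" by (rule L)
    also have "\<dots> \<le> \<kappa> ^ j * r ^ L k" using \<open>r ^ L j \<le> r ^ L k\<close> \<kappa> by (intro mult_left_mono) auto
    also have "\<dots> \<le> \<kappa> ^ j * (c2 * x ^ k)"
      using L(2)[of k] \<kappa> by (intro mult_left_mono) (auto simp: x_def field_simps)
    also have "\<dots> = c2 * x ^ (k - j)"
    proof -
      have "x ^ k = x ^ (k - j) * x ^ j" using jk by (simp flip: power_add)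
      then show ?thesis using \<kappa> by (simp add: x_def power_divide)
    qed
    finally have "4 \<le> 4 * (c2 / c1) * x ^ (k - j)" using L(3) by (simp add: field_simps)
    also have "\<dots> \<le> K0 * x ^ (k - j)"
      using x c2 C by (intro mult_right_mono) (auto simp: K0_def)
    finally show ?thesis unfolding E_def using correlation_fluct_le_4 order_trans by blast
  qed
  have E_le': "cmod (E n j k) \<le> K0 * (x ^ (j - k) * x ^ (k - j))" if n: "L j \<le> n" "L k \<le> n" for n j k
    using E_le[of j k n] E_le[of k j n] n E_cnj[of n j k] by (cases "j \<le> k") auto
  show ?thesis
  proof (intro exI[of _ "K0 * (2 / (1 - x))"] conjI allI impI)
    show "K0 * (2 / (1 - x)) \<ge> 0" using K0 x by auto
    fix N n assume n: "\<forall>k<N. L k \<le> n"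
    let ?Y = "\<lambda>w z. \<Sum>k<N. fluct (\<eta> k) (L k) w z"
    have int: "integrable \<nu> (\<lambda>z. cnj (fluct (\<eta> j) (L j) w z) * fluct (\<eta> k) (L k) w z)" for j k w
      by (rule integrable_bounded[where B = 4]) (measurable, rule norm_cnj_fluct_mult_le)
    have "complex_of_real (wexp n (\<lambda>w. \<integral>z. (cmod (?Y w z))\<^sup>2 \<partial>\<nu>)) = wexp n (\<lambda>w. \<integral>z. complex_of_real ((cmod (?Y w z))\<^sup>2) \<partial>\<nu>)"
      by (subst wexp_bounded_linear[OF bounded_linear_of_real]) (simp only: integral_complex_of_real)
    also have "\<dots> = wexp n (\<lambda>w. \<integral>z. (\<Sum>k<N. \<Sum>j<N. cnj (fluct (\<eta> j) (L j) w z) * fluct (\<eta> k) (L k) w z) \<partial>\<nu>)"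
    proof -
      have "complex_of_real ((cmod (?Y w z))\<^sup>2) = (\<Sum>k<N. \<Sum>j<N. cnj (fluct (\<eta> j) (L j) w z) * fluct (\<eta> k) (L k) w z)" for w z
        unfolding complex_norm_square by (simp add: sum_product ac_simps)
      then show ?thesis by simp
    qed
    also have "\<dots> = (\<Sum>k<N. \<Sum>j<N. E n j k)"
      unfolding E_def wexp_sum[symmetric] using int by (intro wexp_cong) simp
    finally have eq: "complex_of_real (wexp n (\<lambda>w. \<integral>z. (cmod (?Y w z))\<^sup>2 \<partial>\<nu>)) = (\<Sum>k<N. \<Sum>j<N. E n j k)" .
    have "wexp n (\<lambda>w. \<integral>z. (cmod (?Y w z))\<^sup>2 \<partial>\<nu>) \<le> cmod (\<Sum>k<N. \<Sum>j<N. E n j k)"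
      unfolding eq[symmetric] norm_of_real by (rule abs_ge_self)
    also have "\<dots> \<le> (\<Sum>k<N. \<Sum>j<N. K0 * (x ^ (j - k) * x ^ (k - j)))"
      using n by (intro sum_norm_le E_le') auto
    also have "\<dots> = K0 * (\<Sum>k<N. \<Sum>j<N. x ^ (j - k) * x ^ (k - j))"
      by (simp add: sum_distrib_left)
    also have "\<dots> \<le> K0 * (\<Sum>k<N. 2 / (1 - x))"
      using x K0 by (intro mult_left_mono sum_mono sum_power_distance_le) auto
    finally show "wexp n (\<lambda>w. \<integral>z. (cmod (?Y w z))\<^sup>2 \<partial>\<nu>) \<le> K0 * (2 / (1 - x)) * real N"
      by (simp add: ac_simps)
  qed
qed

text \<open>Chebyshev's inequality: if the means contribute at most \<epsilon> N whatever the word,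
  a sum of size 2 \<epsilon> N needs fluctuations of total size \<epsilon> N. The constant
  \<open>K\<close> does not depend on N or \<epsilon>, as summation along squares requires. The
  rotations \<open>d\<close> are arbitrary because those of the prefixes vary with the
  point.\<close>

lemma character_sum_deviation:
  assumes \<kappa>: "\<kappa> > 1" and \<eta>: "\<And>k. cmod (\<eta> k) \<le> C * \<kappa> ^ k"
    and L: "\<And>k. c1 \<le> \<kappa> ^ k * r ^ L k" "\<And>k. \<kappa> ^ k * r ^ L k \<le> c2" "c1 > 0"
  shows "\<exists>K\<ge>0. \<forall>N \<epsilon>. N > 0 \<longrightarrow> \<epsilon> > 0 \<longrightarrow>
    (\<forall>d. (\<forall>k<N. d k \<in> rot ` words (L k)) \<longrightarrow>
       (\<Sum>k<N. cmod (char_fun (\<eta> k * of_real (r ^ L k) * d k))) \<le> \<epsilon> * real N) \<longrightarrow>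
    measure \<nu> {z. cmod (\<Sum>k<N. cis (Re (\<eta> k * z))) \<ge> 2 * \<epsilon> * real N} \<le> K / (\<epsilon>\<^sup>2 * real N)"
proof -
  obtain K where K: "K \<ge> 0" "\<forall>N n. (\<forall>k<N. L k \<le> n) \<longrightarrow>
    wexp n (\<lambda>w. \<integral>z. (cmod (\<Sum>k<N. fluct (\<eta> k) (L k) w z))\<^sup>2 \<partial>\<nu>) \<le> K * real N"
    using second_moment_fluct[OF assms] by blast
  show ?thesis
  proof (intro exI[of _ K] conjI allI impI K(1))
    fix N :: nat and \<epsilon> :: real
    assume N: "N > 0" and \<epsilon>: "\<epsilon> > 0"
      and small: "\<forall>d. (\<forall>k<N. d k \<in> rot ` words (L k)) \<longrightarrow>
       (\<Sum>k<N. cmod (char_fun (\<eta> k * of_real (r ^ L k) * d k))) \<le> \<epsilon> * real N"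
    define S where "S z = (\<Sum>k<N. cis (Re (\<eta> k * z)))" for z
    have [measurable]: "S \<in> borel_measurable borel" unfolding S_def by measurable
    define A where "A = {z. cmod (S z) \<ge> 2 * \<epsilon> * real N}"
    have A[measurable]: "A \<in> sets borel" unfolding A_def by measurable
    \<comment> \<open>Any common depth beyond all the \<open>L k\<close> would do; the sum is
      one.\<close>
    define n where "n = (\<Sum>k<N. L k)"
    have n: "L k \<le> n" if "k < N" for k
      unfolding n_def using that by (intro member_le_sum) auto
    let ?Y = "\<lambda>w z. \<Sum>k<N. fluct (\<eta> k) (L k) w z"
    have iY: "integrable \<nu> (\<lambda>z. (cmod (?Y w z))\<^sup>2)" for w
    proof (rule integrable_bounded[where B = "(real N * 2)\<^sup>2"])
      fix z
      have "cmod (?Y w z) \<le> (\<Sum>k<N. 2)" by (intro sum_norm_le norm_fluct_le)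
      then have "cmod (?Y w z) \<le> real N * 2" by simp
      then show "norm ((cmod (?Y w z))\<^sup>2) \<le> (real N * 2)\<^sup>2"
        unfolding real_norm_def abs_power2 by (rule power_mono) simp
    qed measurable
    have Z: "\<epsilon> * real N > 0" using N \<epsilon> by simp
    have ind: "indicat_real A (wmap w z) \<le> (cmod (?Y w z))\<^sup>2 / (\<epsilon> * real N)\<^sup>2" if w: "w \<in> words n" for w z
    proof (cases "wmap w z \<in> A")
      case True
      have "(\<Sum>k<N. cmod (\<integral>y. cis (Re (\<eta> k * wmap (take (L k) w) y)) \<partial>\<nu>))
          = (\<Sum>k<N. cmod (char_fun (\<eta> k * of_real (r ^ L k) * rot (take (L k) w))))"
      proof (intro sum.cong refl)
        fix k assume "k \<in> {..<N}"
        then have "length (take (L k) w) = L k" using length_words[OF w] n by simp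
        from char_fun_wmap[OF this] show "cmod (\<integral>y. cis (Re (\<eta> k * wmap (take (L k) w) y)) \<partial>\<nu>)
          = cmod (char_fun (\<eta> k * of_real (r ^ L k) * rot (take (L k) w)))"
          by (simp only: norm_mult norm_cis mult_1_left)
      qed
      also have "\<dots> \<le> \<epsilon> * real N"
        using take_in_words[OF w] n by (intro small[rule_format]) auto
      finally have means: "cmod (\<Sum>k<N. \<integral>y. cis (Re (\<eta> k * wmap (take (L k) w) y)) \<partial>\<nu>) \<le> \<epsilon> * real N"
        by (rule order_trans[OF norm_sum])
      have "S (wmap w z) = ?Y w z + (\<Sum>k<N. \<integral>y. cis (Re (\<eta> k * wmap (take (L k) w) y)) \<partial>\<nu>)"
        unfolding S_def fluct_def sum_subtractf by simp
      then have "cmod (S (wmap w z)) \<le> cmod (?Y w z) + \<epsilon> * real N"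
        by (simp only:) (rule order_trans[OF norm_triangle_ineq add_left_mono[OF means]])
      then have "\<epsilon> * real N \<le> cmod (?Y w z)" using True by (simp add: A_def)
      then have "(\<epsilon> * real N)\<^sup>2 \<le> (cmod (?Y w z))\<^sup>2" using Z by (intro power_mono) auto
      moreover have "(\<epsilon> * real N)\<^sup>2 > 0" using Z by (metis zero_less_power)
      ultimately show ?thesis using True by (simp add: le_divide_eq_1)
    qed simp
    have "measure \<nu> A = (\<integral>z. indicat_real A z \<partial>\<nu>)" by (simp add: sets_nu)
    also have "\<dots> = wexp n (\<lambda>w. \<integral>z. indicat_real A (wmap w z) \<partial>\<nu>)"
      by (rule integral_words[where B = 1, OF borel_measurable_indicator[OF A]]) (simp add: indicator_def)
    also have "\<dots> \<le> wexp n (\<lambda>w. \<integral>z. (cmod (?Y w z))\<^sup>2 / (\<epsilon> * real N)\<^sup>2 \<partial>\<nu>)"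
    proof (intro wexp_mono integral_mono ind)
      show "integrable \<nu> (\<lambda>z. indicat_real A (wmap w z))" for w
        using measurable_compose[OF measurable_wmap borel_measurable_indicator[OF A]]
        by (rule integrable_bounded[where B = 1]) (simp add: indicator_def)
    qed (use iY in auto)
    also have "\<dots> = wexp n (\<lambda>w. \<integral>z. (cmod (?Y w z))\<^sup>2 \<partial>\<nu>) / (\<epsilon> * real N)\<^sup>2"
      by (simp add: wexp_bounded_linear[OF bounded_linear_divide, symmetric])
    also have "\<dots> \<le> (K * real N) / (\<epsilon> * real N)\<^sup>2"
      using K(2)[rule_format, of N n] n by (intro divide_right_mono) auto
    also have "\<dots> = K / (\<epsilon>\<^sup>2 * real N)" using N by (simp add: power2_eq_square)
    finally show "measure \<nu> {z. cmod (\<Sum>k<N. cis (Re (\<eta> k * z))) \<ge> 2 * \<epsilon> * real N} \<le> K / (\<epsilon>\<^sup>2 * real N)"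
      unfolding A_def S_def .
  qed
qed

text \<open>A schedule that picks cylinders of diameter comparable to \<open>\<kappa>\<^sup>-\<^sup>k\<close> and along which, averaged
  over blocks of length \<open>P\<close>, the characteristic function is small for all choices of rotations.\<close>

definition good_schedule :: "real \<Rightarrow> (nat \<Rightarrow> complex) \<Rightarrow> real \<Rightarrow> (nat \<Rightarrow> nat) \<Rightarrow> bool" where
  "good_schedule \<kappa> \<eta> \<epsilon> L \<longleftrightarrow>
     (\<exists>c1>0. \<exists>c2. \<forall>k. c1 \<le> \<kappa> ^ k * r ^ L k \<and> \<kappa> ^ k * r ^ L k \<le> c2) \<and>
     (\<exists>P>0. \<exists>B0. \<forall>B\<ge>B0. \<forall>d. (\<forall>k. d k \<in> rot ` words (L k)) \<longrightarrow>
        (\<Sum>k<P. cmod (char_fun (\<eta> (B * P + k) * of_real (r ^ L (B * P + k)) * d (B * P + k)))) \<le> \<epsilon> * real P)"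

text \<open>The factor 8 is three doublings of \<epsilon>: for the blocks before \<open>B0\<close>,
  for the fluctuations, and for the interpolation between squares.\<close>

lemma AE_eventually_character_average:
  assumes \<kappa>: "\<kappa> > 1" and \<eta>: "\<And>k. cmod (\<eta> k) \<le> C * \<kappa> ^ k" and \<epsilon>: "\<epsilon> > 0"
    and good: "good_schedule \<kappa> \<eta> \<epsilon> L"
  shows "AE z in \<nu>. eventually (\<lambda>N. cmod (\<Sum>k<N. cis (Re (\<eta> k * z))) \<le> 8 * \<epsilon> * real N) sequentially"
proof -
  obtain c1 c2 where c12: "c1 > 0" "\<And>k. c1 \<le> \<kappa> ^ k * r ^ L k" "\<And>k. \<kappa> ^ k * r ^ L k \<le> c2"
    using good unfolding good_schedule_def by blast
  obtain P B0 where P: "P > 0" and block: "\<And>B d. B \<ge> B0 \<Longrightarrow> (\<And>k. d k \<in> rot ` words (L k)) \<Longrightarrow>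
        (\<Sum>k<P. cmod (char_fun (\<eta> (B * P + k) * of_real (r ^ L (B * P + k)) * d (B * P + k)))) \<le> \<epsilon> * real P"
    using good unfolding good_schedule_def by blast
  obtain K where K: "K \<ge> 0" "\<And>N \<epsilon>. N > 0 \<Longrightarrow> \<epsilon> > 0 \<Longrightarrow>
    (\<And>d. (\<And>k. k < N \<Longrightarrow> d k \<in> rot ` words (L k)) \<Longrightarrow>
       (\<Sum>k<N. cmod (char_fun (\<eta> k * of_real (r ^ L k) * d k))) \<le> \<epsilon> * real N) \<Longrightarrow>
    measure \<nu> {z. cmod (\<Sum>k<N. cis (Re (\<eta> k * z))) \<ge> 2 * \<epsilon> * real N} \<le> K / (\<epsilon>\<^sup>2 * real N)"
    using character_sum_deviation[OF \<kappa> \<eta> c12(2,3,1)] by blast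
  \<comment> \<open>From here on the at most \<open>B0\<close> uncontrolled blocks, each bounded
    trivially by P, weigh at most \<epsilon> P i^2.\<close>
  define J where "J = nat \<lceil>real B0 / \<epsilon>\<rceil> + 1"
  define A where "A i = (if i < J then {} else {z. cmod (\<Sum>k<P * i\<^sup>2. cis (Re (\<eta> k * z))) \<ge> 2 * (2 * \<epsilon>) * real (P * i\<^sup>2)})" for i
  have A_le: "measure \<nu> (A i) \<le> (K / ((2 * \<epsilon>)\<^sup>2 * real P)) * (1 / real i ^ 2)" for i
  proof (cases "i < J")
    case True
    then show ?thesis using K(1) by (simp add: A_def)
  next
    case False
    then have i: "i \<ge> J" by simp
    then have "i \<ge> 1" by (simp add: J_def)
    have "measure \<nu> (A i) \<le> K / ((2 * \<epsilon>)\<^sup>2 * real (P * i\<^sup>2))"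
      unfolding A_def using False
    proof (simp only: if_False, intro K(2))
      show "P * i\<^sup>2 > 0" "2 * \<epsilon> > 0" using P \<open>i \<ge> 1\<close> \<epsilon> by auto
      fix d assume d: "\<And>k. k < P * i\<^sup>2 \<Longrightarrow> d k \<in> rot ` words (L k)"
      \<comment> \<open>The schedule condition asks for admissible rotations at all indices, so
        \<open>d\<close> is continued by the rotation of the constant word 0.\<close>
      define d' where "d' k = (if k < P * i\<^sup>2 then d k else rot (replicate (L k) 0))" for k
      have "l > 0" using p_sum by (cases l) auto
      then have d': "d' k \<in> rot ` words (L k)" for k
        using d[of k] by (auto simp: d'_def words_def intro!: imageI)
      let ?h = "\<lambda>k. cmod (char_fun (\<eta> k * of_real (r ^ L k) * d' k))"
      have one: "(\<Sum>k<P. ?h (B * P + k)) \<le> \<epsilon> * real P + (if B < B0 then real P else 0)" for B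
      proof (cases "B < B0")
        case True
        have "(\<Sum>k<P. ?h (B * P + k)) \<le> (\<Sum>k<P. 1)" by (intro sum_mono norm_char_fun_le)
        then show ?thesis using True \<epsilon> by (simp add: add_increasing)
      qed (use block[of B d'] d' in auto)
      have "(\<Sum>k<P * i\<^sup>2. cmod (char_fun (\<eta> k * of_real (r ^ L k) * d k))) = (\<Sum>k<i\<^sup>2 * P. ?h k)"
        by (intro sum.cong) (auto simp: d'_def mult.commute)
      also have "\<dots> = (\<Sum>B<i\<^sup>2. sum ?h {B * P..<B * P + P})" by (rule sum.nat_group[symmetric])
      also have "\<dots> = (\<Sum>B<i\<^sup>2. \<Sum>k<P. ?h (B * P + k))"
      proof (rule sum.cong[OF refl])
        fix B
        show "sum ?h {B * P..<B * P + P} = (\<Sum>k<P. ?h (B * P + k))"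
          using sum.shift_bounds_nat_ivl[of ?h 0 "B * P" P] by (simp only: lessThan_atLeast0 add_0 add.commute)
      qed
      also have "\<dots> \<le> (\<Sum>B<i\<^sup>2. \<epsilon> * real P + (if B < B0 then real P else 0))" by (intro sum_mono one)
      also have "\<dots> = \<epsilon> * real P * real (i\<^sup>2) + real P * real (card ({..<i\<^sup>2} \<inter> {B. B < B0}))"
        by (simp add: sum.distrib sum.If_cases mult.commute)
      also have "card ({..<i\<^sup>2} \<inter> {B. B < B0}) \<le> card {..<B0}" by (rule card_mono) auto
      also have "card {..<B0} = B0" by simp
      also have "real B0 \<le> \<epsilon> * real (i\<^sup>2)"
      proof -
        have "real B0 / \<epsilon> \<le> real i" using i unfolding J_def by linarith
        also have "\<dots> \<le> real (i\<^sup>2)" using \<open>i \<ge> 1\<close> by (simp add: power2_eq_square)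
        finally show ?thesis using \<epsilon> by (simp add: field_simps)
      qed
      finally show "(\<Sum>k<P * i\<^sup>2. cmod (char_fun (\<eta> k * of_real (r ^ L k) * d k))) \<le> 2 * \<epsilon> * real (P * i\<^sup>2)"
        by (simp add: mult_left_mono mult_right_mono ac_simps)
    qed
    then show ?thesis by (simp add: mult.assoc)
  qed
  have "AE z in \<nu>. eventually (\<lambda>i. z \<in> space \<nu> - A i) sequentially"
  proof (rule borel_cantelli_AE1)
    have "{z. cmod (\<Sum>k<P * i\<^sup>2. cis (Re (\<eta> k * z))) \<ge> 2 * (2 * \<epsilon>) * real (P * i\<^sup>2)} \<in> sets borel" for i
      by measurable
    then show "A i \<in> sets \<nu>" for i by (simp add: A_def sets_nu)
    show "emeasure \<nu> (A i) < \<infinity>" for i by (simp add: emeasure_eq_measure)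
    have "summable (\<lambda>i. (K / ((2 * \<epsilon>)\<^sup>2 * real P)) * (1 / real i ^ 2))"
      by (intro summable_mult inverse_power_summable[of 2, unfolded inverse_eq_divide]) simp
    then show "summable (\<lambda>i. measure \<nu> (A i))"
      by (rule summable_comparison_test'[where N = 0]) (simp only: real_norm_def abs_of_nonneg[OF measure_nonneg] A_le)
  qed
  then show ?thesis
  proof eventually_elim
    case (elim z)
    have "eventually (\<lambda>i. cmod (\<Sum>k<P * i\<^sup>2. cis (Re (\<eta> k * z))) \<le> 4 * \<epsilon> * real (P * i\<^sup>2)) sequentially"
      using elim eventually_ge_at_top[of J] by eventually_elim (auto simp: A_def)
    from square_interpolation[OF _ P _ this] show ?case using \<epsilon> by simp
  qed
qed

text \<open>Dropping the first \<open>a\<close> terms does not affect the averages in the limit, so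
  each \<epsilon> may use its own shift and schedule; countably many \<epsilon> suffice.\<close>

lemma AE_character_average_tendsto_0:
  assumes \<kappa>: "\<kappa> > 1" and \<eta>: "\<And>k. cmod (\<eta> k) \<le> C * \<kappa> ^ k"
    and good: "\<And>\<epsilon>. \<epsilon> > 0 \<Longrightarrow> \<exists>a L. good_schedule \<kappa> (\<lambda>k. \<eta> (k + a)) \<epsilon> L"
  shows "AE z in \<nu>. (\<lambda>N. (\<Sum>k<N. cis (Re (\<eta> k * z))) / of_nat N) \<longlonglongrightarrow> 0"
proof -
  have ev: "AE z in \<nu>. eventually (\<lambda>N. cmod ((\<Sum>k<N. cis (Re (\<eta> k * z))) / of_nat N) < \<epsilon>) sequentially" if "\<epsilon> > 0" for \<epsilon>
  proof -
    obtain a L where aL: "good_schedule \<kappa> (\<lambda>k. \<eta> (k + a)) (\<epsilon> / 32) L" using good[of "\<epsilon> / 32"] \<open>\<epsilon> > 0\<close> by auto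
    have \<eta>': "cmod (\<eta> (k + a)) \<le> (C * \<kappa> ^ a) * \<kappa> ^ k" for k
      using \<eta>[of "k + a"] by (simp add: power_add ac_simps)
    have "AE z in \<nu>. eventually (\<lambda>N. cmod (\<Sum>k<N. cis (Re (\<eta> (k + a) * z))) \<le> 8 * (\<epsilon> / 32) * real N) sequentially"
      by (rule AE_eventually_character_average[OF \<kappa> \<eta>' _ aL]) (use \<open>\<epsilon> > 0\<close> in simp)
    then show ?thesis
    proof eventually_elim
      case (elim z)
      let ?f = "\<lambda>k. cis (Re (\<eta> k * z))"
      obtain N0 where N0: "\<And>N. N \<ge> N0 \<Longrightarrow> cmod (\<Sum>k<N. ?f (k + a)) \<le> \<epsilon> / 4 * real N"
        using elim unfolding eventually_sequentially by auto
      have "cmod ((\<Sum>k<N. ?f k) / of_nat N) < \<epsilon>" if N: "N \<ge> N0 + a + nat \<lceil>4 * real a / \<epsilon>\<rceil> + 1" for N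
      proof -
        obtain M where M: "N = a + M" "M \<ge> N0" using N by (metis add.commute add_leE le_add_diff_inverse nat_le_iff_add add_le_imp_le_diff add_le_cancel_left add.assoc)
        have "(\<Sum>k<N. ?f k) = (\<Sum>k<a. ?f k) + (\<Sum>k<M. ?f (k + a))"
          unfolding M(1) lessThan_atLeast0
          using sum.atLeastLessThan_concat[of 0 a "a + M" ?f] sum.shift_bounds_nat_ivl[of ?f 0 a M] by (simp add: add.commute)
        also have "cmod \<dots> \<le> (\<Sum>k<a. 1) + \<epsilon> / 4 * real M"
          by (intro norm_triangle_le add_mono sum_norm_le N0 M(2)) simp
        also have "\<dots> \<le> real a + \<epsilon> / 4 * real N" using \<open>\<epsilon> > 0\<close> M(1) by simp
        finally have "cmod (\<Sum>k<N. ?f k) \<le> real a + \<epsilon> / 4 * real N" .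
        moreover have "4 * real a / \<epsilon> \<le> real N" using N by linarith
        then have "real a \<le> \<epsilon> / 4 * real N" using \<open>\<epsilon> > 0\<close> by (simp add: field_simps)
        moreover have "N > 0" using N by simp
        ultimately have "cmod (\<Sum>k<N. ?f k) \<le> \<epsilon> / 2 * real N" by simp
        then have "cmod (\<Sum>k<N. ?f k) / real N \<le> \<epsilon> / 2" using \<open>N > 0\<close> by (simp add: divide_le_eq)
        then show ?thesis using \<open>\<epsilon> > 0\<close> unfolding norm_divide norm_of_nat by linarith
      qed
      then show ?case unfolding eventually_sequentially by blast
    qed
  qed
  have "AE z in \<nu>. \<forall>s. eventually (\<lambda>N. cmod ((\<Sum>k<N. cis (Re (\<eta> k * z))) / of_nat N) < 1 / real (Suc s)) sequentially"
    unfolding AE_all_countable by (intro allI ev) simp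
  then show ?thesis
  proof eventually_elim
    case (elim z)
    show ?case
    proof (rule tendstoI)
      fix e :: real assume "e > 0"
      then obtain s where "1 / real (Suc s) < e" using nat_approx_posE by blast
      then show "\<forall>\<^sub>F N in sequentially. dist ((\<Sum>k<N. cis (Re (\<eta> k * z))) / of_nat N) 0 < e"
        using elim[rule_format, of s] by (auto elim!: eventually_mono)
    qed
  qed
qed

section \<open>Points and lines are null sets\<close>

text \<open>The positions of maximal mass form a finite set that is preserved by the expanding maps
  \<open>\<psi> v k\<close>; hence there is at most one of them for each \<open>v\<close>, and the self-similarity
  forces the whole measure onto it.\<close>

lemma concentration:
  fixes f :: "'v \<Rightarrow> complex \<Rightarrow> 'e::{real_normed_vector, second_countable_topology}"
  assumes V: "finite V" "\<And>v k. v \<in> V \<Longrightarrow> k < l \<Longrightarrow> act v k \<in> V"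
    and f[measurable]: "\<And>v. f v \<in> borel_measurable borel"
    and f_bounded: "\<And>v. v \<in> V \<Longrightarrow> AE z in \<nu>. norm (f v z) \<le> R"
    and conj: "\<And>v k z s. v \<in> V \<Longrightarrow> k < l \<Longrightarrow> norm (f v (\<phi> k z) - s) = r * norm (f (act v k) z - \<psi> v k s)"
    and expand: "\<And>v k s s'. v \<in> V \<Longrightarrow> k < l \<Longrightarrow> norm (\<psi> v k s - \<psi> v k s') = norm (s - s') / r"
    and v0: "v0 \<in> V" "measure \<nu> {z. f v0 z = s0} > 0"
  obtains v s where "v \<in> V" "AE z in \<nu>. f v z = s"
proof -
  have "l > 0" using p_sum by (cases l) auto
  define mass where "mass v s = measure \<nu> {z. f v z = s}" for v s
  have ms[measurable]: "{z. f v z = s} \<in> sets borel" for v s by measurable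
  have mass_eq: "mass v s = (\<Sum>k<l. p k * mass (act v k) (\<psi> v k s))" if "v \<in> V" for v s
  proof -
    have "(\<lambda>z. of_real r * c k * z + \<tau> k) -` {z. f v z = s} = {z. f (act v k) z = \<psi> v k s}" if "k < l" for k
    proof -
      have "f v (\<phi> k z) = s \<longleftrightarrow> f (act v k) z = \<psi> v k s" for z
        using conj[OF \<open>v \<in> V\<close> that, of z s] r by (metis eq_iff_diff_eq_0 mult_eq_0_iff norm_eq_zero order_less_irrefl)
      then show ?thesis by (auto simp: \<phi>_def)
    qed
    then show ?thesis unfolding mass_def using self_sim[OF ms[of v s]] by simp
  qed
  have fin: "finite {s. mass v s \<ge> e}" if "e > 0" for v e
  proof (rule finite_if_finite_subsets_card_bdd[of _ "nat \<lceil>1 / e\<rceil>", THEN conjunct1])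
    fix G assume G: "G \<subseteq> {s. mass v s \<ge> e}" "finite G"
    have "real (card G) * e = (\<Sum>s\<in>G. e)" by simp
    also have "\<dots> \<le> (\<Sum>s\<in>G. mass v s)" using G by (intro sum_mono) auto
    also have "\<dots> = measure \<nu> (\<Union>s\<in>G. {z. f v z = s})"
      unfolding mass_def using G ms sets_nu
      by (intro finite_measure_finite_Union[symmetric]) (auto simp: disjoint_family_on_def)
    also have "\<dots> \<le> 1" by (rule prob_le_1)
    finally have "real (card G) \<le> 1 / e" using that by (simp add: field_simps)
    then show "card G \<le> nat \<lceil>1 / e\<rceil>" by linarith
  qed
  \<comment> \<open>Only finitely many positions are at least as heavy as the given one, so the
    maximal mass is attained and positive.\<close>
  define F0 where "F0 = (SIGMA v:V. {s. mass v s \<ge> mass v0 s0})"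
  have F0: "finite F0" "(v0, s0) \<in> F0"
  proof -
    have "mass v0 s0 > 0" using v0 by (simp add: mass_def)
    then show "finite F0" unfolding F0_def using V(1) by (intro finite_SigmaI fin) auto
    show "(v0, s0) \<in> F0" using v0 by (simp add: F0_def)
  qed
  define m where "m = Max ((\<lambda>(v, s). mass v s) ` F0)"
  have m_in: "m \<in> (\<lambda>(v, s). mass v s) ` F0"
    unfolding m_def using F0 by (intro Max_in) auto
  have m_ge0: "m \<ge> mass v0 s0" "m > 0"
  proof -
    show "m \<ge> mass v0 s0" unfolding m_def using F0 by (intro Max_ge) force+
    then show "m > 0" using v0 by (simp add: mass_def)
  qed
  have m_max: "mass v s \<le> m" if "v \<in> V" for v s
  proof (cases "mass v s \<ge> mass v0 s0")
    case True
    then have "(v, s) \<in> F0" using that by (simp add: F0_def)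
    then show ?thesis unfolding m_def using F0(1) by (intro Max_ge) force+
  qed (use m_ge0 in simp)
  define F where "F = {(v, s). v \<in> V \<and> mass v s = m}"
  have "F \<subseteq> F0" using m_ge0 by (auto simp: F_def F0_def)
  then have finF: "finite F" using F0 finite_subset by blast
  have "F \<noteq> {}" using m_in by (auto simp: F_def F0_def)
  \<comment> \<open>A mass is the mean of the masses at the image positions with positive weights;
    if it is maximal, so are all of them.\<close>
  have F_step: "(act v k, \<psi> v k s) \<in> F" if "(v, s) \<in> F" "k < l" for v s k
  proof (rule ccontr)
    assume n: "(act v k, \<psi> v k s) \<notin> F"
    have v: "v \<in> V" "mass v s = m" using that by (auto simp: F_def)
    have less: "mass (act v k) (\<psi> v k s) < m"
      using n m_max[OF V(2)[OF v(1) that(2)], of "\<psi> v k s"] V(2)[OF v(1) that(2)] by (auto simp: F_def)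
    have "(\<Sum>k<l. p k * mass (act v k) (\<psi> v k s)) < (\<Sum>k<l. p k * m)"
    proof (rule sum_strict_mono_ex1)
      show "\<forall>k\<in>{..<l}. p k * mass (act v k) (\<psi> v k s) \<le> p k * m"
        using V(2)[OF v(1)] by (intro ballI mult_left_mono m_max p_nonneg) auto
      show "\<exists>k\<in>{..<l}. p k * mass (act v k) (\<psi> v k s) < p k * m"
        using that p_pos less by (intro bexI[of _ k]) auto
    qed simp
    also have "\<dots> = m" using p_sum by (simp flip: sum_distrib_right)
    finally show False using mass_eq[OF v(1), of s] v(2) by simp
  qed
  \<comment> \<open>Otherwise take the largest distance between two positions with the same index:
    the maps \<psi> expand it by 1 / r but keep the pair in the finite set \<open>F\<close>.\<close>
  have F_unique: "s = s'" if "(v, s) \<in> F" "(v, s') \<in> F" for v s s'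
  proof (rule ccontr)
    assume "s \<noteq> s'"
    define W where "W = {norm (s - s') | v s s'. (v, s) \<in> F \<and> (v, s') \<in> F}"
    have "W \<subseteq> (\<lambda>(x, y). norm (snd x - snd y)) ` (F \<times> F)" unfolding W_def by force
    then have "finite W" using finF by (meson finite_SigmaI finite_imageI finite_subset)
    moreover have "norm (s - s') \<in> W" using that unfolding W_def by blast
    ultimately have W: "Max W \<in> W" "Max W \<ge> norm (s - s')" "\<And>x. x \<in> W \<Longrightarrow> x \<le> Max W"
      by (auto intro!: Max_in)
    then obtain v1 s1 s1' where 1: "(v1, s1) \<in> F" "(v1, s1') \<in> F" "Max W = norm (s1 - s1')"
      unfolding W_def by blast
    have "norm (\<psi> v1 0 s1 - \<psi> v1 0 s1') \<in> W"
      unfolding W_def using F_step[OF 1(1) \<open>l > 0\<close>] F_step[OF 1(2) \<open>l > 0\<close>] by blast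
    then have "norm (\<psi> v1 0 s1 - \<psi> v1 0 s1') \<le> Max W" by (rule W)
    moreover have "norm (\<psi> v1 0 s1 - \<psi> v1 0 s1') = Max W / r"
      using expand[of v1 0 s1 s1'] 1 \<open>l > 0\<close> by (auto simp: F_def)
    moreover have "Max W > 0" using W(2) \<open>s \<noteq> s'\<close> by (meson less_le_trans zero_less_norm_iff right_minus_eq)
    then have "Max W / r > Max W" using r by (simp add: field_simps)
    ultimately show False by simp
  qed
  obtain v s where vs: "(v, s) \<in> F" using \<open>F \<noteq> {}\<close> by auto
  define B where "B = R + Max ((\<lambda>(v, s). norm s) ` F) + 1"
  have B: "AE z in \<nu>. norm (f v z - s) \<le> B" if "(v, s) \<in> F" for v s
  proof -
    have "norm s \<le> Max ((\<lambda>(v, s). norm s) ` F)" using that finF by (intro Max_ge) force+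
    moreover have "v \<in> V" using that by (simp add: F_def)
    from f_bounded[OF this] have "AE z in \<nu>. norm (f v z) \<le> R" .
    ultimately show ?thesis
      by (auto elim!: eventually_mono simp: B_def intro!: order_trans[OF norm_triangle_ineq4])
  qed
  \<comment> \<open>Pulled back n times, the radius grows to t / r^n while the centre stays in
    \<open>F\<close>; beyond \<open>B\<close> nothing is left.\<close>
  have tail: "measure \<nu> {z. norm (f v z - s) > t} = 0" if "(v, s) \<in> F" "t / r ^ n \<ge> B" for n t v s
    using that
  proof (induction n arbitrary: v s t)
    case 0
    have "AE z in \<nu>. \<not> norm (f v z - s) > t" using B[OF 0(1)] by (rule eventually_mono) (use 0 in auto)
    then have "AE z in \<nu>. z \<notin> {z. norm (f v z - s) > t}" by simp
    moreover have "{z. norm (f v z - s) > t} \<in> sets \<nu>" unfolding sets_nu by measurable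
    ultimately show ?case by (simp add: measure_eq_0_null_sets AE_iff_null_sets)
  next
    case (Suc n)
    have v: "v \<in> V" using Suc.prems by (simp add: F_def)
    have "{z. norm (f v z - s) > t} \<in> sets borel" by measurable
    then have "measure \<nu> {z. norm (f v z - s) > t} = (\<Sum>k<l. p k * measure \<nu> ((\<lambda>z. of_real r * c k * z + \<tau> k) -` {z. norm (f v z - s) > t}))"
      by (rule self_sim)
    also have "\<dots> = 0"
    proof (rule sum.neutral, rule ballI)
      fix k assume "k \<in> {..<l}"
      then have k: "k < l" by simp
      have "(\<lambda>z. of_real r * c k * z + \<tau> k) -` {z. norm (f v z - s) > t} = {z. norm (f (act v k) z - \<psi> v k s) > t / r}"
        using conj[OF v k] r unfolding \<phi>_def by (auto simp: field_simps)
      moreover have "measure \<nu> {z. norm (f (act v k) z - \<psi> v k s) > t / r} = 0"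
        using Suc.prems by (intro Suc.IH F_step k) auto
      ultimately show "p k * measure \<nu> ((\<lambda>z. of_real r * c k * z + \<tau> k) -` {z. norm (f v z - s) > t}) = 0" by simp
    qed
    finally show ?case .
  qed
  have "AE z in \<nu>. norm (f v z - s) \<le> 1 / real (Suc i)" for i
  proof -
    obtain n where "B * real (Suc i) < (1 / r) ^ n"
      using real_arch_pow[of "1 / r"] r by auto
    then have "B \<le> (1 / r) ^ n / real (Suc i)" by (simp only: pos_le_divide_eq of_nat_0_less_iff zero_less_Suc less_imp_le)
    also have "\<dots> = 1 / real (Suc i) / r ^ n" by (simp add: power_divide)
    finally have "1 / real (Suc i) / r ^ n \<ge> B" .
    then have "measure \<nu> {z. norm (f v z - s) > 1 / real (Suc i)} = 0"
      by (rule tail[OF vs])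
    moreover have "{z. norm (f v z - s) > 1 / real (Suc i)} \<in> sets \<nu>" unfolding sets_nu by measurable
    ultimately have "{z. norm (f v z - s) > 1 / real (Suc i)} \<in> null_sets \<nu>"
      by (auto simp: null_sets_def emeasure_eq_measure)
    from AE_not_in[OF this] show ?thesis by eventually_elim auto
  qed
  then have "AE z in \<nu>. \<forall>i. norm (f v z - s) \<le> 1 / real (Suc i)" by (simp add: AE_all_countable)
  then have "AE z in \<nu>. f v z = s"
  proof eventually_elim
    case (elim z)
    show ?case
    proof (rule ccontr)
      assume "f v z \<noteq> s"
      then have "norm (f v z - s) > 0" by simp
      then obtain i where "1 / real (Suc i) < norm (f v z - s)" using nat_approx_posE by blast
      then show False using elim by (meson not_le)
    qed
  qed
  moreover have "v \<in> V" using vs by (simp add: F_def)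
  ultimately show ?thesis using that by blast
qed

text \<open>With a one-element index set, \<open>concentration\<close> turns an atom into a point
  mass, and a point mass lies on a line.\<close>

lemma no_atoms:
  assumes u0: "\<And>s. \<not> (AE z in \<nu>. Re (u0 * z) = s)"
  shows "measure \<nu> {a} = 0"
proof (rule ccontr)
  assume "measure \<nu> {a} \<noteq> 0"
  then have pos: "measure \<nu> {z. z = a} > 0" by (simp add: zero_less_measure_iff)
  obtain v :: unit and s where "AE z in \<nu>. z = s"
  proof (rule concentration[of "{()}" "\<lambda>v k. ()" "\<lambda>v z. z" 2 "\<lambda>v k s. (s - \<tau> k) / (of_real r * c k)" "()" a])
    fix k z s assume k: "k < l"
    have ck: "cmod (c k) = 1" "c k \<noteq> 0" using norm_c[OF k] by auto
    have "\<phi> k z - s = of_real r * c k * (z - (s - \<tau> k) / (of_real r * c k))"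
      using ck r by (simp add: \<phi>_def field_simps)
    then show "norm (\<phi> k z - s) = r * norm (z - (s - \<tau> k) / (of_real r * c k))"
      using ck r by (simp add: norm_mult)
  next
    fix k s s' assume k: "k < l"
    have ck: "cmod (c k) = 1" "c k \<noteq> 0" using norm_c[OF k] by auto
    have "(s - \<tau> k) / (of_real r * c k) - (s' - \<tau> k) / (of_real r * c k) = (s - s') / (of_real r * c k)"
      by (simp flip: diff_divide_distrib)
    then show "norm ((s - \<tau> k) / (of_real r * c k) - (s' - \<tau> k) / (of_real r * c k)) = norm (s - s') / r"
      using ck r by (simp add: norm_divide norm_mult)
  qed (use bounded pos in auto)
  then have "AE z in \<nu>. Re (u0 * z) = Re (u0 * s)" by eventually_elim simp
  with u0 show False by blast
qed

text \<open>Pulling a line back turns its direction by some \<open>c k\<close>, and only finitely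
  many directions occur, so a charged line would carry the whole measure. If all \<open>c k\<close>
  are real, that line has direction \<open>u0\<close> up to sign. Otherwise some pull-back is a
  transverse line, which leaves one point. Both contradict the hypothesis on
  \<open>u0\<close>.\<close>

lemma no_lines:
  assumes u0: "\<And>s. \<not> (AE z in \<nu>. Re (u0 * z) = s)" "cmod u0 = 1"
    and J: "J > 0" "\<And>k. k < l \<Longrightarrow> c k ^ J = 1" and w: "w \<in> words n"
  shows "measure \<nu> {z. Re (u0 * rot w * z) = s} = 0"
proof (rule ccontr)
  assume "measure \<nu> {z. Re (u0 * rot w * z) = s} \<noteq> 0"
  then have pos: "measure \<nu> {z. Re (u0 * rot w * z) = s} > 0" by (simp add: zero_less_measure_iff)
  define V where "V = (\<lambda>w. u0 * rot w) ` {w. set w \<subseteq> {..<l}}"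
  have rotJ: "rot w ^ J = 1" if "set w \<subseteq> {..<l}" for w
    using that by (induction w) (auto simp: rot_def power_mult_distrib J)
  have "V \<subseteq> (\<lambda>d. u0 * d) ` {d. d ^ J = 1}" unfolding V_def using rotJ by auto
  moreover have "finite {d :: complex. d ^ J = 1}" using J by (intro finite_roots_unity) simp
  ultimately have finV: "finite V" by (meson finite_imageI finite_subset)
  have actV: "v * c k \<in> V" if v: "v \<in> V" and k: "k < l" for v k
  proof -
    obtain w where "v = u0 * rot w" "set w \<subseteq> {..<l}" using v by (auto simp: V_def)
    then have "v * c k = u0 * rot (w @ [k])" "set (w @ [k]) \<subseteq> {..<l}" using k by (auto simp: rot_def)
    then show ?thesis unfolding V_def by blast
  qed
  have nV: "cmod v = 1" if "v \<in> V" for v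
    using that u0(2) norm_rot by (auto simp: V_def norm_mult words_def)
  have sim: "Re (v * \<phi> k z) - s = r * (Re (v * c k * z) - (s - Re (v * \<tau> k)) / r)" for v k z s
  proof -
    have "Re (v * \<phi> k z) = r * Re (v * c k * z) + Re (v * \<tau> k)" by (simp add: \<phi>_def algebra_simps)
    then show ?thesis using r by (simp add: field_simps del: times_complex.sel)
  qed
  obtain v s where v: "v \<in> V" and line: "AE z in \<nu>. Re (v * z) = s"
  proof (rule concentration[of V "\<lambda>v k. v * c k" "\<lambda>v z. Re (v * z)" 2 "\<lambda>v k s. (s - Re (v * \<tau> k)) / r" "u0 * rot w" s])
    show "AE z in \<nu>. norm (Re (v * z)) \<le> 2" if "v \<in> V" for v
      using bounded
    proof eventually_elim
      case (elim z)
      have "\<bar>Re (v * z)\<bar> \<le> cmod v * cmod z" using abs_Re_le_cmod norm_mult by metis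
      then show ?case using elim nV[OF that] by simp
    qed
    show "norm (Re (v * \<phi> k z) - s) = r * norm (Re (v * c k * z) - (s - Re (v * \<tau> k)) / r)" for v k z s
      unfolding sim norm_mult using r by simp
    show "norm ((s - Re (v * \<tau> k)) / r - (s' - Re (v * \<tau> k)) / r) = norm (s - s') / r" for v k s s'
      using r by (simp flip: diff_divide_distrib)
    show "u0 * rot w \<in> V" using w by (auto simp: V_def words_def)
  qed (use finV actV pos in \<open>auto simp del: times_complex.sel\<close>)
  \<comment> \<open>All weights are positive, so a null set has null preimages under every
    map.\<close>
  have line': "AE z in \<nu>. Re (v * c k * z) = (s - Re (v * \<tau> k)) / r" if k: "k < l" for k
  proof -
    define A where "A = {z. Re (v * z) \<noteq> s}"
    have A: "A \<in> sets borel" unfolding A_def by measurable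
    have "AE z in \<nu>. z \<notin> A" using line by (simp add: A_def)
    then have "measure \<nu> A = 0" using A by (simp add: measure_eq_0_null_sets AE_iff_null_sets sets_nu)
    then have "(\<Sum>k<l. p k * measure \<nu> (\<phi> k -` A)) = 0"
      using self_sim[OF A] by (simp add: \<phi>_def[abs_def])
    then have "p k * measure \<nu> (\<phi> k -` A) = 0"
      using k by (subst (asm) sum_nonneg_eq_0_iff) (auto intro: mult_nonneg_nonneg p_nonneg)
    then have "measure \<nu> (\<phi> k -` A) = 0" using p_pos[OF k] by simp
    moreover have "\<phi> k -` A \<in> sets \<nu>"
      using measurable_sets[OF measurable_phi A, of k] by (simp add: sets_nu)
    ultimately have "\<phi> k -` A \<in> null_sets \<nu>" by (auto simp: null_sets_def emeasure_eq_measure)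
    from AE_not_in[OF this] show ?thesis
    proof eventually_elim
      case (elim z)
      then have "Re (v * \<phi> k z) = s" by (simp add: A_def)
      then show ?case using sim[of v k z s] r by simp
    qed
  qed
  show False
  proof (cases "\<forall>k<l. Im (c k) = 0")
    case True
    have ck: "c k = 1 \<or> c k = -1" if "k < l" for k
    proof -
      have "\<bar>Re (c k)\<bar> = 1" using True that norm_c[OF that] by (simp add: cmod_eq_Re)
      then show ?thesis using True that by (auto simp: complex_eq_iff abs_if split: if_splits)
    qed
    have "rot w = 1 \<or> rot w = -1" if "set w \<subseteq> {..<l}" for w
      using that
    proof (induction w)
      case (Cons k w)
      then show ?case using ck[of k] by (auto simp: rot_def)
    qed (simp add: rot_def)
    then have "v = u0 \<or> v = - u0" using v unfolding V_def by fastforce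
    then have "AE z in \<nu>. Re (u0 * z) = (if v = u0 then s else - s)"
      using line by (auto elim!: eventually_mono simp del: times_complex.sel)
    then show False using u0(1) by blast
  next
    case False
    then obtain k where k: "k < l" "Im (c k) \<noteq> 0" by blast
    define a where "a = Complex s ((Re (c k) * s - (s - Re (v * \<tau> k)) / r) / Im (c k)) / v"
    have "v \<noteq> 0" using nV[OF v] by auto
    have "AE z in \<nu>. z = a"
      using line line'[OF k(1)]
    proof eventually_elim
      case (elim z)
      have "Re (v * c k * z) = Re (c k) * Re (v * z) - Im (c k) * Im (v * z)"
        by (simp add: algebra_simps)
      then have "Im (v * z) = (Re (c k) * s - (s - Re (v * \<tau> k)) / r) / Im (c k)"
        using elim k(2) by (simp add: field_simps del: times_complex.sel)
      then have "v * z = Complex s ((Re (c k) * s - (s - Re (v * \<tau> k)) / r) / Im (c k))"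
        using elim(1) by (simp add: complex_eq_iff del: times_complex.sel)
      then show ?case using \<open>v \<noteq> 0\<close> by (simp add: a_def eq_divide_eq mult.commute)
    qed
    then have "AE z in \<nu>. Re (u0 * z) = Re (u0 * a)" by eventually_elim simp
    then show False using u0(1) by blast
  qed
qed

section \<open>Averages of the characteristic function along arcs\<close>

text \<open>The near-diagonal sets decrease to the set of differences invisible to the arc, which is
  null by Fubini and \<open>zero\<close>.\<close>

lemma near_diagonal:
  assumes zero: "\<And>a. measure \<nu> {z. arc_size u (v * (a - z)) = 0} = 0" and "\<epsilon> > 0"
  obtains d where "d > 0" "measure (\<nu> \<Otimes>\<^sub>M \<nu>) {p. arc_size u (v * (fst p - snd p)) < d} \<le> \<epsilon>"
proof -
  interpret P: pair_prob_space \<nu> \<nu> ..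
  have sp: "space (\<nu> \<Otimes>\<^sub>M \<nu>) = UNIV" by (simp add: space_pair_measure)
  have m[measurable]: "(\<lambda>p. arc_size u (v * (fst p - snd p))) \<in> borel_measurable (\<nu> \<Otimes>\<^sub>M \<nu>)"
    unfolding arc_size_def by measurable
  define A where "A n = {p. arc_size u (v * (fst p - snd p)) < 1 / real (Suc n)}" for n
  have A[measurable]: "A n \<in> sets (\<nu> \<Otimes>\<^sub>M \<nu>)" for n
  proof -
    have "A n = {p \<in> space (\<nu> \<Otimes>\<^sub>M \<nu>). arc_size u (v * (fst p - snd p)) < 1 / real (Suc n)}"
      by (simp add: A_def sp)
    also have "\<dots> \<in> sets (\<nu> \<Otimes>\<^sub>M \<nu>)" by measurable
    finally show ?thesis .
  qed
  define D where "D = {p. arc_size u (v * (fst p - snd p)) = 0}"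
  have D: "D \<in> sets (\<nu> \<Otimes>\<^sub>M \<nu>)"
  proof -
    have "D = {p \<in> space (\<nu> \<Otimes>\<^sub>M \<nu>). arc_size u (v * (fst p - snd p)) = 0}"
      by (simp add: D_def sp)
    also have "\<dots> \<in> sets (\<nu> \<Otimes>\<^sub>M \<nu>)" by measurable
    finally show ?thesis .
  qed
  have "emeasure (\<nu> \<Otimes>\<^sub>M \<nu>) D = (\<integral>\<^sup>+a. emeasure \<nu> (Pair a -` D) \<partial>\<nu>)"
    by (rule emeasure_pair_measure_alt[OF D])
  also have "\<dots> = (\<integral>\<^sup>+a. 0 \<partial>\<nu>)"
    using zero by (simp add: D_def vimage_def emeasure_eq_measure)
  finally have D0: "measure (\<nu> \<Otimes>\<^sub>M \<nu>) D = 0" by (simp add: measure_def)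
  have "(\<lambda>n. measure (\<nu> \<Otimes>\<^sub>M \<nu>) (A n)) \<longlonglongrightarrow> measure (\<nu> \<Otimes>\<^sub>M \<nu>) (\<Inter>n. A n)"
  proof (rule P.finite_Lim_measure_decseq)
    show "decseq A"
      unfolding decseq_def A_def by (auto intro: less_le_trans simp: frac_le)
  qed auto
  also have "(\<Inter>n. A n) = D"
  proof safe
    fix x y assume *: "(x, y) \<in> (\<Inter>n. A n)"
    have "arc_size u (v * (x - y)) = 0"
    proof (rule ccontr)
      assume "arc_size u (v * (x - y)) \<noteq> 0"
      then have "arc_size u (v * (x - y)) > 0" using arc_size_nonneg[of u "v * (x - y)"] by linarith
      then obtain n where "1 / real (Suc n) < arc_size u (v * (x - y))" using nat_approx_posE by blast
      moreover have "(x, y) \<in> A n" using * by blast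
      ultimately show False by (simp add: A_def)
    qed
    then show "(x, y) \<in> D" by (simp add: D_def)
  qed (auto simp: A_def D_def)
  finally have "eventually (\<lambda>n. measure (\<nu> \<Otimes>\<^sub>M \<nu>) (A n) < \<epsilon>) sequentially"
    unfolding D0 using \<open>\<epsilon> > 0\<close> by (rule order_tendstoD)
  then obtain n where "measure (\<nu> \<Otimes>\<^sub>M \<nu>) (A n) < \<epsilon>"
    by (meson eventually_happens trivial_limit_sequentially)
  then show ?thesis by (intro that[of "1 / real (Suc n)"]) (auto simp: A_def)
qed

text \<open>Turns an average over frequencies into oscillatory sums with a fixed difference of two
  independent points.\<close>

lemma norm_char_fun_square:
  "complex_of_real ((cmod (char_fun \<xi>))\<^sup>2) = (\<integral>p. cis (Re (\<xi> * (fst p - snd p))) \<partial>(\<nu> \<Otimes>\<^sub>M \<nu>))"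
  and integrable_pair_character: "integrable (\<nu> \<Otimes>\<^sub>M \<nu>) (\<lambda>p. cis (Re (\<xi> * (fst p - snd p))))"
proof -
  interpret P: pair_prob_space \<nu> \<nu> ..
  show int: "integrable (\<nu> \<Otimes>\<^sub>M \<nu>) (\<lambda>p. cis (Re (\<xi> * (fst p - snd p))))"
    by (rule P.integrable_const_bound[of _ 1]) (simp, measurable)
  have eq: "cis (Re (\<xi> * (x - y))) = cis (Re (\<xi> * x)) * cnj (cis (Re (\<xi> * y)))" for x y
    by (simp add: cis_cnj cis_mult algebra_simps)
  have "(\<integral>p. cis (Re (\<xi> * (fst p - snd p))) \<partial>(\<nu> \<Otimes>\<^sub>M \<nu>)) = (\<integral>x. \<integral>y. cis (Re (\<xi> * (x - y))) \<partial>\<nu> \<partial>\<nu>)"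
    using P.integral_fst'[OF int] by simp
  also have "\<dots> = (\<integral>x. cis (Re (\<xi> * x)) * cnj (char_fun \<xi>) \<partial>\<nu>)"
    unfolding eq char_fun_def Bochner_Integration.integral_cnj[symmetric] by (simp only: integral_mult_right_zero)
  also have "\<dots> = char_fun \<xi> * cnj (char_fun \<xi>)" by (simp only: integral_mult_left_zero char_fun_def)
  finally show "complex_of_real ((cmod (char_fun \<xi>))\<^sup>2) = (\<integral>p. cis (Re (\<xi> * (fst p - snd p))) \<partial>(\<nu> \<Otimes>\<^sub>M \<nu>))"
    by (simp only: complex_norm_square)
qed

definition arc_bound :: "complex \<Rightarrow> complex set \<Rightarrow> real \<Rightarrow> real \<Rightarrow> real \<Rightarrow> nat \<Rightarrow> real \<Rightarrow> bool" where
  "arc_bound u V \<epsilon> R R' M0 \<epsilon>' \<longleftrightarrow> (\<forall>M\<ge>M0. \<forall>\<gamma>. cmod (\<gamma> - u / of_nat M) \<le> \<epsilon>' / real M \<longrightarrow>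
     (\<forall>v\<in>V. \<forall>s. R \<le> s \<and> s \<le> R' \<longrightarrow>
        (\<Sum>i<M. cmod (char_fun (of_real s * v * exp (of_nat i * \<gamma>)))) \<le> \<epsilon> * real M))"

lemma arc_boundD:
  "arc_bound u V \<epsilon> R R' M0 \<epsilon>' \<Longrightarrow> M \<ge> M0 \<Longrightarrow> cmod (\<gamma> - u / of_nat M) \<le> \<epsilon>' / real M \<Longrightarrow> v \<in> V \<Longrightarrow> R \<le> s \<Longrightarrow> s \<le> R' \<Longrightarrow>
     (\<Sum>i<M. cmod (char_fun (of_real s * v * exp (of_nat i * \<gamma>)))) \<le> \<epsilon> * real M"
  unfolding arc_bound_def by blast

text \<open>The threshold \<open>R0\<close> precedes \<open>R'\<close>, while \<open>M0\<close> and
  \<open>\<epsilon>'\<close> may depend on it. Uniformity in M and \<gamma> leaves room for steps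
  that only approximate u / M.\<close>

definition small_arc_averages :: "complex \<Rightarrow> complex set \<Rightarrow> real \<Rightarrow> bool" where
  "small_arc_averages u V \<epsilon> \<longleftrightarrow> (\<exists>R0>0. \<forall>R\<ge>R0. \<forall>R'. \<exists>M0>0. \<exists>\<epsilon>'>0. arc_bound u V \<epsilon> R R' M0 \<epsilon>')"

text \<open>Pairs with difference of arc size below \<open>d\<close> are rare by
  \<open>diag\<close>, all others oscillate by \<open>oscillatory_sum_decay\<close>; Cauchy-Schwarz
  returns from squares to first powers.\<close>

lemma small_arc_averages:
  assumes u: "u \<noteq> 0" and \<epsilon>: "\<epsilon> > 0" and V: "\<And>v. v \<in> V \<Longrightarrow> cmod v = 1"
    and diag: "\<And>\<epsilon>. \<epsilon> > 0 \<Longrightarrow> \<exists>d>0. \<forall>v\<in>V. measure (\<nu> \<Otimes>\<^sub>M \<nu>) {p. arc_size u (v * (fst p - snd p)) < d} \<le> \<epsilon>"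
  shows "small_arc_averages u V \<epsilon>"
proof -
  interpret P: pair_prob_space \<nu> \<nu> ..
  have sp: "space (\<nu> \<Otimes>\<^sub>M \<nu>) = UNIV" by (simp add: space_pair_measure)
  \<comment> \<open>Half of \<epsilon>^2 for the rare pairs, half for the oscillating ones.\<close>
  define \<delta> where "\<delta> = \<epsilon>\<^sup>2 / 2"
  have "\<delta> > 0" using \<epsilon> by (simp add: \<delta>_def)
  obtain \<rho> where \<rho>: "\<rho> > 0"
    "\<And>\<rho>'. \<exists>M0 \<epsilon>'. M0 > 0 \<and> \<epsilon>' > 0 \<and> (\<forall>M \<gamma> z. M \<ge> M0 \<and> cmod (\<gamma> - u / of_nat M) \<le> \<epsilon>' / real M \<and> \<rho> \<le> arc_size u z \<and> cmod z \<le> \<rho>' \<longrightarrow>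
       cmod (\<Sum>i<M. cis (Re (z * exp (of_nat i * \<gamma>)))) \<le> \<delta> * real M)"
    using oscillatory_sum_decay[OF u \<open>\<delta> > 0\<close>] by blast
  obtain d where d: "d > 0" "\<And>v. v \<in> V \<Longrightarrow> measure (\<nu> \<Otimes>\<^sub>M \<nu>) {p. arc_size u (v * (fst p - snd p)) < d} \<le> \<delta>"
    using diag[OF \<open>\<delta> > 0\<close>] by blast
  show ?thesis
    unfolding small_arc_averages_def
  proof (intro exI[of _ "\<rho> / d"] conjI allI impI)
    show "\<rho> / d > 0" using \<rho> d by simp
    fix R R' :: real assume R: "\<rho> / d \<le> R"
    obtain M0 \<epsilon>' where M0: "M0 > 0" "\<epsilon>' > 0" and osc:
      "\<And>M \<gamma> z. M \<ge> M0 \<Longrightarrow> cmod (\<gamma> - u / of_nat M) \<le> \<epsilon>' / real M \<Longrightarrow> \<rho> \<le> arc_size u z \<Longrightarrow> cmod z \<le> 4 * R' \<Longrightarrow>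
       cmod (\<Sum>i<M. cis (Re (z * exp (of_nat i * \<gamma>)))) \<le> \<delta> * real M"
      using \<rho>(2)[of "4 * R'"] by blast
    have "(\<Sum>i<M. cmod (char_fun (of_real s * v * exp (of_nat i * \<gamma>)))) \<le> \<epsilon> * real M"
      if M: "M \<ge> M0" and \<gamma>: "cmod (\<gamma> - u / of_nat M) \<le> \<epsilon>' / real M" and v: "v \<in> V" and s: "R \<le> s" "s \<le> R'"
      for M \<gamma> v s
    proof -
      have "s > 0" using R s \<rho> d by (meson divide_pos_pos less_le_trans)
      define E where "E = {p. arc_size u (v * (fst p - snd p)) < d}"
      have m[measurable]: "(\<lambda>p. arc_size u (v * (fst p - snd p))) \<in> borel_measurable (\<nu> \<Otimes>\<^sub>M \<nu>)"
        unfolding arc_size_def by measurable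
      have E[measurable]: "E \<in> sets (\<nu> \<Otimes>\<^sub>M \<nu>)"
      proof -
        have "E = {p \<in> space (\<nu> \<Otimes>\<^sub>M \<nu>). arc_size u (v * (fst p - snd p)) < d}" by (simp add: E_def sp)
        also have "\<dots> \<in> sets (\<nu> \<Otimes>\<^sub>M \<nu>)" by measurable
        finally show ?thesis .
      qed
      define X where "X p = (\<Sum>i<M. cis (Re (of_real s * v * exp (of_nat i * \<gamma>) * (fst p - snd p))))" for p
      define a where "a i = cmod (char_fun (of_real s * v * exp (of_nat i * \<gamma>)))" for i
      have "complex_of_real (\<Sum>i<M. (a i)\<^sup>2) = (\<integral>p. X p \<partial>(\<nu> \<Otimes>\<^sub>M \<nu>))"
        unfolding a_def X_def of_real_sum norm_char_fun_square
        by (rule Bochner_Integration.integral_sum[symmetric]) (rule integrable_pair_character)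
      then have "(\<Sum>i<M. (a i)\<^sup>2) \<le> cmod (\<integral>p. X p \<partial>(\<nu> \<Otimes>\<^sub>M \<nu>))"
        by (metis abs_ge_self norm_of_real)
      also have "\<dots> \<le> (\<integral>p. cmod (X p) \<partial>(\<nu> \<Otimes>\<^sub>M \<nu>))" by (rule integral_norm_bound)
      also have "\<dots> \<le> (\<integral>p. indicator E p * real M + \<delta> * real M \<partial>(\<nu> \<Otimes>\<^sub>M \<nu>))"
      proof (rule integral_mono_AE)
        have iX: "integrable (\<nu> \<Otimes>\<^sub>M \<nu>) X"
          unfolding X_def by (intro Bochner_Integration.integrable_sum integrable_pair_character)
        then show "integrable (\<nu> \<Otimes>\<^sub>M \<nu>) (\<lambda>p. cmod (X p))" by simp
        show "integrable (\<nu> \<Otimes>\<^sub>M \<nu>) (\<lambda>p. indicator E p * real M + \<delta> * real M)"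
          by (intro Bochner_Integration.integrable_add integrable_mult_left) (auto simp: P.emeasure_eq_measure)
        have "AE p in \<nu> \<Otimes>\<^sub>M \<nu>. cmod (fst p) \<le> 2 \<and> cmod (snd p) \<le> 2"
        proof (rule P.AE_pair_measure)
          have "{p \<in> space (\<nu> \<Otimes>\<^sub>M \<nu>). cmod (fst p) \<le> 2 \<and> cmod (snd p) \<le> 2} \<in> sets (\<nu> \<Otimes>\<^sub>M \<nu>)"
            by measurable
          then show "{x \<in> space (\<nu> \<Otimes>\<^sub>M \<nu>). cmod (fst x) \<le> 2 \<and> cmod (snd x) \<le> 2} \<in> sets (\<nu> \<Otimes>\<^sub>M \<nu>)" .
          show "AE x in \<nu>. AE y in \<nu>. cmod (fst (x, y)) \<le> 2 \<and> cmod (snd (x, y)) \<le> 2"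
            using bounded
          proof eventually_elim
            case (elim x)
            show ?case using bounded by eventually_elim (use elim in simp)
          qed
        qed
        then show "AE p in \<nu> \<Otimes>\<^sub>M \<nu>. cmod (X p) \<le> indicator E p * real M + \<delta> * real M"
        proof eventually_elim
          case (elim p)
          have triv: "cmod (X p) \<le> real M"
          proof -
            have "cmod (X p) \<le> (\<Sum>i<M. 1)" unfolding X_def by (intro sum_norm_le) simp
            then show ?thesis by simp
          qed
          show ?case
          proof (cases "p \<in> E")
            case True
            moreover have "0 \<le> \<delta> * real M" using \<open>\<delta> > 0\<close> by simp
            ultimately show ?thesis using triv by simp
          next
            case False
            define z where "z = of_real s * (v * (fst p - snd p))"
            have "X p = (\<Sum>i<M. cis (Re (z * exp (of_nat i * \<gamma>))))"
              unfolding X_def z_def by (simp only: ac_simps)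
            moreover have "\<rho> \<le> arc_size u z"
            proof -
              have "\<rho> = \<rho> / d * d" using d by simp
              also have "\<dots> \<le> s * arc_size u (v * (fst p - snd p))"
                using False R s d \<rho> \<open>s > 0\<close> by (intro mult_mono) (auto simp: E_def)
              also have "\<dots> = arc_size u z" unfolding z_def using \<open>s > 0\<close> by (simp only: arc_size_scale less_imp_le)
              finally show ?thesis .
            qed
            moreover have "cmod z \<le> 4 * R'"
            proof -
              have "cmod z = s * cmod (fst p - snd p)" using V[OF v] \<open>s > 0\<close> by (simp add: z_def norm_mult)
              also have "\<dots> \<le> R' * 4"
                using elim s \<open>s > 0\<close> norm_triangle_ineq4[of "fst p" "snd p"] by (intro mult_mono) auto
              finally show ?thesis by simp
            qed
            ultimately have "cmod (X p) \<le> \<delta> * real M" using osc[OF M \<gamma>] by simp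
            then show ?thesis using False by simp
          qed
        qed
      qed
      also have "\<dots> = measure (\<nu> \<Otimes>\<^sub>M \<nu>) E * real M + \<delta> * real M"
        using P.prob_space by (subst Bochner_Integration.integral_add) (auto simp: P.emeasure_eq_measure)
      also have "\<dots> \<le> \<delta> * real M + \<delta> * real M"
        using d(2)[OF v] by (intro add_right_mono mult_right_mono) (auto simp: E_def)
      also have "\<dots> = \<epsilon>\<^sup>2 * real M" by (simp add: \<delta>_def)
      finally have "(\<Sum>i<M. (a i)\<^sup>2) \<le> \<epsilon>\<^sup>2 * real M" .
      then have "(\<Sum>i<M. (a i)\<^sup>2) * real M \<le> \<epsilon>\<^sup>2 * real M * real M" by (rule mult_right_mono) simp
      moreover have "(\<Sum>i<M. a i)\<^sup>2 \<le> (\<Sum>i<M. (a i)\<^sup>2) * real M"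
        using sum_squared_le_sum_of_squares[of a "{..<M}"] by simp
      ultimately have "(\<Sum>i<M. a i)\<^sup>2 \<le> (\<epsilon> * real M)\<^sup>2" by (simp add: power2_eq_square ac_simps)
      then have "(\<Sum>i<M. a i) \<le> \<epsilon> * real M" by (rule power2_le_imp_le) (use \<epsilon> in simp)
      then show ?thesis unfolding a_def .
    qed
    then have "arc_bound u V \<epsilon> R R' M0 \<epsilon>'" unfolding arc_bound_def by blast
    then show "\<exists>M0>0. \<exists>\<epsilon>'>0. arc_bound u V \<epsilon> R R' M0 \<epsilon>'" using M0 by blast
  qed
qed

text \<open>For nonreal \<open>u\<close> the arc size is the modulus, invariant under rotation by
  \<open>v\<close>, so one \<open>d\<close> serves the possibly infinite set
  \<open>V\<close>.\<close>

lemma small_circle_averages: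
  assumes u: "Im u \<noteq> 0" and \<epsilon>: "\<epsilon> > 0" and atoms: "\<And>a. measure \<nu> {a} = 0" and V: "\<And>v. v \<in> V \<Longrightarrow> cmod v = 1"
  shows "small_arc_averages u V \<epsilon>"
proof (rule small_arc_averages[OF _ \<epsilon> V])
  show "u \<noteq> 0" using u by auto
  fix e :: real assume e: "e > 0"
  have "{z. arc_size u (1 * (a - z)) = 0} = {a}" for a
    using u by (auto simp: arc_size_def)
  then obtain d where d: "d > 0" "measure (\<nu> \<Otimes>\<^sub>M \<nu>) {p. arc_size u (1 * (fst p - snd p)) < d} \<le> e"
    using near_diagonal[of u 1 e] atoms e by auto
  moreover have "arc_size u (v * z) = arc_size u (1 * z)" if "v \<in> V" for v z
    using u V[OF that] by (simp add: arc_size_def norm_mult)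
  ultimately show "\<exists>d>0. \<forall>v\<in>V. measure (\<nu> \<Otimes>\<^sub>M \<nu>) {p. arc_size u (v * (fst p - snd p)) < d} \<le> e"
    by (intro exI[of _ d]) auto
qed auto

text \<open>Here \<open>d\<close> depends on the direction \<open>v\<close>, and a minimum over the
  finite set \<open>V\<close> is taken.\<close>

lemma small_ray_averages:
  assumes u: "u \<noteq> 0" "Im u = 0" and \<epsilon>: "\<epsilon> > 0" and "finite V" and V: "\<And>v. v \<in> V \<Longrightarrow> cmod v = 1"
    and lines: "\<And>v s. v \<in> V \<Longrightarrow> measure \<nu> {z. Re (v * z) = s} = 0"
  shows "small_arc_averages u V \<epsilon>"
proof (rule small_arc_averages[OF u(1) \<epsilon> V])
  interpret P: pair_prob_space \<nu> \<nu> ..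
  fix e :: real assume e: "e > 0"
  have "\<exists>d>0. measure (\<nu> \<Otimes>\<^sub>M \<nu>) {p. arc_size u (v * (fst p - snd p)) < d} \<le> e" if v: "v \<in> V" for v
  proof -
    have "{z. arc_size u (v * (a - z)) = 0} = {z. Re (v * z) = Re (v * a)}" for a
      using u by (auto simp: arc_size_def algebra_simps)
    then have "measure \<nu> {z. arc_size u (v * (a - z)) = 0} = 0" for a
      using lines[OF v] by (simp del: times_complex.sel)
    from near_diagonal[OF this e] show ?thesis by blast
  qed
  then obtain d where d: "\<And>v. v \<in> V \<Longrightarrow> d v > 0" "\<And>v. v \<in> V \<Longrightarrow> measure (\<nu> \<Otimes>\<^sub>M \<nu>) {p. arc_size u (v * (fst p - snd p)) < d v} \<le> e"
    by metis
  define d0 where "d0 = Min (insert 1 (d ` V))"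
  have "d0 > 0" unfolding d0_def using \<open>finite V\<close> d by (subst Min_gr_iff) auto
  moreover have "measure (\<nu> \<Otimes>\<^sub>M \<nu>) {p. arc_size u (v * (fst p - snd p)) < d0} \<le> e" if v: "v \<in> V" for v
  proof -
    have m[measurable]: "(\<lambda>p. arc_size u (v * (fst p - snd p))) \<in> borel_measurable (\<nu> \<Otimes>\<^sub>M \<nu>)"
      unfolding arc_size_def by measurable
    have "{p \<in> space (\<nu> \<Otimes>\<^sub>M \<nu>). arc_size u (v * (fst p - snd p)) < d v} \<in> sets (\<nu> \<Otimes>\<^sub>M \<nu>)" by measurable
    moreover have "d0 \<le> d v" unfolding d0_def using \<open>finite V\<close> v by (intro Min_le) auto
    ultimately have "measure (\<nu> \<Otimes>\<^sub>M \<nu>) {p. arc_size u (v * (fst p - snd p)) < d0} \<le> measure (\<nu> \<Otimes>\<^sub>M \<nu>) {p. arc_size u (v * (fst p - snd p)) < d v}"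
      by (intro P.finite_measure_mono) (auto simp: space_pair_measure)
    then show ?thesis using d(2)[OF v] by linarith
  qed
  ultimately show "\<exists>d>0. \<forall>v\<in>V. measure (\<nu> \<Otimes>\<^sub>M \<nu>) {p. arc_size u (v * (fst p - snd p)) < d} \<le> e" by blast
qed auto

section \<open>Rotations with incommensurable quotients\<close>

text \<open>The n-th power of the Markov operator of the random walk on the circle with steps
  \<open>c k\<close>.\<close>

definition rot_avg :: "nat \<Rightarrow> (complex \<Rightarrow> real) \<Rightarrow> complex \<Rightarrow> real" where
  "rot_avg n F \<zeta> = wexp n (\<lambda>w. F (\<zeta> * rot w))"

lemma rot_append: "rot (u @ v) = rot u * rot v"
  by (simp add: rot_def)

lemma rot_avg_add: "rot_avg (m + n) F \<zeta> = wexp m (\<lambda>u. rot_avg n F (\<zeta> * rot u))"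
  unfolding rot_avg_def wexp_append by (simp add: rot_append mult.assoc)

lemma wexp_diff: "wexp n (\<lambda>w. F w - G w) = wexp n F - wexp n G"
  by (induction n arbitrary: F G) (simp_all add: sum_subtractf scaleR_diff_right)

lemma rot_avg_bounded:
  assumes "\<And>\<zeta>. \<bar>F \<zeta>\<bar> \<le> b"
  shows "\<bar>rot_avg n F \<zeta>\<bar> \<le> b"
  unfolding rot_avg_def using norm_wexp_le_const[of n "\<lambda>w. F (\<zeta> * rot w)" b] assms by simp

lemma wexp_ge_single:
  fixes F :: "nat list \<Rightarrow> real"
  assumes "\<And>w. w \<in> words n \<Longrightarrow> 0 \<le> F w" "w0 \<in> words n"
  shows "prod_list (map p w0) * F w0 \<le> wexp n F"
  using assms
proof (induction n arbitrary: F w0)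
  case (Suc n)
  obtain k w1 where w0: "w0 = k # w1" "k < l" "w1 \<in> words n"
    using Suc.prems(2) by (cases w0) (auto simp: words_def)
  have nn: "0 \<le> wexp n (\<lambda>w. F (j # w))" if "j < l" for j
    using wexp_mono[of n "\<lambda>_. 0" "\<lambda>w. F (j # w)"] Suc.prems(1)[OF Cons_in_words[OF that]] by (simp add: wexp_const)
  have "prod_list (map p w1) * F (k # w1) \<le> wexp n (\<lambda>w. F (k # w))"
    using w0 by (intro Suc.IH Suc.prems(1) Cons_in_words)
  then have "p k * (prod_list (map p w1) * F (k # w1)) \<le> p k * wexp n (\<lambda>w. F (k # w))"
    using w0 by (intro mult_left_mono p_nonneg)
  also have "\<dots> \<le> (\<Sum>j<l. p j * wexp n (\<lambda>w. F (j # w)))"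
    using w0 nn by (intro member_le_sum) (auto intro: mult_nonneg_nonneg p_nonneg)
  finally show ?case by (simp add: w0 mult.assoc)
qed (simp add: words_def)

text \<open>A maximum principle: where the \<open>n\<close>-fold average of \<open>F(\<zeta>) - F(\<zeta>g)\<close> is nearly extremal, it is
  so along a long orbit of \<open>g = c a / c b\<close>, on which the sum telescopes.\<close>

lemma rot_avg_shift_upper:
  assumes ab: "a < l" "b < l" and F: "\<And>\<zeta>. \<bar>F \<zeta>\<bar> \<le> 1" and "\<delta> > 0"
  shows "\<exists>I. \<forall>i\<ge>I. \<forall>\<zeta>. rot_avg i F \<zeta> - rot_avg i F (\<zeta> * (c a / c b)) \<le> \<delta>"
proof (rule ccontr)
  assume contra: "\<not> ?thesis"
  define g where "g = c a / c b"
  have cb: "c b \<noteq> 0" using norm_c[OF ab(2)] by auto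
  define G where "G i \<zeta> = rot_avg i F \<zeta> - rot_avg i F (\<zeta> * g)" for i \<zeta>
  have G_le: "\<bar>G i \<zeta>\<bar> \<le> 2" for i \<zeta>
    unfolding G_def using rot_avg_bounded[of F 1 i \<zeta>] rot_avg_bounded[of F 1 i "\<zeta> * g"] F by (simp add: abs_le_iff)
  have G_add: "G (m + i) \<zeta> = wexp m (\<lambda>u. G i (\<zeta> * rot u))" for m i \<zeta>
    unfolding G_def rot_avg_add wexp_diff by (simp add: ac_simps)
  define S where "S i = (SUP \<zeta>. G i \<zeta>)" for i
  have bdd: "bdd_above (range (G i))" for i
    using G_le by (auto intro!: bdd_aboveI[of _ 2] simp: abs_le_iff)
  have S_upper: "G i \<zeta> \<le> S i" for i \<zeta>
    unfolding S_def using bdd by (intro cSUP_upper) auto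
  have S_lower: "- 2 \<le> S i" for i
    using S_upper[of i 0] G_le[of i 0] by (simp add: abs_le_iff)
  have "decseq S"
  proof (rule decseq_SucI)
    fix i
    show "S (Suc i) \<le> S i"
    proof (unfold S_def[of "Suc i"], rule cSUP_least)
      fix \<zeta>
      have "G (1 + i) \<zeta> \<le> wexp 1 (\<lambda>_. S i)"
        unfolding G_add by (intro wexp_mono S_upper)
      then show "G (Suc i) \<zeta> \<le> S i" by (simp add: wexp_const)
    qed simp
  qed
  then obtain L where L: "S \<longlonglongrightarrow> L" "\<And>i. L \<le> S i"
    using decseq_convergent[of S "- 2"] S_lower by metis
  have S_big: "S i > \<delta>" for i
  proof -
    obtain i' \<zeta> where "i' \<ge> i" "G i' \<zeta> > \<delta>"
      using contra unfolding G_def g_def by (meson not_le)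
    then show ?thesis using S_upper[of i' \<zeta>] \<open>decseq S\<close>[THEN decseqD, of i i'] by linarith
  qed
  \<comment> \<open>Chosen so that m terms of size \<delta> / 2 exceed 2, the bound on the
    telescoped sum.\<close>
  define m where "m = nat \<lceil>4 / \<delta>\<rceil> + 1"
  define q where "q = min (p a) (p b)"
  have q: "q > 0" "q \<le> p a" "q \<le> p b" using p_pos ab by (auto simp: q_def)
  \<comment> \<open>Each word formed from \<open>a\<close> and \<open>b\<close> has weight at least
    \<open>q ^ m\<close>, so a total defect below 2 \<kappa> leaves each of them a defect below
    \<delta> / 2.\<close>
  define \<kappa> where "\<kappa> = \<delta> * q ^ m / 4"
  have "\<kappa> > 0" using q \<open>\<delta> > 0\<close> by (simp add: \<kappa>_def)
  have "eventually (\<lambda>i. S i < L + \<kappa>) sequentially"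
    using L(1) \<open>\<kappa> > 0\<close> by (intro order_tendstoD) auto
  then obtain i where i: "S i < L + \<kappa>" by (meson eventually_happens trivial_limit_sequentially)
  obtain \<zeta> where \<zeta>: "G (m + i) \<zeta> > S (m + i) - \<kappa>"
  proof (rule ccontr)
    assume "\<not> thesis"
    then have "\<And>\<zeta>. G (m + i) \<zeta> \<le> S (m + i) - \<kappa>" using that by (meson not_le)
    then have "S (m + i) \<le> S (m + i) - \<kappa>"
      by (subst (1) S_def) (rule cSUP_least, auto)
    then show False using \<open>\<kappa> > 0\<close> by simp
  qed
  have step: "G i (\<zeta> * c b ^ m * g ^ j) \<ge> \<delta> / 2" if j: "j < m" for j
  proof -
    define w where "w = replicate j a @ replicate (m - j) b"
    have w: "w \<in> words m" using j ab by (auto simp: w_def words_def)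
    have rw: "rot w = c b ^ m * g ^ j"
    proof -
      have "rot w = c a ^ j * c b ^ (m - j)" by (simp add: w_def rot_def)
      also have "c a = c b * g" using cb by (simp add: g_def)
      finally show ?thesis using j by (simp add: power_mult_distrib ac_simps flip: power_add)
    qed
    have "prod_list (map p w) = p a ^ j * p b ^ (m - j)" by (simp add: w_def)
    also have "\<dots> \<ge> q ^ j * q ^ (m - j)" using q by (intro mult_mono power_mono) auto
    finally have pw: "q ^ m \<le> prod_list (map p w)" using j by (simp flip: power_add)
    have nn: "0 \<le> S i - G i (\<zeta> * rot u)" for u using S_upper[of i "\<zeta> * rot u"] by simp
    have "q ^ m * (S i - G i (\<zeta> * rot w)) \<le> prod_list (map p w) * (S i - G i (\<zeta> * rot w))"
      by (rule mult_right_mono[OF pw nn])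
    also have "\<dots> \<le> wexp m (\<lambda>u. S i - G i (\<zeta> * rot u))"
      by (rule wexp_ge_single[OF nn w])
    also have "\<dots> = S i - G (m + i) \<zeta>" by (simp add: wexp_diff wexp_const G_add)
    also have "\<dots> < 2 * \<kappa>" using \<zeta> i L(2)[of "m + i"] by linarith
    also have "\<dots> = q ^ m * (\<delta> / 2)" by (simp add: \<kappa>_def)
    finally have "S i - G i (\<zeta> * rot w) < \<delta> / 2" using q by (simp add: mult_less_cancel_left_pos)
    then show ?thesis using S_big[of i] by (simp add: rw mult.assoc)
  qed
  have "real m * (\<delta> / 2) = (\<Sum>j<m. \<delta> / 2)" by simp
  also have "\<dots> \<le> (\<Sum>j<m. G i (\<zeta> * c b ^ m * g ^ j))" by (intro sum_mono step) auto
  also have "\<dots> = rot_avg i F (\<zeta> * c b ^ m) - rot_avg i F (\<zeta> * c b ^ m * g ^ m)"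
    using sum_lessThan_telescope'[of "\<lambda>j. rot_avg i F (\<zeta> * c b ^ m * g ^ j)" m]
    by (simp add: G_def ac_simps)
  also have "\<dots> \<le> 2"
    using rot_avg_bounded[of F 1 i "\<zeta> * c b ^ m"] rot_avg_bounded[of F 1 i "\<zeta> * c b ^ m * g ^ m"] F by (simp add: abs_le_iff)
  finally have "real m \<le> 4 / \<delta>" using \<open>\<delta> > 0\<close> by (simp add: field_simps)
  then show False unfolding m_def by linarith
qed

lemma rot_avg_shift_power:
  assumes ab: "a < l" "b < l" and F: "\<And>\<zeta>. \<bar>F \<zeta>\<bar> \<le> 1" and "\<delta> > 0"
  shows "\<exists>I. \<forall>i\<ge>I. \<forall>\<zeta>. \<forall>t\<le>T. rot_avg i F \<zeta> \<le> rot_avg i F (\<zeta> * (c a / c b) ^ t) + \<delta>"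
proof -
  define \<delta>' where "\<delta>' = \<delta> / (real T + 1)"
  have "\<delta>' > 0" using \<open>\<delta> > 0\<close> by (simp add: \<delta>'_def)
  obtain I where I: "\<And>i \<zeta>. i \<ge> I \<Longrightarrow> rot_avg i F \<zeta> - rot_avg i F (\<zeta> * (c a / c b)) \<le> \<delta>'"
    using rot_avg_shift_upper[OF ab, of F \<delta>'] F \<open>\<delta>' > 0\<close> by blast
  have "rot_avg i F \<zeta> \<le> rot_avg i F (\<zeta> * (c a / c b) ^ t) + real t * \<delta>'" if "i \<ge> I" for i \<zeta> t
  proof (induction t)
    case (Suc t)
    then show ?case using I[OF that, of "\<zeta> * (c a / c b) ^ t"] by (simp add: algebra_simps)
  qed simp
  moreover have "real t * \<delta>' \<le> \<delta>" if "t \<le> T" for t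
  proof -
    have "real t * \<delta>' \<le> (real T + 1) * \<delta>'" using that \<open>\<delta>' > 0\<close> by (intro mult_right_mono) auto
    then show ?thesis by (simp add: \<delta>'_def)
  qed
  ultimately show ?thesis by (intro exI[of _ I]) (meson add_left_mono order_trans)
qed

text \<open>The modulus is dominated by a long random-walk average, which is almost monotone along
  the powers of \<open>c a / c b\<close> and may thus be averaged over them. Suitable powers follow
  an arc of a circle, where \<open>small_circle_averages\<close> applies.\<close>

lemma char_fun_decay:
  assumes ab: "a < l" "b < l" and irr: "\<And>J. J > 0 \<Longrightarrow> c a ^ J \<noteq> c b ^ J"
    and atoms: "\<And>x. measure \<nu> {x} = 0" and "\<epsilon> > 0"
  obtains R where "R > 0" "\<And>\<xi>. cmod \<xi> \<ge> R \<Longrightarrow> cmod (char_fun \<xi>) \<le> \<epsilon>"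
proof -
  have nab: "cmod (c a) = 1" "cmod (c b) = 1" using norm_c ab by auto
  then have cb: "c b \<noteq> 0" "c a \<noteq> 0" by auto
  define \<alpha> where "\<alpha> = Arg (c a / c b)"
  have g: "c a / c b = cis \<alpha>"
    using cis_Arg[of "c a / c b"] nab cb by (auto simp: \<alpha>_def sgn_div_norm norm_divide)
  have irr\<alpha>: "\<alpha> / (2 * pi) \<notin> \<rat>"
  proof
    assume "\<alpha> / (2 * pi) \<in> \<rat>"
    then obtain x y :: int where xy: "y > 0" "\<alpha> / (2 * pi) = of_int x / of_int y"
      by (metis Rats_cases')
    then have "real (nat y) * \<alpha> = 2 * pi * of_int x" by (simp add: field_simps)
    then have "cis \<alpha> ^ nat y = 1" by (simp only: Complex.DeMoivre) (auto intro: cis_multiple_2pi)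
    then have "c a ^ nat y = c b ^ nat y" using cb by (simp flip: g add: power_divide)
    then show False using irr[of "nat y"] xy by simp
  qed
  have "small_arc_averages \<i> (sphere 0 1) (\<epsilon> / 2)"
    using atoms \<open>\<epsilon> > 0\<close> by (intro small_circle_averages) auto
  then obtain R0 where R0: "R0 > 0" and "\<exists>M0>0. \<exists>\<epsilon>'>0. arc_bound \<i> (sphere 0 1) (\<epsilon> / 2) R0 (R0 / r) M0 \<epsilon>'"
    unfolding small_arc_averages_def by blast
  then obtain M \<epsilon>' where M: "M > 0" "\<epsilon>' > 0" and "arc_bound \<i> (sphere 0 1) (\<epsilon> / 2) R0 (R0 / r) M \<epsilon>'" by blast
  note arc' = arc_boundD[OF this(3) order_refl]
  have "\<epsilon>' / (2 * pi * real M) > 0" using M by simp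
  \<comment> \<open>A power of \<open>c a / c b\<close> with angle close to 1 / M modulo 2 \<pi>, so
    that M of its powers run through an arc of angle about 1.\<close>
  then obtain n h where nh: "n > 0" "\<bar>of_int n * (\<alpha> / (2 * pi)) - of_int h - 1 / (2 * pi * real M)\<bar> < \<epsilon>' / (2 * pi * real M)"
    using sequence_of_fractional_parts_is_dense[OF irr\<alpha>, of "\<epsilon>' / (2 * pi * real M)" "1 / (2 * pi * real M)"] by blast
  define \<gamma> where "\<gamma> = \<i> * of_real (of_int n * \<alpha> - 2 * pi * of_int h)"
  have \<gamma>: "cmod (\<gamma> - \<i> / of_nat M) \<le> \<epsilon>' / real M"
  proof -
    have "\<gamma> - \<i> / of_nat M = \<i> * of_real (2 * pi * (of_int n * (\<alpha> / (2 * pi)) - of_int h - 1 / (2 * pi * real M)))"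
      by (simp add: \<gamma>_def field_simps)
    then have "cmod (\<gamma> - \<i> / of_nat M) = 2 * pi * \<bar>of_int n * (\<alpha> / (2 * pi)) - of_int h - 1 / (2 * pi * real M)\<bar>"
      by (simp only: norm_mult norm_ii norm_of_real abs_mult) simp
    also have "\<dots> \<le> 2 * pi * (\<epsilon>' / (2 * pi * real M))" using nh by (intro mult_left_mono) auto
    finally show ?thesis by simp
  qed
  have exp\<gamma>: "exp (of_nat i * \<gamma>) = (c a / c b) ^ (nat n * i)" for i
  proof -
    have "exp \<gamma> = cis (of_int n * \<alpha>) * exp (\<i> * of_real (2 * pi * of_int (- h)))"
      by (simp add: \<gamma>_def cis_conv_exp right_diff_distrib flip: exp_add)
    also have "exp (\<i> * of_real (2 * pi * of_int (- h))) = 1"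
      unfolding cis_conv_exp[symmetric] by (rule cis_multiple_2pi) simp
    also have "cis (of_int n * \<alpha>) = cis \<alpha> ^ nat n" using nh by (simp add: Complex.DeMoivre)
    finally show ?thesis by (simp add: exp_of_nat_mult g power_mult)
  qed
  define F where "F \<zeta> = cmod (char_fun \<zeta>)" for \<zeta>
  have F: "\<bar>F \<zeta>\<bar> \<le> 1" for \<zeta> using norm_char_fun_le by (simp add: F_def)
  obtain I where "\<forall>i\<ge>I. \<forall>\<zeta>. \<forall>t\<le>nat n * M. rot_avg i F \<zeta> \<le> rot_avg i F (\<zeta> * (c a / c b) ^ t) + \<epsilon> / 2"
    using rot_avg_shift_power[OF ab, of F "\<epsilon> / 2" "nat n * M"] F \<open>\<epsilon> > 0\<close> by auto
  note I = this[rule_format]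
  show ?thesis
  proof (rule that)
    show "R0 / r ^ I > 0" using R0 r by simp
    fix \<xi> assume \<xi>: "cmod \<xi> \<ge> R0 / r ^ I"
    \<comment> \<open>The last generation at which the frequency still has size at least
      \<open>R0\<close>; one more would fall below, hence the upper bound
      \<open>R0 / r\<close>.\<close>
    have "\<exists>i\<ge>I. R0 \<le> cmod \<xi> * r ^ i \<and> cmod \<xi> * r ^ i \<le> R0 / r"
    proof -
      have "(\<lambda>i. cmod \<xi> * r ^ i) \<longlonglongrightarrow> cmod \<xi> * 0" using r by (intro tendsto_mult_left LIMSEQ_realpow_zero) auto
      then have "eventually (\<lambda>i. cmod \<xi> * r ^ i < R0) sequentially" using R0 by (intro order_tendstoD) auto
      then obtain i0 where i0: "\<And>i. i \<ge> i0 \<Longrightarrow> cmod \<xi> * r ^ i < R0" unfolding eventually_sequentially by blast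
      have Ige: "R0 \<le> cmod \<xi> * r ^ I" using \<xi> r by (simp add: field_simps)
      define A where "A = {i. i \<ge> I \<and> R0 \<le> cmod \<xi> * r ^ i}"
      have "A \<subseteq> {..i0}" unfolding A_def using i0 by (auto simp: not_le intro!: leI dest!: less_imp_le)
         (meson leD nat_le_linear)
      then have "finite A" by (rule finite_subset) simp
      moreover have "I \<in> A" using Ige by (simp add: A_def)
      ultimately have mA: "Max A \<in> A" "Suc (Max A) \<notin> A" by (auto intro: Max_in dest: Max_ge)
      then have "cmod \<xi> * r ^ Suc (Max A) < R0" by (auto simp: A_def)
      then have "cmod \<xi> * r ^ Max A \<le> R0 / r" using r by (simp add: field_simps)
      then show ?thesis using mA by (auto simp: A_def)
    qed
    then obtain i where i: "i \<ge> I" "R0 \<le> cmod \<xi> * r ^ i" "cmod \<xi> * r ^ i \<le> R0 / r" by blast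
    define \<zeta> where "\<zeta> = \<xi> * of_real (r ^ i)"
    have n\<zeta>: "cmod \<zeta> = cmod \<xi> * r ^ i" using r by (simp add: \<zeta>_def norm_mult norm_power)
    have "F \<xi> \<le> rot_avg i F \<zeta>"
      unfolding F_def rot_avg_def \<zeta>_def by (rule norm_char_fun_le_words)
    moreover have "real M * rot_avg i F \<zeta> \<le> real M * \<epsilon>"
    proof -
      have "real M * rot_avg i F \<zeta> = (\<Sum>j<M. rot_avg i F \<zeta>)" by simp
      also have "\<dots> \<le> (\<Sum>j<M. rot_avg i F (\<zeta> * exp (of_nat j * \<gamma>)) + \<epsilon> / 2)"
        unfolding exp\<gamma> by (intro sum_mono I i) auto
      also have "\<dots> = wexp i (\<lambda>w. \<Sum>j<M. F (\<zeta> * exp (of_nat j * \<gamma>) * rot w)) + real M * (\<epsilon> / 2)"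
        by (simp add: sum.distrib rot_avg_def wexp_sum)
      also have "wexp i (\<lambda>w. \<Sum>j<M. F (\<zeta> * exp (of_nat j * \<gamma>) * rot w)) \<le> wexp i (\<lambda>w. \<epsilon> / 2 * real M)"
      proof (rule wexp_mono)
        fix w assume w: "w \<in> words i"
        have "\<zeta> \<noteq> 0" using n\<zeta> i R0 by auto
        define v where "v = sgn \<zeta> * rot w"
        have v: "v \<in> sphere 0 1" using norm_rot[OF w] \<open>\<zeta> \<noteq> 0\<close> by (simp add: v_def norm_mult norm_sgn)
        have "\<zeta> = of_real (cmod \<zeta>) * sgn \<zeta>"
          using \<open>\<zeta> \<noteq> 0\<close> by (simp add: sgn_div_norm scaleR_conv_of_real)
        then have eq: "\<zeta> * exp (of_nat j * \<gamma>) * rot w = of_real (cmod \<zeta>) * v * exp (of_nat j * \<gamma>)" for j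
          unfolding v_def by (metis mult.assoc mult.commute)
        show "(\<Sum>j<M. F (\<zeta> * exp (of_nat j * \<gamma>) * rot w)) \<le> \<epsilon> / 2 * real M"
          unfolding F_def eq by (rule arc'[OF \<gamma> v]) (use i n\<zeta> in auto)
      qed
      finally show ?thesis by (simp add: wexp_const mult.commute)
    qed
    then have "rot_avg i F \<zeta> \<le> \<epsilon>" using M(1) by simp
    ultimately show "cmod (char_fun \<xi>) \<le> \<epsilon>" by (simp add: F_def)
  qed
qed

section \<open>Schedules of comparable scale, and the case of decay\<close>

lemma natural_schedule:
  assumes \<kappa>: "\<kappa> > 1"
  obtains L :: "nat \<Rightarrow> nat" where "\<And>k. 1 \<le> \<kappa> ^ k * r ^ L k" "\<And>k. \<kappa> ^ k * r ^ L k \<le> 1 / r"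
proof -
  have "\<exists>L::nat. 1 \<le> \<kappa> ^ k * r ^ L \<and> \<kappa> ^ k * r ^ L \<le> 1 / r" for k
  proof -
    have "(\<lambda>i. \<kappa> ^ k * r ^ i) \<longlonglongrightarrow> \<kappa> ^ k * 0" using r by (intro tendsto_mult_left LIMSEQ_realpow_zero) auto
    then have "eventually (\<lambda>i. \<kappa> ^ k * r ^ i < 1) sequentially" by (intro order_tendstoD) auto
    then obtain i0 where "\<kappa> ^ k * r ^ i0 < 1" by (meson eventually_happens trivial_limit_sequentially)
    \<comment> \<open>The generation before this one is the witness: its size is at least 1 and at
      most 1 / r.\<close>
    define i where "i = (LEAST i. \<kappa> ^ k * r ^ i < 1)"
    have i: "\<kappa> ^ k * r ^ i < 1" unfolding i_def by (rule LeastI) fact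
    have "i \<noteq> 0"
    proof
      assume "i = 0"
      then have "\<kappa> ^ k < 1" using i by simp
      moreover have "1 \<le> \<kappa> ^ k" using \<kappa> by (intro one_le_power) simp
      ultimately show False by simp
    qed
    then obtain j where j: "i = Suc j" by (cases i) auto
    have "\<not> \<kappa> ^ k * r ^ j < 1" using not_less_Least[of j "\<lambda>i. \<kappa> ^ k * r ^ i < 1"] j by (simp add: i_def)
    then show ?thesis using i j r by (intro exI[of _ j]) (auto simp: field_simps)
  qed
  then show ?thesis using that by metis
qed

text \<open>Every single mean is small once its frequency exceeds \<open>R\<close>, so blocks of
  length 1 suffice. The shift \<open>s\<close> lifts all frequencies above \<open>R\<close>.\<close>

lemma good_schedule_decay:
  assumes ab: "a < l" "b < l" and irr: "\<And>J. J > 0 \<Longrightarrow> c a ^ J \<noteq> c b ^ J"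
    and atoms: "\<And>x. measure \<nu> {x} = 0" and \<epsilon>: "\<epsilon> > 0"
    and \<kappa>: "\<kappa> > 1" and \<eta>: "(\<lambda>k. \<eta> k / of_real \<kappa> ^ k) \<longlonglongrightarrow> \<eta>0" "\<eta>0 \<noteq> 0"
  shows "\<exists>s L. good_schedule \<kappa> (\<lambda>k. \<eta> (k + s)) \<epsilon> L"
proof -
  obtain R where R: "R > 0" "\<And>\<xi>. cmod \<xi> \<ge> R \<Longrightarrow> cmod (char_fun \<xi>) \<le> \<epsilon>"
    using char_fun_decay[OF ab irr atoms \<epsilon>] by blast
  obtain L :: "nat \<Rightarrow> nat" where L: "\<And>k. 1 \<le> \<kappa> ^ k * r ^ L k" "\<And>k. \<kappa> ^ k * r ^ L k \<le> 1 / r"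
    using natural_schedule[OF \<kappa>] by blast
  have "(\<lambda>k. cmod (\<eta> k / of_real \<kappa> ^ k)) \<longlonglongrightarrow> cmod \<eta>0" by (intro tendsto_norm \<eta>)
  then have "eventually (\<lambda>k. cmod (\<eta> k / of_real \<kappa> ^ k) > cmod \<eta>0 / 2) sequentially"
    using \<eta>(2) by (intro order_tendstoD) auto
  then obtain s0 where s0: "\<And>k. k \<ge> s0 \<Longrightarrow> cmod (\<eta> k / of_real \<kappa> ^ k) > cmod \<eta>0 / 2"
    unfolding eventually_sequentially by blast
  obtain s1 where s1: "R / (cmod \<eta>0 / 2) < \<kappa> ^ s1" using real_arch_pow[OF \<kappa>] by blast
  define s where "s = max s0 s1"
  have "\<kappa> ^ s1 \<le> \<kappa> ^ s" using \<kappa> by (intro power_increasing) (auto simp: s_def)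
  with s1 have "R / (cmod \<eta>0 / 2) < \<kappa> ^ s" by linarith
  then have s: "\<And>k. k \<ge> s \<Longrightarrow> cmod (\<eta> k / of_real \<kappa> ^ k) > cmod \<eta>0 / 2" "(cmod \<eta>0 / 2) * \<kappa> ^ s \<ge> R"
    using s0 \<eta>(2) by (auto simp: s_def field_simps)
  have big: "cmod (char_fun (\<eta> (k + s) * of_real (r ^ L k) * d)) \<le> \<epsilon>" if "d \<in> rot ` words (L k)" for k d
  proof (rule R(2))
    have "R \<le> ((cmod \<eta>0 / 2) * \<kappa> ^ s) * 1" using s(2) by simp
    also have "\<dots> \<le> ((cmod \<eta>0 / 2) * \<kappa> ^ s) * (\<kappa> ^ k * r ^ L k)"
      using L(1) \<kappa> by (intro mult_left_mono) auto
    also have "\<dots> = (cmod \<eta>0 / 2) * \<kappa> ^ (k + s) * r ^ L k" by (simp add: power_add)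
    also have "(cmod \<eta>0 / 2) * \<kappa> ^ (k + s) \<le> cmod (\<eta> (k + s))"
      using s(1)[of "k + s"] \<kappa> by (simp add: norm_divide norm_power field_simps)
    then have "(cmod \<eta>0 / 2) * \<kappa> ^ (k + s) * r ^ L k \<le> cmod (\<eta> (k + s)) * r ^ L k"
      using r by (intro mult_right_mono) auto
    also have "\<dots> = cmod (\<eta> (k + s) * of_real (r ^ L k) * d)"
      using that norm_rot r by (auto simp: norm_mult norm_power)
    finally show "R \<le> cmod (\<eta> (k + s) * of_real (r ^ L k) * d)" .
  qed
  have "good_schedule \<kappa> (\<lambda>k. \<eta> (k + s)) \<epsilon> L"
    unfolding good_schedule_def
  proof (intro conjI)
    show "\<exists>c1>0. \<exists>c2. \<forall>k. c1 \<le> \<kappa> ^ k * r ^ L k \<and> \<kappa> ^ k * r ^ L k \<le> c2"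
      using L by (intro exI[of _ 1]) auto
    show "\<exists>P>0. \<exists>B0. \<forall>B\<ge>B0. \<forall>d. (\<forall>k. d k \<in> rot ` words (L k)) \<longrightarrow>
        (\<Sum>k<P. cmod (char_fun (\<eta> (B * P + k + s) * of_real (r ^ L (B * P + k)) * d (B * P + k)))) \<le> \<epsilon> * real P"
      using big by (intro exI[of _ 1]) auto
  qed
  then show ?thesis by blast
qed

section \<open>Commensurable rotations and the scheduling argument\<close>

text \<open>For fixed residue t modulo q, the frequencies in a block form a geometric progression
  with ratio exp \<gamma>, up to a factor from a finite set and an error from replacing
  \<open>\<eta> k\<close> by its leading term.\<close>

lemma good_schedule_block:
  assumes J: "J > 0" "\<And>k. k < l \<Longrightarrow> c k ^ J = c 0 ^ J"
    and \<eta>: "(\<lambda>k. \<eta> k / of_real \<kappa> ^ k) \<longlonglongrightarrow> \<eta>0" "\<eta>0 \<noteq> 0"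
    and line: "\<And>s. \<not> (AE z in \<nu>. Re (sgn \<eta>0 * z) = s)"
    and \<epsilon>: "\<epsilon> > 0" and \<kappa>: "\<kappa> > 1" and irr: "ln r / ln \<kappa> \<notin> \<rat>"
  shows "\<exists>s L. good_schedule \<kappa> (\<lambda>k. \<eta> (k + s)) \<epsilon> L"
proof -
  have "l > 0" using p_sum by (cases l) auto
  have atoms: "measure \<nu> {a} = 0" for a by (rule no_atoms[OF line])
  define \<theta> where "\<theta> = Arg (c 0)"
  have c0: "c 0 = cis \<theta>" "cmod (c 0) = 1" "c 0 \<noteq> 0"
  proof -
    show "cmod (c 0) = 1" using norm_c \<open>l > 0\<close> by simp
    then show "c 0 \<noteq> 0" by auto
    then have "cis (Arg (c 0)) = sgn (c 0)" by (rule cis_Arg)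
    also have "sgn (c 0) = c 0" using \<open>cmod (c 0) = 1\<close> by (simp only: sgn_div_norm) simp
    finally show "c 0 = cis \<theta>" by (simp only: \<theta>_def)
  qed
  have sgn: "cmod (sgn \<eta>0) = 1" using \<eta>(2) by (simp add: norm_sgn)
  \<comment> \<open>What the rotation of a word can deviate from the power of \<open>c 0\<close> of
    the same length; finite because every quotient is a J-th root of unity.\<close>
  define \<Omega> where "\<Omega> = {rot w / c 0 ^ length w | w. set w \<subseteq> {..<l}}"
  have rotJ: "rot w ^ J = c 0 ^ (J * length w)" if "set w \<subseteq> {..<l}" for w
    using that
  proof (induction w)
    case (Cons k w)
    have "rot (k # w) ^ J = c k ^ J * rot w ^ J" by (simp add: rot_def power_mult_distrib)
    also have "c k ^ J = c 0 ^ J" using Cons.prems by (intro J(2)) auto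
    finally show ?case using Cons by (simp add: power_add)
  qed (simp add: rot_def)
  have "\<Omega> \<subseteq> {d. d ^ J = 1}"
    using rotJ c0 by (auto simp: \<Omega>_def power_divide mult.commute simp flip: power_mult)
  then have fin\<Omega>: "finite \<Omega>" using finite_roots_unity[of J] J(1) by (auto intro: finite_subset)
  have "1 \<in> \<Omega>" unfolding \<Omega>_def by (auto intro!: exI[of _ "[]"] simp: rot_def)
  have n\<Omega>: "cmod \<rho> = 1" if "\<rho> \<in> \<Omega>" for \<rho>
    using that norm_rot c0 by (auto simp: \<Omega>_def norm_divide norm_power words_def)
  define V where "V = {sgn \<eta>0 * c 0 ^ i * \<rho> | i \<rho>. \<rho> \<in> \<Omega>}"
  have nV: "cmod v = 1" if "v \<in> V" for v
    using that n\<Omega> sgn c0 by (auto simp: V_def norm_mult norm_power)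
  obtain u where u: "u \<noteq> 0" "Im u \<noteq> 0 \<or> (\<exists>N>0. cis \<theta> ^ N = 1)"
    "\<And>t. of_real t * u \<in> closure (log_group \<kappa> r \<theta>)"
    using log_group_drift[OF \<kappa> irr, of \<theta>] by blast
  \<comment> \<open>One share for each element of \<open>\<Omega>\<close> and one for the
    approximation of \<open>\<eta>\<close>; \<open>card \<Omega> + 1\<close> is at most twice
    \<open>card \<Omega>\<close>.\<close>
  define \<epsilon>1 where "\<epsilon>1 = \<epsilon> / (2 * real (card \<Omega>))"
  have card\<Omega>: "card \<Omega> \<ge> 1" using fin\<Omega> \<open>1 \<in> \<Omega>\<close> by (simp add: Suc_le_eq card_gt_0_iff) blast
  then have "\<epsilon>1 > 0" using \<epsilon> by (simp add: \<epsilon>1_def)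
  have averages: "small_arc_averages u' V \<epsilon>1" if u': "u' = u \<or> u' = - u" for u'
  proof (cases "Im u = 0")
    case False
    then show ?thesis using u' atoms \<open>\<epsilon>1 > 0\<close> nV by (intro small_circle_averages) auto
  next
    case True
    then obtain N where N: "N > 0" "c 0 ^ N = 1" using u(2) c0(1) by auto
    have cJN: "c k ^ (J * N) = 1" if "k < l" for k
    proof -
      have "c k ^ (J * N) = (c 0 ^ N) ^ J" using J(2)[OF that] by (simp add: power_mult) (simp flip: power_mult add: mult.commute)
      then show ?thesis using N by simp
    qed
    \<comment> \<open>\<open>no_lines\<close> speaks of rotations of actual words; since
      \<open>c 0\<close> has finite order here, the division by its power becomes a prefix of
      letters 0.\<close>
    have V_rot: "\<exists>w n. w \<in> words n \<and> v = sgn \<eta>0 * rot w" if v_in: "v \<in> V" for v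
    proof -
      obtain i w where v: "v = sgn \<eta>0 * c 0 ^ i * (rot w / c 0 ^ length w)" "set w \<subseteq> {..<l}"
        using v_in unfolding V_def \<Omega>_def by blast
      obtain N' where N': "N = Suc N'" using N(1) by (cases N) auto
      define w' where "w' = replicate (i + N' * length w) 0 @ w"
      have "c 0 ^ (N' * length w) * c 0 ^ length w = (c 0 ^ N) ^ length w"
        unfolding N' power_mult[symmetric] power_add[symmetric] by (simp add: add.commute)
      then have "c 0 ^ (N' * length w) * c 0 ^ length w = 1" by (simp add: N)
      then have inv: "1 / c 0 ^ length w = c 0 ^ (N' * length w)" using c0(3) by (simp add: divide_eq_eq)
      have rw': "rot w' = c 0 ^ (i + N' * length w) * rot w" by (simp add: w'_def rot_def)
      have "v = sgn \<eta>0 * c 0 ^ i * (rot w * (1 / c 0 ^ length w))" unfolding v(1) by simp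
      also have "\<dots> = sgn \<eta>0 * rot w'" unfolding inv rw' power_add by (simp only: mult_ac)
      finally have "v = sgn \<eta>0 * rot w'" .
      moreover have "w' \<in> words (length w')" using v(2) \<open>l > 0\<close> by (auto simp: w'_def words_def)
      ultimately show ?thesis by blast
    qed
    show ?thesis
    proof (rule small_ray_averages)
      show "u' \<noteq> 0" "Im u' = 0" using u' u(1) True by auto
      have "V \<subseteq> (\<lambda>d. sgn \<eta>0 * d) ` {d. d ^ (J * N) = 1}"
      proof
        fix v assume "v \<in> V"
        then obtain w n where w: "w \<in> words n" "v = sgn \<eta>0 * rot w" using V_rot by blast
        have "rot w ^ (J * N) = 1" if "set w \<subseteq> {..<l}" for w
          using that by (induction w) (auto simp: rot_def power_mult_distrib cJN)
        then show "v \<in> (\<lambda>d. sgn \<eta>0 * d) ` {d. d ^ (J * N) = 1}" using w by (auto simp: words_def)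
      qed
      moreover have "finite {d :: complex. d ^ (J * N) = 1}" using J(1) N(1) by (intro finite_roots_unity) simp
      ultimately show "finite V" by (meson finite_imageI finite_subset)
      fix v s assume "v \<in> V"
      then obtain w n where w: "w \<in> words n" "v = sgn \<eta>0 * rot w" using V_rot by blast
      show "measure \<nu> {z. Re (v * z) = s} = 0"
        unfolding w(2) by (rule no_lines[OF line sgn _ cJN w(1)]) (use J(1) N(1) in auto)
    qed (use \<open>\<epsilon>1 > 0\<close> nV in auto)
  qed
  \<comment> \<open>The sign in \<open>log_group_step\<close> is not under control and may change
    with M, so both arcs are prepared before M is fixed.\<close>
  obtain Ra where Ra: "Ra > 0" "\<And>R R'. R \<ge> Ra \<Longrightarrow> \<exists>M0>0. \<exists>\<epsilon>'>0. arc_bound u V \<epsilon>1 R R' M0 \<epsilon>'"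
    using averages[of u] unfolding small_arc_averages_def by blast
  obtain Rb where Rb: "Rb > 0" "\<And>R R'. R \<ge> Rb \<Longrightarrow> \<exists>M0>0. \<exists>\<epsilon>'>0. arc_bound (- u) V \<epsilon>1 R R' M0 \<epsilon>'"
    using averages[of "- u"] unfolding small_arc_averages_def by blast
  \<comment> \<open>Shifting time by \<open>s\<close> multiplies the frequencies by
    \<open>\<kappa> ^ s\<close>, which lifts the starting points of all arcs into the range from
    \<open>R\<close> to \<open>R / r\<close>.\<close>
  obtain s where s: "max Ra Rb / cmod \<eta>0 < \<kappa> ^ s" using real_arch_pow[OF \<kappa>] by blast
  define R where "R = cmod \<eta>0 * \<kappa> ^ s"
  have R: "R \<ge> Ra" "R \<ge> Rb" "R > 0"
  proof -
    have "max Ra Rb < R" using s \<eta>(2) by (simp add: R_def field_simps)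
    then show "R \<ge> Ra" "R \<ge> Rb" "R > 0" using Ra(1) by auto
  qed
  obtain Ma ea where a: "Ma > 0" "ea > 0" "arc_bound u V \<epsilon>1 R (R / r) Ma ea" using Ra(2)[OF R(1)] by blast
  obtain Mb eb where b: "Mb > 0" "eb > 0" "arc_bound (- u) V \<epsilon>1 R (R / r) Mb eb" using Rb(2)[OF R(2)] by blast
  define e where "e = min (min ea eb) (cmod u / 2)"
  have e: "0 < e" "e < cmod u" "e \<le> ea" "e \<le> eb" using a b u(1) by (auto simp: e_def min_less_iff_disj)
  obtain M1 where M1: "M1 > 0" "\<And>M. M \<ge> M1 \<Longrightarrow> \<exists>q>0. \<exists>j>0. \<exists>\<gamma>. exp \<gamma> = of_real \<kappa> ^ q * (of_real r * cis \<theta>) ^ j \<and>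
     (cmod (\<gamma> - u / of_nat M) \<le> e / real M \<or> cmod (\<gamma> - (- u) / of_nat M) \<le> e / real M)"
    using log_group_step[OF \<kappa> r u(3) e(1,2)] by blast
  define M where "M = max M1 (max Ma Mb)"
  have M: "M \<ge> M1" "M \<ge> Ma" "M \<ge> Mb" "M > 0" using M1(1) by (auto simp: M_def)
  obtain q j \<gamma> where qj: "q > 0" "j > 0" and exp\<gamma>: "exp \<gamma> = of_real \<kappa> ^ q * (of_real r * c 0) ^ j"
    and \<gamma>: "cmod (\<gamma> - u / of_nat M) \<le> e / real M \<or> cmod (\<gamma> - (- u) / of_nat M) \<le> e / real M"
    using M1(2)[OF M(1)] c0(1) by auto
  have arc: "(\<Sum>i<M. cmod (char_fun (of_real x * v * exp (of_nat i * \<gamma>)))) \<le> \<epsilon>1 * real M"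
    if "v \<in> V" "R \<le> x" "x \<le> R / r" for x v
    using \<gamma>
  proof
    assume "cmod (\<gamma> - u / of_nat M) \<le> e / real M"
    also have "\<dots> \<le> ea / real M" using e by (intro divide_right_mono) auto
    finally show ?thesis using arc_boundD[OF a(3) M(2)] that by blast
  next
    assume "cmod (\<gamma> - (- u) / of_nat M) \<le> e / real M"
    also have "\<dots> \<le> eb / real M" using e by (intro divide_right_mono) auto
    finally show ?thesis using arc_boundD[OF b(3) M(3)] that by blast
  qed
  obtain fl :: "nat \<Rightarrow> nat" where fl: "\<And>k. 1 \<le> \<kappa> ^ k * r ^ fl k" "\<And>k. \<kappa> ^ k * r ^ fl k \<le> 1 / r"
    using natural_schedule[OF \<kappa>] by blast
  define P where "P = M * q"
  have "P > 0" using M qj by (simp add: P_def)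
  \<comment> \<open>At position i q + t of a block: the natural generation of the start t, plus j
    generations for each of the i completed rounds of q time steps.\<close>
  define L where "L k = fl (k div P * P + k mod P mod q) + j * (k mod P div q)" for k
  have L_block: "L (B * P + (i * q + t)) = fl (B * P + t) + j * i" if "i < M" "t < q" for B i t
  proof -
    have "i * q + t < P"
    proof -
      have "i * q + t < (i + 1) * q" using that by simp
      also have "\<dots> \<le> M * q" using that by (intro mult_right_mono) auto
      finally show ?thesis by (simp add: P_def)
    qed
    then have "(B * P + (i * q + t)) div P = B" "(B * P + (i * q + t)) mod P = i * q + t"
      using \<open>P > 0\<close> by auto
    then show ?thesis using that by (simp add: L_def)
  qed
  have decomp: "\<exists>B i t. i < M \<and> t < q \<and> k = B * P + (i * q + t)" for k
  proof (intro exI conjI)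
    show "k mod P div q < M"
      using \<open>P > 0\<close> by (simp add: P_def less_mult_imp_div_less)
    show "k mod P mod q < q" using qj by simp
    show "k = k div P * P + (k mod P div q * q + k mod P mod q)" by simp
  qed
  have norm_exp: "\<kappa> ^ q * r ^ j = exp (Re \<gamma>)"
  proof -
    have "exp (Re \<gamma>) = cmod (of_real \<kappa> ^ q * (of_real r * c 0) ^ j)" by (simp flip: exp\<gamma>)
    also have "\<dots> = \<kappa> ^ q * r ^ j" using \<kappa> r c0(2) by (simp add: norm_mult norm_power)
    finally show ?thesis ..
  qed
  have size: "\<kappa> ^ (B * P + (i * q + t)) * r ^ L (B * P + (i * q + t)) = (\<kappa> ^ (B * P + t) * r ^ fl (B * P + t)) * exp (real i * Re \<gamma>)"
    if "i < M" "t < q" for B i t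
  proof -
    have "\<kappa> ^ (B * P + (i * q + t)) * r ^ L (B * P + (i * q + t)) = (\<kappa> ^ (B * P + t) * r ^ fl (B * P + t)) * (\<kappa> ^ q * r ^ j) ^ i"
      unfolding L_block[OF that] by (simp add: power_add power_mult power_mult_distrib mult_ac) (simp add: mult.commute flip: power_mult)
    then show ?thesis by (simp add: norm_exp exp_of_nat_mult)
  qed
  \<comment> \<open>The size drifts by exp (Re \<gamma>) per round, for fewer than M rounds.\<close>
  define c1 where "c1 = exp (- (real M * \<bar>Re \<gamma>\<bar>))"
  define c2 where "c2 = 1 / r * exp (real M * \<bar>Re \<gamma>\<bar>)"
  have bounds: "c1 \<le> \<kappa> ^ k * r ^ L k" "\<kappa> ^ k * r ^ L k \<le> c2" for k
  proof -
    obtain B i t where k: "i < M" "t < q" "k = B * P + (i * q + t)" using decomp by blast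
    have "\<bar>real i * Re \<gamma>\<bar> \<le> real M * \<bar>Re \<gamma>\<bar>" using k(1) unfolding abs_mult by (intro mult_mono) auto
    then have ex: "c1 \<le> exp (real i * Re \<gamma>)" "exp (real i * Re \<gamma>) \<le> exp (real M * \<bar>Re \<gamma>\<bar>)" by (auto simp: c1_def abs_le_iff)
    have "1 * c1 \<le> (\<kappa> ^ (B * P + t) * r ^ fl (B * P + t)) * exp (real i * Re \<gamma>)"
      using fl(1)[of "B * P + t"] ex by (intro mult_mono) (auto simp: c1_def)
    then show "c1 \<le> \<kappa> ^ k * r ^ L k" unfolding k(3) size[OF k(1,2)] by simp
    show "\<kappa> ^ k * r ^ L k \<le> c2" unfolding k(3) size[OF k(1,2)] c2_def
      using fl(2)[of "B * P + t"] ex r by (intro mult_mono) auto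
  qed
  have "c1 > 0" "c2 > 0" using r by (auto simp: c1_def c2_def)
  \<comment> \<open>Makes the replacement error, with Lipschitz constant 2 and scale at most
    \<open>\<kappa> ^ s * c2\<close>, equal to \<open>\<epsilon>1\<close>.\<close>
  define \<delta> where "\<delta> = \<epsilon>1 / (2 * \<kappa> ^ s * c2)"
  have "\<delta> > 0" using \<open>\<epsilon>1 > 0\<close> \<open>c2 > 0\<close> \<kappa> by (simp add: \<delta>_def)
  then obtain k0 where k0: "\<And>k. k \<ge> k0 \<Longrightarrow> dist (\<eta> k / of_real \<kappa> ^ k) \<eta>0 < \<delta>"
    using metric_LIMSEQ_D[OF \<eta>(1)] by blast
  have approx: "cmod (\<eta> k - \<eta>0 * of_real \<kappa> ^ k) \<le> \<delta> * \<kappa> ^ k" if "k \<ge> k0" for k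
  proof -
    have "\<eta> k - \<eta>0 * of_real \<kappa> ^ k = (\<eta> k / of_real \<kappa> ^ k - \<eta>0) * of_real \<kappa> ^ k"
      using \<kappa> by (simp add: left_diff_distrib)
    then have "cmod (\<eta> k - \<eta>0 * of_real \<kappa> ^ k) = dist (\<eta> k / of_real \<kappa> ^ k) \<eta>0 * \<kappa> ^ k"
      using \<kappa> by (simp add: norm_mult norm_power dist_norm)
    then show ?thesis using k0[OF that] \<kappa> by (simp add: mult_right_mono)
  qed
  have "good_schedule \<kappa> (\<lambda>k. \<eta> (k + s)) \<epsilon> L"
    unfolding good_schedule_def
  proof (intro conjI)
    show "\<exists>c1>0. \<exists>c2. \<forall>k. c1 \<le> \<kappa> ^ k * r ^ L k \<and> \<kappa> ^ k * r ^ L k \<le> c2"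
      using bounds \<open>c1 > 0\<close> by blast
    have block: "(\<Sum>k<P. cmod (char_fun (\<eta> (B * P + k + s) * of_real (r ^ L (B * P + k)) * d (B * P + k)))) \<le> \<epsilon> * real P"
      if B: "B \<ge> k0" and d: "\<And>k. d k \<in> rot ` words (L k)" for B d
    proof -
      define f where "f k = cmod (char_fun (\<eta> (k + s) * of_real (r ^ L k) * d k))" for k
      define \<zeta> where "\<zeta> t = \<eta>0 * of_real (\<kappa> ^ s * (\<kappa> ^ (B * P + t) * r ^ fl (B * P + t))) * c 0 ^ fl (B * P + t)" for t
      have term_le: "f (B * P + (i * q + t)) \<le> (\<Sum>\<rho>\<in>\<Omega>. cmod (char_fun (\<zeta> t * \<rho> * exp (of_nat i * \<gamma>)))) + \<epsilon>1"
        if it: "i < M" "t < q" for i t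
      proof -
        define k where "k = B * P + (i * q + t)"
        have Lk: "L k = fl (B * P + t) + j * i" unfolding k_def by (rule L_block[OF it])
        obtain w where w: "w \<in> words (L k)" "d k = rot w" using d[of k] by auto
        define \<rho> where "\<rho> = rot w / c 0 ^ L k"
        have \<rho>: "\<rho> \<in> \<Omega>" using w unfolding \<Omega>_def \<rho>_def words_def by (auto intro!: exI[of _ w])
        have dk: "d k = c 0 ^ L k * \<rho>" using w c0(3) by (simp add: \<rho>_def)
        have main: "\<eta>0 * of_real \<kappa> ^ (k + s) * of_real (r ^ L k) * d k = \<zeta> t * \<rho> * exp (of_nat i * \<gamma>)"
        proof -
          have "exp (of_nat i * \<gamma>) = of_real \<kappa> ^ (q * i) * of_real r ^ (j * i) * c 0 ^ (j * i)"
            by (simp add: exp_of_nat_mult exp\<gamma> power_mult_distrib power_mult)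
          then show ?thesis unfolding dk \<zeta>_def Lk
            by (simp add: k_def power_add mult_ac)
        qed
        have "B \<le> B * P" using \<open>P > 0\<close> by simp
        then have ks: "k + s \<ge> k0" using B unfolding k_def by linarith
        have nd: "cmod (d k) = 1" using w norm_rot by simp
        have "cmod (char_fun (\<eta> (k + s) * of_real (r ^ L k) * d k) - char_fun (\<zeta> t * \<rho> * exp (of_nat i * \<gamma>))) \<le> \<epsilon>1"
        proof -
          have "cmod (char_fun (\<eta> (k + s) * of_real (r ^ L k) * d k) - char_fun (\<zeta> t * \<rho> * exp (of_nat i * \<gamma>)))
              \<le> 2 * cmod (\<eta> (k + s) * of_real (r ^ L k) * d k - \<zeta> t * \<rho> * exp (of_nat i * \<gamma>))"
            by (rule char_fun_lipschitz)
          also have "\<eta> (k + s) * of_real (r ^ L k) * d k - \<zeta> t * \<rho> * exp (of_nat i * \<gamma>)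
              = (\<eta> (k + s) - \<eta>0 * of_real \<kappa> ^ (k + s)) * of_real (r ^ L k) * d k"
            unfolding main[symmetric] by (simp add: algebra_simps)
          also have "cmod \<dots> = cmod (\<eta> (k + s) - \<eta>0 * of_real \<kappa> ^ (k + s)) * r ^ L k"
            using nd r by (simp add: norm_mult norm_power)
          also have "2 * \<dots> \<le> 2 * (\<delta> * \<kappa> ^ (k + s) * r ^ L k)"
            using approx[OF ks] r by (intro mult_left_mono mult_right_mono) auto
          also have "\<dots> = 2 * \<delta> * \<kappa> ^ s * (\<kappa> ^ k * r ^ L k)" by (simp add: power_add)
          also have "\<dots> \<le> 2 * \<delta> * \<kappa> ^ s * c2" using bounds \<open>\<delta> > 0\<close> \<kappa> by (intro mult_left_mono) auto
          also have "\<dots> = \<epsilon>1" using \<open>c2 > 0\<close> \<kappa> by (simp add: \<delta>_def)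
          finally show ?thesis .
        qed
        then have "f k \<le> cmod (char_fun (\<zeta> t * \<rho> * exp (of_nat i * \<gamma>))) + \<epsilon>1"
          unfolding f_def using norm_triangle_sub[of "char_fun (\<eta> (k + s) * of_real (r ^ L k) * d k)" "char_fun (\<zeta> t * \<rho> * exp (of_nat i * \<gamma>))"] by linarith
        also have "cmod (char_fun (\<zeta> t * \<rho> * exp (of_nat i * \<gamma>))) \<le> (\<Sum>\<rho>\<in>\<Omega>. cmod (char_fun (\<zeta> t * \<rho> * exp (of_nat i * \<gamma>))))"
          using \<rho> fin\<Omega> by (intro member_le_sum) auto
        finally show ?thesis unfolding k_def by simp
      qed
      have arc_t: "(\<Sum>i<M. cmod (char_fun (\<zeta> t * \<rho> * exp (of_nat i * \<gamma>)))) \<le> \<epsilon>1 * real M" if \<rho>: "\<rho> \<in> \<Omega>" for t \<rho>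
      proof -
        define x where "x = R * (\<kappa> ^ (B * P + t) * r ^ fl (B * P + t))"
        define v where "v = sgn \<eta>0 * c 0 ^ fl (B * P + t) * \<rho>"
        have \<eta>0_eq: "of_real (cmod \<eta>0) * sgn \<eta>0 = \<eta>0" using \<eta>(2) by (simp add: sgn_div_norm scaleR_conv_of_real)
        have "of_real x * v = of_real (cmod \<eta>0) * sgn \<eta>0 * of_real (\<kappa> ^ s * (\<kappa> ^ (B * P + t) * r ^ fl (B * P + t))) * c 0 ^ fl (B * P + t) * \<rho>"
          unfolding x_def v_def R_def by (simp only: of_real_mult mult_ac)
        then have "\<zeta> t * \<rho> = of_real x * v" unfolding \<eta>0_eq by (simp only: \<zeta>_def)
        moreover have "v \<in> V" using \<rho> by (auto simp: V_def v_def)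
        moreover have "R \<le> x" using fl(1)[of "B * P + t"] R(3) by (simp add: x_def)
        moreover have "x \<le> R / r" using mult_left_mono[OF fl(2)[of "B * P + t"], of R] R(3) by (simp add: x_def)
        ultimately show ?thesis using arc by simp
      qed
      have "(\<Sum>k<P. f (B * P + k)) = (\<Sum>i<M. \<Sum>k\<in>{i * q..<i * q + q}. f (B * P + k))"
        unfolding P_def by (rule sum.nat_group[symmetric])
      also have "\<dots> = (\<Sum>i<M. \<Sum>t<q. f (B * P + (i * q + t)))"
      proof (rule sum.cong[OF refl])
        fix i
        show "(\<Sum>k\<in>{i * q..<i * q + q}. f (B * P + k)) = (\<Sum>t<q. f (B * P + (i * q + t)))"
          using sum.shift_bounds_nat_ivl[of "\<lambda>k. f (B * P + k)" 0 "i * q" q]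
          by (simp only: lessThan_atLeast0 add_0 add_0_right add.commute[of _ "i * q"])
      qed
      also have "\<dots> \<le> (\<Sum>i<M. \<Sum>t<q. (\<Sum>\<rho>\<in>\<Omega>. cmod (char_fun (\<zeta> t * \<rho> * exp (of_nat i * \<gamma>)))) + \<epsilon>1)"
        by (intro sum_mono term_le) auto
      also have "\<dots> = (\<Sum>t<q. \<Sum>i<M. (\<Sum>\<rho>\<in>\<Omega>. cmod (char_fun (\<zeta> t * \<rho> * exp (of_nat i * \<gamma>)))) + \<epsilon>1)"
        by (rule sum.swap)
      also have "\<dots> = (\<Sum>t<q. (\<Sum>\<rho>\<in>\<Omega>. \<Sum>i<M. cmod (char_fun (\<zeta> t * \<rho> * exp (of_nat i * \<gamma>)))) + real M * \<epsilon>1)"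
      proof (rule sum.cong[OF refl])
        fix t
        show "(\<Sum>i<M. (\<Sum>\<rho>\<in>\<Omega>. cmod (char_fun (\<zeta> t * \<rho> * exp (of_nat i * \<gamma>)))) + \<epsilon>1)
          = (\<Sum>\<rho>\<in>\<Omega>. \<Sum>i<M. cmod (char_fun (\<zeta> t * \<rho> * exp (of_nat i * \<gamma>)))) + real M * \<epsilon>1"
          unfolding sum.distrib by (subst sum.swap) simp
      qed
      also have "\<dots> \<le> (\<Sum>t<q. (\<Sum>\<rho>\<in>\<Omega>. \<epsilon>1 * real M) + real M * \<epsilon>1)"
        by (intro sum_mono add_right_mono arc_t)
      also have "\<dots> = (real (card \<Omega>) + 1) * (\<epsilon>1 * real P)"
        by (simp add: P_def algebra_simps)
      also have "\<dots> \<le> (2 * real (card \<Omega>)) * (\<epsilon>1 * real P)"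
        using card\<Omega> \<open>\<epsilon>1 > 0\<close> by (intro mult_right_mono) auto
      also have "\<dots> = \<epsilon> * real P" using card\<Omega> by (simp add: \<epsilon>1_def)
      finally show ?thesis unfolding f_def .
    qed
    show "\<exists>P>0. \<exists>B0. \<forall>B\<ge>B0. \<forall>d. (\<forall>k. d k \<in> rot ` words (L k)) \<longrightarrow>
        (\<Sum>k<P. cmod (char_fun (\<eta> (B * P + k + s) * of_real (r ^ L (B * P + k)) * d (B * P + k)))) \<le> \<epsilon> * real P"
      using block \<open>P > 0\<close> by (intro exI[of _ P] conjI exI[of _ k0]) auto
  qed
  then show ?thesis by blast
qed

text \<open>Either some quotient \<open>c a / c b\<close> has infinite order and the characteristic
  function decays, or all \<open>c k\<close> have a power in common and the block schedule
  applies.\<close>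

lemma AE_characters_equidistribute:
  assumes \<kappa>: "\<kappa> > 1" and irr: "ln r / ln \<kappa> \<notin> \<rat>"
    and \<eta>: "(\<lambda>k. \<eta> k / of_real \<kappa> ^ k) \<longlonglongrightarrow> \<eta>0" "\<eta>0 \<noteq> 0"
    and line: "\<And>s. \<not> (AE z in \<nu>. Re (sgn \<eta>0 * z) = s)"
  shows "AE z in \<nu>. (\<lambda>N. (\<Sum>k<N. cis (Re (\<eta> k * z))) / of_nat N) \<longlonglongrightarrow> 0"
proof -
  have "Bseq (\<lambda>k. \<eta> k / of_real \<kappa> ^ k)" using \<eta>(1) by (intro convergent_imp_Bseq) (auto simp: convergent_def)
  then obtain C where C: "\<And>k. cmod (\<eta> k / of_real \<kappa> ^ k) \<le> C" by (auto simp: Bseq_def)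
  have "cmod (\<eta> k) \<le> C * \<kappa> ^ k" for k
    using C[of k] \<kappa> by (simp add: norm_divide norm_power field_simps)
  then show ?thesis
  proof (rule AE_character_average_tendsto_0[OF \<kappa>])
    fix \<epsilon> :: real assume \<epsilon>: "\<epsilon> > 0"
    show "\<exists>s L. good_schedule \<kappa> (\<lambda>k. \<eta> (k + s)) \<epsilon> L"
    proof (cases "\<exists>a b. a < l \<and> b < l \<and> (\<forall>J>0. c a ^ J \<noteq> c b ^ J)")
      case True
      then obtain a b where "a < l" "b < l" "\<And>J. J > 0 \<Longrightarrow> c a ^ J \<noteq> c b ^ J" by blast
      then show ?thesis by (rule good_schedule_decay[OF _ _ _ no_atoms[OF line] \<epsilon> \<kappa> \<eta>])
    next
      case False
      have "l > 0" using p_sum by (cases l) auto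
      then have "\<forall>k<l. \<exists>J>0. c k ^ J = c 0 ^ J" using False by blast
      then obtain J where J: "\<And>k. k < l \<Longrightarrow> J k > 0 \<and> c k ^ J k = c 0 ^ J k" by metis
      \<comment> \<open>A common multiple of the exponents found for the single letters.\<close>
      define J0 where "J0 = (\<Prod>k<l. J k)"
      have "J0 > 0" unfolding J0_def using J by (intro prod_pos) auto
      moreover have "c k ^ J0 = c 0 ^ J0" if "k < l" for k
      proof -
        have "J k dvd J0" unfolding J0_def using that by (intro dvd_prodI) auto
        then obtain m where "J0 = J k * m" by (auto simp: dvd_def)
        then show ?thesis using J[OF that] by (simp add: power_mult)
      qed
      ultimately show ?thesis by (rule good_schedule_block[OF _ _ \<eta> line \<epsilon> \<kappa> irr])
    qed
  qed
qed

end

section \<open>Passage to the complex plane\<close>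

definition vec_complex :: "real^2 \<Rightarrow> complex" where
  "vec_complex x = Complex (x $ 1) (x $ 2)"

lemma measurable_vec_complex[measurable]: "vec_complex \<in> borel_measurable borel"
proof -
  have eq: "vec_complex = (\<lambda>x. of_real (x $ 1) + \<i> * of_real (x $ 2))"
    by (simp add: vec_complex_def fun_eq_iff complex_eq_iff)
  show ?thesis unfolding eq by (intro borel_measurable_continuous_onI continuous_intros)
qed

text \<open>Unit columns and determinant 1 make a sum of two squares vanish, which identifies the
  matrix with multiplication by its first column.\<close>

lemma rotation_matrix_2:
  fixes Q :: "real^2^2"
  assumes "rotation_matrix Q"
  shows "cmod (Complex (Q $ 1 $ 1) (Q $ 2 $ 1)) = 1"
    and "vec_complex (Q *v x) = Complex (Q $ 1 $ 1) (Q $ 2 $ 1) * vec_complex x"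
proof -
  have "transpose Q ** Q = mat 1" and det: "Q $ 1 $ 1 * Q $ 2 $ 2 - Q $ 1 $ 2 * Q $ 2 $ 1 = 1"
    using assms by (auto simp: rotation_matrix_def orthogonal_matrix_def det_2)
  then have "(transpose Q ** Q) $ i $ i = 1" for i by (simp add: mat_def)
  from this[of 1] this[of 2] have cols: "(Q $ 1 $ 1)\<^sup>2 + (Q $ 2 $ 1)\<^sup>2 = 1" "(Q $ 1 $ 2)\<^sup>2 + (Q $ 2 $ 2)\<^sup>2 = 1"
    by (simp_all add: matrix_matrix_mult_def transpose_def sum_2 power2_eq_square)
  then show "cmod (Complex (Q $ 1 $ 1) (Q $ 2 $ 1)) = 1" by (simp add: cmod_def)
  have "(Q $ 1 $ 1 - Q $ 2 $ 2)\<^sup>2 + (Q $ 1 $ 2 + Q $ 2 $ 1)\<^sup>2 = 0"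
    using cols det by (simp add: power2_eq_square algebra_simps)
  then have "Q $ 2 $ 2 = Q $ 1 $ 1" "Q $ 1 $ 2 = - Q $ 2 $ 1"
    by (simp_all add: sum_power2_eq_zero_iff)
  then show "vec_complex (Q *v x) = Complex (Q $ 1 $ 1) (Q $ 2 $ 1) * vec_complex x"
    by (simp add: vec_complex_def matrix_vector_mult_def sum_2 complex_eq_iff)
qed

text \<open>The open ball around \<open>x\<close> that just reaches the hyperplane misses it, hence
  is null.\<close>

lemma msupp_subset_hyperplane:
  assumes "sets \<mu> = sets borel" "AE x in \<mu>. x $ i = s"
  shows "msupp \<mu> \<subseteq> {x. x $ i = s}"
proof
  fix x assume x: "x \<in> msupp \<mu>"
  show "x \<in> {x. x $ i = s}"
  proof (rule ccontr)
    assume "x \<notin> {x. x $ i = s}"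
    then have "\<bar>x $ i - s\<bar> > 0" by simp
    then have "emeasure \<mu> (ball x \<bar>x $ i - s\<bar>) > 0" using x unfolding msupp_def by blast
    moreover have "AE y in \<mu>. y \<notin> ball x \<bar>x $ i - s\<bar>"
      using assms(2)
    proof eventually_elim
      case (elim y)
      have "\<bar>x $ i - y $ i\<bar> \<le> dist x y"
        using component_le_norm_cart[of "x - y" i] by (simp add: dist_norm)
      then show ?case using elim by simp
    qed
    then have "emeasure \<mu> (ball x \<bar>x $ i - s\<bar>) = 0"
      using assms(1) by (subst (asm) AE_iff_null_sets[symmetric]) auto
    ultimately show False by simp
  qed
qed

theorem theorem1p2:
  fixes m n l :: nat and r :: real
    and p :: "nat \<Rightarrow> real" and Q :: "nat \<Rightarrow> real^2^2" and t :: "nat \<Rightarrow> real^2"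
    and \<mu> :: "(real^2) measure"
  assumes mn: "m > n" "n > 1"
    and r: "0 < r" "r < 1"
    and irr_m: "ln r / ln m \<notin> \<rat>"
    and irr_n: "ln r / ln n \<notin> \<rat>"
    and rot: "\<forall>k<l. rotation_matrix (Q k)"
    and p_pos: "\<forall>k<l. p k > 0"
    and p_sum: "(\<Sum>k<l. p k) = 1"
    and prob: "prob_space \<mu>"
    and borel: "sets \<mu> = sets borel"
    and in_square: "emeasure \<mu> (cbox 0 One) = 1"
    and self_sim: "\<forall>A\<in>sets borel. measure \<mu> A = (\<Sum>k<l. p k * measure \<mu> (sim_map r Q t k -` A))"
    and ssc: "strong_separation l (sim_map r Q t)"
    and not_vert: "\<not> (\<exists>c. msupp \<mu> \<subseteq> {x. x $ 1 = c})"
    and not_horiz: "\<not> (\<exists>c. msupp \<mu> \<subseteq> {x. x $ 2 = c})"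
    and cond2: "finite (gen_group (DPhi l Q)) \<or> measure_dim \<mu> > 1"
    and cond3: "kPhi l Q \<noteq> \<infinity> \<longrightarrow>
       (\<forall>q::int. q \<noteq> 0 \<longrightarrow>
          q / ln m \<notin> {of_int z * (gammaPhi l Q / (ln r * real (the_enat (kPhi l Q)))) | z. True} \<and>
          q / ln n \<notin> {of_int z * (gammaPhi l Q / (ln r * real (the_enat (kPhi l Q)))) | z. True})"
  shows "pointwise_generic \<mu> (Tmn m n) leb_square"
proof -
  interpret M: prob_space \<mu> by (rule prob)
  define \<nu> where "\<nu> = distr \<mu> borel vec_complex"
  define c where "c k = Complex (Q k $ 1 $ 1) (Q k $ 2 $ 1)" for k
  define \<tau> where "\<tau> k = vec_complex (t k)" for k
  have V[measurable]: "vec_complex \<in> measurable \<mu> borel"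
    by (subst measurable_cong_sets[OF borel refl]) measurable
  have space\<mu>: "space \<mu> = UNIV" using sets_eq_imp_space_eq[OF borel] by simp
  have conj: "vec_complex (sim_map r Q t k x) = of_real r * c k * vec_complex x + \<tau> k" if "k < l" for k x
  proof -
    have "vec_complex (sim_map r Q t k x) = of_real r * vec_complex (Q k *v x) + \<tau> k"
      by (simp add: vec_complex_def sim_map_def \<tau>_def complex_eq_iff)
    then show ?thesis using rot that rotation_matrix_2(2) by (simp add: c_def mult.assoc)
  qed
  interpret self_similar \<nu> l r p c \<tau>
  proof (intro self_similar.intro self_similar_axioms.intro)
    show "prob_space \<nu>" unfolding \<nu>_def by (rule M.prob_space_distr) measurable
    show "sets \<nu> = sets borel" by (simp add: \<nu>_def)
    show "cmod (c k) = 1" if "k < l" for k using rot that rotation_matrix_2(1) by (simp add: c_def)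
    have "AE x in \<mu>. x \<in> cbox 0 One"
      using in_square borel M.prob_space by (intro M.AE_prob_1) (simp add: measure_def)
    then have "AE x in \<mu>. cmod (vec_complex x) \<le> 2"
    proof eventually_elim
      case (elim x)
      then have "\<bar>x $ 1\<bar> \<le> 1" "\<bar>x $ 2\<bar> \<le> 1" by (auto simp: mem_box_cart One_nth_2)
      then show ?case using cmod_le[of "vec_complex x"] by (simp add: vec_complex_def)
    qed
    then show "AE z in \<nu>. cmod z \<le> 2" unfolding \<nu>_def by (subst AE_distr_iff) auto
    fix A :: "complex set" assume A[measurable]: "A \<in> sets borel"
    have mA: "measure \<nu> B = measure \<mu> (vec_complex -` B)" if "B \<in> sets borel" for B
      unfolding \<nu>_def using that by (simp add: measure_distr space\<mu>)
    have VA: "vec_complex -` A \<in> sets borel" using measurable_sets[OF measurable_vec_complex A] by simp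
    have "measure \<nu> A = (\<Sum>k<l. p k * measure \<mu> (sim_map r Q t k -` (vec_complex -` A)))"
      using self_sim VA mA[OF A] by simp
    also have "\<dots> = (\<Sum>k<l. p k * measure \<nu> ((\<lambda>z. of_real r * c k * z + \<tau> k) -` A))"
    proof (rule sum.cong[OF refl])
      fix k assume "k \<in> {..<l}"
      then have "sim_map r Q t k -` (vec_complex -` A) = vec_complex -` ((\<lambda>z. of_real r * c k * z + \<tau> k) -` A)"
        using conj by auto
      moreover have "(\<lambda>z. of_real r * c k * z + \<tau> k) \<in> borel_measurable borel" by measurable
      from measurable_sets[OF this A] have "(\<lambda>z. of_real r * c k * z + \<tau> k) -` A \<in> sets borel" by simp
      ultimately show "p k * measure \<mu> (sim_map r Q t k -` (vec_complex -` A)) = p k * measure \<nu> ((\<lambda>z. of_real r * c k * z + \<tau> k) -` A)"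
        by (simp add: mA)
    qed
    finally show "measure \<nu> A = (\<Sum>k<l. p k * measure \<nu> ((\<lambda>z. of_real r * c k * z + \<tau> k) -` A))" .
  qed (use r p_pos p_sum in auto)
  have not_Re: "\<not> (AE z in \<nu>. Re z = s)" for s
  proof
    assume "AE z in \<nu>. Re z = s"
    from AE_distrD[OF V this[unfolded \<nu>_def]] have "AE x in \<mu>. x $ 1 = s" by (simp add: vec_complex_def)
    from msupp_subset_hyperplane[OF borel this] show False using not_vert by blast
  qed
  have not_Im: "\<not> (AE z in \<nu>. Im z = s)" for s
  proof
    assume "AE z in \<nu>. Im z = s"
    from AE_distrD[OF V this[unfolded \<nu>_def]] have "AE x in \<mu>. x $ 2 = s" by (simp add: vec_complex_def)
    from msupp_subset_hyperplane[OF borel this] show False using not_horiz by blast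
  qed
  have char: "AE x in \<mu>. (\<lambda>N. (\<Sum>k<N. tchar a b ((Tmn m n ^^ k) x)) / of_nat N) \<longlonglongrightarrow> 0" if ab: "(a, b) \<noteq> (0, 0)" for a b
  proof -
    \<comment> \<open>The minus sign compensates the sign of the imaginary parts in Re (\<eta>
      z).\<close>
    define \<eta> where "\<eta> k = Complex (2 * pi * of_int a * real m ^ k) (- 2 * pi * of_int b * real n ^ k)" for k
    have tchar_eq: "tchar a b ((Tmn m n ^^ k) x) = cis (Re (\<eta> k * vec_complex x))" for k x
      unfolding tchar_Tmn_funpow by (simp add: tchar_def \<eta>_def vec_complex_def algebra_simps)
    \<comment> \<open>As m > n, the base \<open>m\<close> dominates whenever a is nonzero, and the
      limit frequency is real; otherwise the base is \<open>n\<close> and the frequency purely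
      imaginary. The corresponding lines are the vertical and the horizontal ones.\<close>
    have "AE z in \<nu>. (\<lambda>N. (\<Sum>k<N. cis (Re (\<eta> k * z))) / of_nat N) \<longlonglongrightarrow> 0"
    proof (cases "a = 0")
      case False
      define \<eta>0 where "\<eta>0 = complex_of_real (2 * pi * of_int a)"
      show ?thesis
      proof (rule AE_characters_equidistribute[of "real m" \<eta> \<eta>0])
        show "real m > 1" "ln r / ln (real m) \<notin> \<rat>" using mn irr_m by auto
        show "\<eta>0 \<noteq> 0" using False by (simp add: \<eta>0_def)
        have "(\<lambda>k. \<eta>0 - \<i> * of_real (2 * pi * of_int b * (real n / real m) ^ k)) \<longlonglongrightarrow> \<eta>0 - \<i> * of_real (2 * pi * of_int b * 0)"
          using mn by (intro tendsto_intros LIMSEQ_realpow_zero) auto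
        moreover have "\<eta> k / of_real (real m) ^ k = \<eta>0 - \<i> * of_real (2 * pi * of_int b * (real n / real m) ^ k)" for k
        proof -
          have "\<eta> k = of_real (2 * pi * of_int a * real m ^ k) - \<i> * of_real (2 * pi * of_int b * real n ^ k)"
            by (simp add: \<eta>_def complex_eq_iff)
          then show ?thesis using mn by (simp add: \<eta>0_def diff_divide_distrib power_divide)
        qed
        ultimately show "(\<lambda>k. \<eta> k / of_real (real m) ^ k) \<longlonglongrightarrow> \<eta>0" by simp
        have "sgn \<eta>0 = of_real (sgn (of_int a))"
          using False unfolding \<eta>0_def sgn_of_real by (simp add: sgn_mult)
        then have "Re (sgn \<eta>0 * z) = sgn (of_int a) * Re z" for z by simp
        moreover have "sgn (of_int a) * x = s \<longleftrightarrow> x = sgn (of_int a) * s" for x s :: real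
          using False by (auto simp: sgn_if)
        ultimately show "\<not> (AE z in \<nu>. Re (sgn \<eta>0 * z) = s)" for s
          using not_Re by (simp del: times_complex.sel)
      qed
    next
      case True
      define \<eta>0 where "\<eta>0 = - \<i> * complex_of_real (2 * pi * of_int b)"
      have b: "b \<noteq> 0" using True ab by simp
      show ?thesis
      proof (rule AE_characters_equidistribute[of "real n" \<eta> \<eta>0])
        show "real n > 1" "ln r / ln (real n) \<notin> \<rat>" using mn irr_n by auto
        show "\<eta>0 \<noteq> 0" using b by (simp add: \<eta>0_def)
        have "\<eta> k / of_real (real n) ^ k = \<eta>0" for k
        proof -
          have "\<eta> k = - \<i> * of_real (2 * pi * of_int b * real n ^ k)"
            using True by (simp add: \<eta>_def complex_eq_iff)
          then show ?thesis using mn by (simp add: \<eta>0_def)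
        qed
        then show "(\<lambda>k. \<eta> k / of_real (real n) ^ k) \<longlonglongrightarrow> \<eta>0" by simp
        have "sgn \<eta>0 = - \<i> * of_real (sgn (of_int b))"
          using b unfolding \<eta>0_def sgn_mult sgn_of_real by (simp add: sgn_mult sgn_div_norm)
        then have "Re (sgn \<eta>0 * z) = sgn (of_int b) * Im z" for z by simp
        moreover have "sgn (of_int b) * x = s \<longleftrightarrow> x = sgn (of_int b) * s" for x s :: real
          using b by (auto simp: sgn_if)
        ultimately show "\<not> (AE z in \<nu>. Re (sgn \<eta>0 * z) = s)" for s
          using not_Im by (simp del: times_complex.sel)
      qed
    qed
    from AE_distrD[OF V this[unfolded \<nu>_def]] show ?thesis unfolding tchar_eq .
  qed
  \<comment> \<open>There are countably many characters, so one null set serves them all.\<close>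
  have "AE x in \<mu>. \<forall>a b. (a, b) \<noteq> (0, 0) \<longrightarrow> (\<lambda>N. (\<Sum>k<N. tchar a b ((Tmn m n ^^ k) x)) / of_nat N) \<longlonglongrightarrow> 0"
    unfolding AE_all_countable using char by (auto intro: AE_I2)
  then show ?thesis
    unfolding pointwise_generic_def
    by eventually_elim (auto intro!: Weyl_torus_continuous simp: equidistributed_def)
qed

end
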